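(* Let $X$ and $Y$ be free $\mathbb Z_2$-spaces and $f:X\to Y$ an equivariant continuous map. Assume that (a) $\operatorname{h-ind}_2(Y)=k$, (b) $\dim X=k$, (c) $H^k(X;\mathbb Z_2)\cong H^k(Y;\mathbb Z_2)\cong\mathbb Z_2$, (d) $f^*:H^k(Y;\mathbb Z_2)\to H^k(X;\mathbb Z_2)$ is an isomorphism. Then $\operatorname{h-ind}_2(X)=k$.
   Context: A free $\mathbb Z_2$-space is a paracompact (Hausdorff) space $X$ with a free continuous involution $T$. $H^*$ denotes Čech cohomology, and $\dim$ is the (covering) dimension. For a free $\mathbb Z_2$-space $X$ let $w(X)\in H^1(X/T;\mathbb Z_2)$ be the first Stiefel–Whitney class of the real line bundle $(X\times\mathbb R)/T\to X/T$, where $T$ acts on $X\times\mathbb R$ by $(x,t)\mapsto(Tx,-t)$. The index $\operatorname{h-ind}_2(X)$ is the greatest $n$ such that $w(X)^n\neq0$ in $H^n(X/T;\mathbb Z_2)$ (and $\infty$ if there is no greatest such $n$). *)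

theory Defs
  imports "HOL-Analysis.Analysis" "HOL-Algebra.Elementary_Groups" "HOL-Library.Z2"
begin

section \<open>Open covers, paracompactness, covering dimension\<close>

definition open_cover :: "'a topology \<Rightarrow> 'a set set \<Rightarrow> bool" where
  "open_cover X \<U> \<longleftrightarrow> (\<forall>U\<in>\<U>. openin X U) \<and> \<Union>\<U> = topspace X"

definition refines :: "'a set set \<Rightarrow> 'a set set \<Rightarrow> bool" where
  "refines \<V> \<U> \<longleftrightarrow> (\<forall>V\<in>\<V>. \<exists>U\<in>\<U>. V \<subseteq> U)"

definition paracompact_space :: "'a topology \<Rightarrow> bool" where
  "paracompact_space X \<longleftrightarrow>
     (\<forall>\<U>. open_cover X \<U> \<longrightarrow> (\<exists>\<V>. open_cover X \<V> \<and> refines \<V> \<U> \<and> locally_finite_in X \<V>))"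

definition covering_dim_le :: "'a topology \<Rightarrow> int \<Rightarrow> bool" where
  "covering_dim_le X n \<longleftrightarrow>
     (\<forall>\<U>. open_cover X \<U> \<longrightarrow>
        (\<exists>\<V>. open_cover X \<V> \<and> refines \<V> \<U> \<and>
           (\<forall>x\<in>topspace X. finite {V\<in>\<V>. x \<in> V} \<and> int (card {V\<in>\<V>. x \<in> V}) \<le> n + 1)))"

text \<open>
  The definition uses arbitrary open covers. On paracompact Hausdorff spaces this agrees with the
  variant for finite open covers, by a theorem of Dowker. The empty space has dimension \<open>-1\<close>; the
  value is \<open>\<infinity>\<close> if there is no bound.
\<close>

definition covering_dim :: "'a topology \<Rightarrow> ereal" where
  "covering_dim X = (INF n\<in>{n. - 1 \<le> n \<and> covering_dim_le X n}. ereal (real_of_int n))"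

section \<open>Cech cohomology with coefficients in the constant sheaf \<open>\<int>/2\<close>\<close>

text \<open>
  An \<open>n\<close>-cochain of a cover \<open>\<U>\<close> assigns to every tuple \<open>us = [U\<^sub>0, \<dots>, U\<^sub>n]\<close> of members of \<open>\<U>\<close> a
  section of the constant sheaf over \<open>U\<^sub>0 \<inter> \<dots> \<inter> U\<^sub>n\<close>, i.e. a locally constant function with values
  in the two-element field. Cochains are total functions of \<open>us\<close> and of the point; the values at
  other lists, and at points outside the intersection, carry no information, and everything below
  compares cochains only where they are meaningful (\<open>cochain_agree\<close>).
\<close>

type_synonym 'a cochain = "'a set list \<Rightarrow> 'a \<Rightarrow> bit"

type_synonym 'a cech_class = "('a set set \<times> 'a cochain) set"

definition tuples :: "nat \<Rightarrow> 'a set set \<Rightarrow> 'a set list set" where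
  "tuples n \<U> = {us. length us = Suc n \<and> set us \<subseteq> \<U>}"

definition cochains :: "nat \<Rightarrow> 'a topology \<Rightarrow> 'a set set \<Rightarrow> 'a cochain set" where
  "cochains n X \<U> =
     {c. \<forall>us\<in>tuples n \<U>. continuous_map (subtopology X (\<Inter>(set us))) (discrete_topology UNIV) (c us)}"

definition cochain_agree :: "nat \<Rightarrow> 'a set set \<Rightarrow> 'a cochain \<Rightarrow> 'a cochain \<Rightarrow> bool" where
  "cochain_agree n \<U> a b \<longleftrightarrow> (\<forall>us\<in>tuples n \<U>. \<forall>x\<in>\<Inter>(set us). a us x = b us x)"

text \<open>The usual alternating signs play no role in characteristic 2.\<close>

definition coboundary :: "'a cochain \<Rightarrow> 'a cochain" where
  "coboundary c = (\<lambda>us x. \<Sum>i<length us. c (take i us @ drop (Suc i) us) x)"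

definition cocycles :: "nat \<Rightarrow> 'a topology \<Rightarrow> 'a set set \<Rightarrow> 'a cochain set" where
  "cocycles n X \<U> =
     {c \<in> cochains n X \<U>. cochain_agree (Suc n) \<U> (coboundary c) (\<lambda>us x. 0)}"

definition cohomologous :: "nat \<Rightarrow> 'a topology \<Rightarrow> 'a set set \<Rightarrow> 'a cochain \<Rightarrow> 'a cochain \<Rightarrow> bool" where
  "cohomologous n X \<U> a b \<longleftrightarrow>
     (case n of
        0 \<Rightarrow> cochain_agree 0 \<U> a b
      | Suc m \<Rightarrow> \<exists>e\<in>cochains m X \<U>. cochain_agree n \<U> (\<lambda>us x. a us x - b us x) (coboundary e))"

text \<open>
  A map of covers over \<open>f\<close>; for \<open>f = id\<close> these are the refinement maps.
\<close>

definition cover_map :: "('a \<Rightarrow> 'b) \<Rightarrow> 'a set set \<Rightarrow> 'b set set \<Rightarrow> ('a set \<Rightarrow> 'b set) \<Rightarrow> bool" where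
  "cover_map f \<U> \<V> \<phi> \<longleftrightarrow> (\<forall>U\<in>\<U>. \<phi> U \<in> \<V> \<and> f ` U \<subseteq> \<phi> U)"

definition pullback_cochain :: "('a \<Rightarrow> 'b) \<Rightarrow> ('a set \<Rightarrow> 'b set) \<Rightarrow> 'b cochain \<Rightarrow> 'a cochain" where
  "pullback_cochain f \<phi> c = (\<lambda>us x. c (map \<phi> us) (f x))"

text \<open>
  \<open>H\<^sup>n(X)\<close> is the direct limit of the groups \<open>H\<^sup>n(\<U>)\<close> over the open covers \<open>\<U>\<close> of \<open>X\<close>, directed by
  refinement. Its elements are the classes of pairs of an open cover \<open>\<U>\<close> and a cocycle of \<open>\<U>\<close>,
  where two pairs are identified if they become cohomologous on some common refinement.
\<close>

definition cech_cocycles :: "nat \<Rightarrow> 'a topology \<Rightarrow> ('a set set \<times> 'a cochain) set" where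
  "cech_cocycles n X = {(\<U>, c). open_cover X \<U> \<and> c \<in> cocycles n X \<U>}"

definition cech_rel ::
    "nat \<Rightarrow> 'a topology \<Rightarrow> (('a set set \<times> 'a cochain) \<times> ('a set set \<times> 'a cochain)) set" where
  "cech_rel n X =
     {((\<U>, a), (\<V>, b)). (\<U>, a) \<in> cech_cocycles n X \<and> (\<V>, b) \<in> cech_cocycles n X \<and>
        (\<exists>\<W> r s. open_cover X \<W> \<and> cover_map id \<W> \<U> r \<and> cover_map id \<W> \<V> s \<and>
           cohomologous n X \<W> (pullback_cochain id r a) (pullback_cochain id s b))}"

definition cech_class_of :: "nat \<Rightarrow> 'a topology \<Rightarrow> 'a set set \<Rightarrow> 'a cochain \<Rightarrow> 'a cech_class" where
  "cech_class_of n X \<U> c = cech_rel n X `` {(\<U>, c)}"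

text \<open>
  Any two classes have representatives on a common cover. Operations on classes are given, as usual
  for quotients, by the union of the classes obtained from all admissible choices of representatives;
  all these classes coincide.
\<close>

definition cech_add :: "nat \<Rightarrow> 'a topology \<Rightarrow> 'a cech_class \<Rightarrow> 'a cech_class \<Rightarrow> 'a cech_class" where
  "cech_add n X A B =
     \<Union>{cech_class_of n X \<U> (\<lambda>us x. a us x + b us x) | \<U> a b. (\<U>, a) \<in> A \<and> (\<U>, b) \<in> B}"

definition cech_zero :: "nat \<Rightarrow> 'a topology \<Rightarrow> 'a cech_class" where
  "cech_zero n X = cech_class_of n X {topspace X} (\<lambda>us x. 0)"

definition cech_cohomology :: "nat \<Rightarrow> 'a topology \<Rightarrow> 'a cech_class monoid" where
  "cech_cohomology n X =
     \<lparr>carrier = cech_cocycles n X // cech_rel n X,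
      monoid.mult = cech_add n X, one = cech_zero n X\<rparr>"

definition cech_induced ::
    "nat \<Rightarrow> 'a topology \<Rightarrow> 'b topology \<Rightarrow> ('a \<Rightarrow> 'b) \<Rightarrow> 'b cech_class \<Rightarrow> 'a cech_class" where
  "cech_induced n X Y f B =
     \<Union>{cech_class_of n X \<U> (pullback_cochain f \<phi> b) | \<U> \<phi> \<V> b.
         (\<V>, b) \<in> B \<and> open_cover X \<U> \<and> cover_map f \<U> \<V> \<phi>}"

definition cup_cochain :: "nat \<Rightarrow> 'a cochain \<Rightarrow> 'a cochain \<Rightarrow> 'a cochain" where
  "cup_cochain p a b = (\<lambda>us x. a (take (Suc p) us) x * b (drop p us) x)"

definition cech_cup ::
    "nat \<Rightarrow> nat \<Rightarrow> 'a topology \<Rightarrow> 'a cech_class \<Rightarrow> 'a cech_class \<Rightarrow> 'a cech_class" where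
  "cech_cup p q X A B =
     \<Union>{cech_class_of (p + q) X \<U> (cup_cochain p a b) | \<U> a b. (\<U>, a) \<in> A \<and> (\<U>, b) \<in> B}"

definition cech_unit :: "'a topology \<Rightarrow> 'a cech_class" where
  "cech_unit X = cech_class_of 0 X {topspace X} (\<lambda>us x. 1)"

text \<open>Cup powers of a class \<open>w \<in> H\<^sup>1(X)\<close>.\<close>

primrec cech_power :: "'a topology \<Rightarrow> 'a cech_class \<Rightarrow> nat \<Rightarrow> 'a cech_class" where
  "cech_power X w 0 = cech_unit X"
| "cech_power X w (Suc n) = cech_cup n 1 X (cech_power X w n) w"

section \<open>The first Stiefel--Whitney class of a real line bundle\<close>

text \<open>
  A real line bundle is given by its base \<open>B\<close>, its total space \<open>E\<close>, the projection \<open>\<pi>\<close> and the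
  fibrewise scalar multiplication \<open>m\<close>. A local trivialization over \<open>U\<close> is the same as a nowhere
  vanishing section over \<open>U\<close>.
\<close>

definition nonvanishing_section ::
    "'b topology \<Rightarrow> 'e topology \<Rightarrow> ('e \<Rightarrow> 'b) \<Rightarrow> (real \<Rightarrow> 'e \<Rightarrow> 'e) \<Rightarrow> 'b set \<Rightarrow> ('b \<Rightarrow> 'e) \<Rightarrow> bool" where
  "nonvanishing_section B E \<pi> m U s \<longleftrightarrow>
     continuous_map (subtopology B U) E s \<and> (\<forall>b\<in>U. \<pi> (s b) = b \<and> s b \<noteq> m 0 (s b))"

text \<open>
  The class \<open>w\<^sub>1 \<in> H\<^sup>1(B; \<int>/2)\<close> is represented by the signs of the transition functions between the
  local trivializations over the members of any trivializing open cover, \<open>0\<close> standing for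
  positive and \<open>1\<close> for negative.
\<close>

definition first_SW_class ::
    "'b topology \<Rightarrow> 'e topology \<Rightarrow> ('e \<Rightarrow> 'b) \<Rightarrow> (real \<Rightarrow> 'e \<Rightarrow> 'e) \<Rightarrow> 'b cech_class" where
  "first_SW_class B E \<pi> m =
     \<Union>{cech_class_of 1 B \<U> c | \<U> c. open_cover B \<U> \<and>
         (\<exists>s. (\<forall>U\<in>\<U>. nonvanishing_section B E \<pi> m U (s U)) \<and>
              (\<forall>U\<in>\<U>. \<forall>V\<in>\<U>. \<forall>b\<in>U \<inter> V. \<exists>g. s V b = m g (s U b) \<and> c [U, V] b = of_bool (g < 0)))}"

section \<open>Free \<open>\<int>/2\<close>-spaces and their index\<close>

definition free_Z2_space :: "'a topology \<Rightarrow> ('a \<Rightarrow> 'a) \<Rightarrow> bool" where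
  "free_Z2_space X T \<longleftrightarrow> paracompact_space X \<and> Hausdorff_space X \<and> continuous_map X X T \<and>
     (\<forall>x\<in>topspace X. T (T x) = x \<and> T x \<noteq> x)"

text \<open>The quotient of \<open>X\<close> by an involution \<open>T\<close>; its points are the orbits \<open>{x, T x}\<close>.\<close>

definition orbit_space :: "'a topology \<Rightarrow> ('a \<Rightarrow> 'a) \<Rightarrow> 'a set topology" where
  "orbit_space X T =
     topology (\<lambda>U. U \<subseteq> (\<lambda>x. {x, T x}) ` topspace X \<and> openin X {x \<in> topspace X. {x, T x} \<in> U})"

lemma openin_orbit_space:
  "openin (orbit_space X T) U \<longleftrightarrow>
     U \<subseteq> (\<lambda>x. {x, T x}) ` topspace X \<and> openin X {x \<in> topspace X. {x, T x} \<in> U}"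
proof -
  let ?P = "\<lambda>U. U \<subseteq> (\<lambda>x. {x, T x}) ` topspace X \<and> openin X {x \<in> topspace X. {x, T x} \<in> U}"
  have "istopology ?P"
    unfolding istopology_def
  proof (intro conjI allI impI)
    fix S S' assume "?P S" "?P S'"
    moreover have "{x \<in> topspace X. {x, T x} \<in> S \<inter> S'} =
        {x \<in> topspace X. {x, T x} \<in> S} \<inter> {x \<in> topspace X. {x, T x} \<in> S'}" by auto
    ultimately show "S \<inter> S' \<subseteq> (\<lambda>x. {x, T x}) ` topspace X"
      and "openin X {x \<in> topspace X. {x, T x} \<in> S \<inter> S'}" by auto
  next
    fix K assume K: "\<forall>S\<in>K. ?P S"
    then show "\<Union>K \<subseteq> (\<lambda>x. {x, T x}) ` topspace X" by blast
    have "{x \<in> topspace X. {x, T x} \<in> \<Union>K} = (\<Union>S\<in>K. {x \<in> topspace X. {x, T x} \<in> S})" by auto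
    with K show "openin X {x \<in> topspace X. {x, T x} \<in> \<Union>K}" by auto
  qed
  then show ?thesis by (simp add: orbit_space_def topology_inverse')
qed

lemma quotient_map_orbit_space: "quotient_map X (orbit_space X T) (\<lambda>x. {x, T x})"
proof -
  let ?q = "\<lambda>x. {x, T x}"
  have "{x \<in> topspace X. ?q x \<in> ?q ` topspace X} = topspace X" by auto
  then have "openin (orbit_space X T) (?q ` topspace X)"
    unfolding openin_orbit_space by simp
  then have "?q ` topspace X \<subseteq> topspace (orbit_space X T)"
    by (rule openin_subset)
  moreover have "topspace (orbit_space X T) \<subseteq> ?q ` topspace X"
    using openin_topspace[of "orbit_space X T"] unfolding openin_orbit_space by (rule conjunct1)
  ultimately have "?q ` topspace X = topspace (orbit_space X T)"
    by (rule subset_antisym)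
  then show ?thesis
    unfolding quotient_map_def openin_orbit_space by blast
qed

text \<open>
  For the line bundle \<open>(X \<times> \<real>)/T \<rightarrow> X/T\<close>, the orbit \<open>[x, t]\<close> is the set \<open>{(x, t), (T x, -t)}\<close>. Hence
  the projection to \<open>{x, T x}\<close> is the image under \<open>fst\<close>, and scalar multiplication acts elementwise.
\<close>

definition w_class :: "'a topology \<Rightarrow> ('a \<Rightarrow> 'a) \<Rightarrow> 'a set cech_class" where
  "w_class X T =
     first_SW_class (orbit_space X T)
       (orbit_space (prod_topology X euclideanreal) (\<lambda>(x, t). (T x, - t)))
       (\<lambda>e. fst ` e)
       (\<lambda>r e. (\<lambda>(x, t). (x, r * t)) ` e)"

definition w_power_nonzero :: "'a topology \<Rightarrow> ('a \<Rightarrow> 'a) \<Rightarrow> nat \<Rightarrow> bool" where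
  "w_power_nonzero X T n \<longleftrightarrow>
     cech_power (orbit_space X T) (w_class X T) n \<noteq> cech_zero n (orbit_space X T)"

definition h_ind2 :: "'a topology \<Rightarrow> ('a \<Rightarrow> 'a) \<Rightarrow> enat" where
  "h_ind2 X T =
     (if \<exists>n. w_power_nonzero X T n \<and> (\<forall>m. w_power_nonzero X T m \<longrightarrow> m \<le> n)
      then enat (GREATEST n. w_power_nonzero X T n) else \<infinity>)"

end

theory Submission
  imports Defs
begin

text \<open>
  Write \<open>w\<close> for the characteristic class of the double cover \<open>X \<rightarrow> X/S\<close>, and also for that
  of \<open>Y \<rightarrow> Y/T\<close>. The proof follows the Gysin sequence
  \<open>H\<^sup>n(X/S) \<rightarrow> H\<^sup>n(X) \<rightarrow> H\<^sup>n(X/S) \<rightarrow> H\<^sup>n\<^sup>+\<^sup>1(X/S)\<close>,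
  whose maps are the pullback, the transfer and the cup product with \<open>w\<close>.

  On \<open>Y\<close> we have \<open>w\<^sup>k\<^sup>+\<^sup>1 = 0\<close>, so that \<open>w\<^sup>k\<close> is the transfer of a class \<open>y \<in> H\<^sup>k(Y)\<close>, which is nonzero
  since \<open>w\<^sup>k\<close> is. Then \<open>x = f\<^sup>*y\<close> is the nonzero class of \<open>H\<^sup>k(X)\<close>, and by naturality its transfer is
  the power \<open>w\<^sup>k\<close> for \<open>X\<close>. Suppose that this power is zero. By exactness \<open>x\<close> is then the pullback of a
  class \<open>z \<in> H\<^sup>k(X/S)\<close>. If \<open>z \<union> w = 0\<close>, then \<open>z\<close> is the transfer of a class of \<open>X\<close>, that is, of \<open>0\<close>
  or of \<open>x\<close>. Both transfers are zero, hence \<open>z = 0\<close> and \<open>x = 0\<close>, a contradiction. The higher powers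
  of \<open>w\<close> vanish on \<open>X\<close> because they do on \<open>Y\<close>.

  It remains to see that \<open>z \<union> w = 0\<close> (\<open>cup_w_vanishes\<close>). This would follow from \<open>dim X/S \<le> k\<close>, but there
  is a way that uses only the dimension of \<open>X\<close>: as \<open>H\<^sup>n(X) = 0\<close> for \<open>n > k\<close>
  (\<open>cech_vanishes_above_dim\<close>), multiplication by \<open>w\<close> is injective on \<open>H\<^sup>n(X/S)\<close> for \<open>n > k\<close>
  (\<open>cup_w_injective\<close>), whereas the power \<open>w\<^sup>k\<^sup>+\<^sup>1\<close> is zero, being pulled back from \<open>Y/T\<close>.

  All this is carried out with explicit Cech cochains. On a cover of \<open>X/S\<close> by evenly covered sets a
  numbering of the sheets by \<open>0\<close> and \<open>1\<close> gives functions \<open>\<epsilon>\<close> on \<open>X\<close> with \<open>\<epsilon>(Sx) = \<epsilon>(x) + 1\<close>, and \<open>\<delta>\<epsilon>\<close> is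
  the pullback of a cocycle that represents \<open>w\<close> (\<open>w_class_eq\<close>). If \<open>z \<union> w = \<delta>g\<close>, then \<open>z \<union> \<epsilon> + g\<close> is
  a cocycle of \<open>X\<close>, and summing over the two sheets gives back \<open>z\<close>; so \<open>z\<close> bounds if \<open>z \<union> \<epsilon> + g\<close>
  does (\<open>transfer\<close>). Conversely, \<open>z = \<delta>d\<close> implies that \<open>z \<union> \<epsilon> + g\<close> is cohomologous to the pullback
  of \<open>d \<union> w + g\<close> (\<open>lift_of_coboundary\<close>).
\<close>

section \<open>Arithmetic modulo 2 and locally constant functions\<close>

declare add_bit_eq_xor [simp del] mult_bit_eq_and [simp del]

lemma bit_add_self [simp]: "a + a = 0" "a + (a + b) = b" for a b :: bit
  by (cases a; cases b; simp)+

lemma bit_add_eq_0_iff: "a + b = 0 \<longleftrightarrow> a = b" for a b :: bit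
  by (cases a; cases b; simp)

lemma bit_add_eq_iff: "a + b = c \<longleftrightarrow> b = c + a" for a b c :: bit
  by (cases a; cases b; cases c; simp)

abbreviation locally_const :: "'a topology \<Rightarrow> 'a set \<Rightarrow> ('a \<Rightarrow> bit) \<Rightarrow> bool" where
  "locally_const X A g \<equiv> continuous_map (subtopology X A) (discrete_topology UNIV) g"

lemma locally_const_iff:
  "locally_const X A g \<longleftrightarrow>
     (\<forall>x\<in>topspace X \<inter> A. \<exists>U. openin X U \<and> x \<in> U \<and> (\<forall>y\<in>U \<inter> A. g y = g x))"
proof
  assume g: "locally_const X A g"
  show "\<forall>x\<in>topspace X \<inter> A. \<exists>U. openin X U \<and> x \<in> U \<and> (\<forall>y\<in>U \<inter> A. g y = g x)"
  proof
    fix x assume x: "x \<in> topspace X \<inter> A"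
    have "openin (subtopology X A) {y \<in> topspace (subtopology X A). g y \<in> {g x}}"
      using g by (rule openin_continuous_map_preimage) simp
    then obtain U where U: "openin X U" "{y \<in> topspace X \<inter> A. g y = g x} = U \<inter> A"
      by (auto simp: openin_subtopology)
    then have "x \<in> U" "\<forall>y\<in>U \<inter> A. g y = g x" using x by auto
    with U show "\<exists>U. openin X U \<and> x \<in> U \<and> (\<forall>y\<in>U \<inter> A. g y = g x)" by blast
  qed
next
  assume *: "\<forall>x\<in>topspace X \<inter> A. \<exists>U. openin X U \<and> x \<in> U \<and> (\<forall>y\<in>U \<inter> A. g y = g x)"
  show "locally_const X A g"
    unfolding continuous_map_def
  proof (intro conjI allI impI)
    fix V :: "bit set"
    let ?P = "{x \<in> topspace (subtopology X A). g x \<in> V}"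
    show "openin (subtopology X A) ?P"
    proof (subst openin_subopen, intro ballI)
      fix x assume x: "x \<in> ?P"
      then have x': "x \<in> topspace X \<inter> A" by simp
      from bspec[OF * x'] obtain U
        where U: "openin X U" "x \<in> U" "\<forall>y\<in>U \<inter> A. g y = g x" by blast
      then have "openin (subtopology X A) (U \<inter> A)" by (auto simp: openin_subtopology)
      moreover have "U \<inter> A \<subseteq> ?P"
      proof
        fix y assume y: "y \<in> U \<inter> A"
        then have "g y \<in> V" using bspec[OF U(3) y] x by simp
        then show "y \<in> ?P" using y openin_subset[OF U(1)] by auto
      qed
      moreover have "x \<in> U \<inter> A" using U(2) x' by simp
      ultimately show "\<exists>T. openin (subtopology X A) T \<and> x \<in> T \<and> T \<subseteq> ?P" by blast
    qed
  qed simp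
qed

lemma locally_const_combine:
  assumes "locally_const X A g" "locally_const X A h"
  shows "locally_const X A (\<lambda>x. F (g x) (h x))"
  unfolding locally_const_iff
proof
  fix x assume x: "x \<in> topspace X \<inter> A"
  from assms x obtain U V where
    "openin X U" "x \<in> U" "\<forall>y\<in>U \<inter> A. g y = g x" "openin X V" "x \<in> V" "\<forall>y\<in>V \<inter> A. h y = h x"
    unfolding locally_const_iff by meson
  then have "openin X (U \<inter> V) \<and> x \<in> U \<inter> V \<and> (\<forall>y\<in>(U \<inter> V) \<inter> A. F (g y) (h y) = F (g x) (h x))"
    by (metis IntD1 IntD2 IntI openin_Int)
  then show "\<exists>U. openin X U \<and> x \<in> U \<and> (\<forall>y\<in>U \<inter> A. F (g y) (h y) = F (g x) (h x))"
    by (rule exI)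
qed

lemma locally_const_sum:
  assumes "finite I" "\<And>i. i \<in> I \<Longrightarrow> locally_const X A (g i)"
  shows "locally_const X A (\<lambda>x. \<Sum>i\<in>I. g i x)"
  using assms by (induction I) (auto intro: locally_const_combine)

lemma locally_const_mono:
  assumes "locally_const X B g" "A \<inter> topspace X \<subseteq> B"
  shows "locally_const X A g"
  by (metis assms continuous_map_from_subtopology_mono inf_commute subtopology_restrict)

lemma locally_const_compose:
  assumes f: "continuous_map X Y f" and g: "locally_const Y B g"
    and AB: "\<And>x. x \<in> A \<Longrightarrow> x \<in> topspace X \<Longrightarrow> f x \<in> B"
  shows "locally_const X A (\<lambda>x. g (f x))"
proof -
  have "continuous_map (subtopology X A) (subtopology Y B) f"
    using f AB by (auto simp: continuous_map_in_subtopology continuous_map_from_subtopology)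
  from continuous_map_compose[OF this g] show ?thesis by (simp add: o_def)
qed

lemma locally_const_cong:
  assumes "locally_const X A g" "\<And>x. x \<in> A \<Longrightarrow> x \<in> topspace X \<Longrightarrow> g x = h x"
  shows "locally_const X A h"
  using assms(1) by (rule continuous_map_eq) (use assms(2) in auto)

section \<open>Combinatorics of cochains\<close>

lemma coboundary_Nil [simp]: "coboundary c [] x = 0"
  by (simp add: coboundary_def)

text \<open>
  Peeling off the first vertex turns the sum over the faces into a recursion; with it the identities
  of this section become inductions on tuples in place of manipulations of double sums.
\<close>

lemma coboundary_Cons: "coboundary c (u # us) x = c us x + coboundary (\<lambda>vs. c (u # vs)) us x"
  by (simp add: coboundary_def sum.lessThan_Suc_shift del: sum.lessThan_Suc)

lemma coboundary_add:
  "coboundary (\<lambda>us x. a us x + b us x) us x = coboundary a us x + coboundary b us x"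
  by (simp add: coboundary_def sum.distrib)

lemma coboundary_zero [simp]: "coboundary (\<lambda>us x. 0) us x = 0"
  by (simp add: coboundary_def)

lemma set_face_subset: "set (take i us @ drop (Suc i) us) \<subseteq> set us"
  by (auto dest: in_set_takeD in_set_dropD)

lemma coboundary_cong:
  assumes "\<And>vs. length us = Suc (length vs) \<Longrightarrow> set vs \<subseteq> set us \<Longrightarrow> a vs x = b vs x"
  shows "coboundary a us x = coboundary b us x"
  unfolding coboundary_def
proof (rule sum.cong, simp)
  fix i assume "i \<in> {..<length us}"
  then show "a (take i us @ drop (Suc i) us) x = b (take i us @ drop (Suc i) us) x"
    by (intro assms set_face_subset) auto
qed

lemma coboundary_coboundary: "coboundary (coboundary c) us x = 0"
proof (induction us arbitrary: c)
  case (Cons u us)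
  have "coboundary (\<lambda>vs. coboundary c (u # vs)) us x
      = coboundary c us x + coboundary (coboundary (\<lambda>vs. c (u # vs))) us x"
    unfolding coboundary_Cons coboundary_add by simp
  with Cons show ?case by (simp add: coboundary_Cons)
qed simp

lemma coboundary_pullback:
  "coboundary (pullback_cochain f \<phi> c) = pullback_cochain f \<phi> (coboundary c)"
  by (simp add: fun_eq_iff coboundary_def pullback_cochain_def take_map drop_map)

text \<open>
  The Leibniz rule: both terms on the right contain the product of \<open>a\<close> on the first \<open>p + 1\<close> vertices
  with \<open>b\<close> on the remaining ones, and these two contributions cancel modulo 2.
\<close>

lemma coboundary_cup:
  assumes "length us \<ge> p + 2"
  shows "coboundary (cup_cochain p a b) us x =
    cup_cochain (Suc p) (coboundary a) b us x + cup_cochain p a (coboundary b) us x"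
  using assms
proof (induction p arbitrary: a us)
  case 0
  then obtain u v t where us: "us = u # v # t" by (cases us; cases "tl us") auto
  have "coboundary (\<lambda>vs. cup_cochain 0 a b (u # vs)) (v # t) x =
      a [u] x * coboundary (\<lambda>vs. b (u # vs)) (v # t) x"
    by (simp add: cup_cochain_def coboundary_def sum_distrib_left del: sum.lessThan_Suc)
  then show ?case
    unfolding us by (simp add: coboundary_Cons cup_cochain_def algebra_simps)
next
  case (Suc p)
  then obtain u t where us: "us = u # t" "length t \<ge> p + 2" by (cases us) auto
  have "(\<lambda>vs. cup_cochain (Suc p) a b (u # vs)) = cup_cochain p (\<lambda>vs. a (u # vs)) b"
    by (simp add: fun_eq_iff cup_cochain_def)
  then show ?case
    using Suc.IH[OF us(2), of "\<lambda>vs. a (u # vs)"] us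
    by (simp add: coboundary_Cons) (simp add: cup_cochain_def coboundary_Cons algebra_simps)
qed

lemma pullback_cup:
  "pullback_cochain f \<phi> (cup_cochain p a b) =
     cup_cochain p (pullback_cochain f \<phi> a) (pullback_cochain f \<phi> b)"
  by (simp add: fun_eq_iff cup_cochain_def pullback_cochain_def take_map drop_map)

lemma cup_cochain_assoc:
  "cup_cochain (p + q) (cup_cochain p a b) c = cup_cochain p a (cup_cochain q b c)"
proof (intro ext)
  fix us :: "'a set list" and x
  have "min (Suc p) (Suc (p + q)) = Suc p" by simp
  moreover have "drop p (take (Suc (p + q)) us) = take (Suc q) (drop p us)"
    by (simp add: take_drop add.commute)
  ultimately show "cup_cochain (p + q) (cup_cochain p a b) c us x = cup_cochain p a (cup_cochain q b c) us x"
    by (simp add: cup_cochain_def mult.assoc add.commute)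
qed

text \<open>
  The prism operator: the chain homotopy between the pullbacks along two choices \<open>r\<close>, \<open>s\<close> of the map
  of covers. On \<open>[u\<^sub>0, \<dots>, u\<^sub>n]\<close> it is the sum of the values of \<open>c\<close> at
  \<open>[r u\<^sub>0, \<dots>, r u\<^sub>i, s u\<^sub>i, \<dots>, s u\<^sub>n]\<close>.
\<close>

primrec prism ::
    "('a \<Rightarrow> 'b) \<Rightarrow> ('a set \<Rightarrow> 'b set) \<Rightarrow> ('a set \<Rightarrow> 'b set) \<Rightarrow> 'a set list \<Rightarrow> 'b cochain \<Rightarrow> 'a \<Rightarrow> bit" where
  "prism f r s [] c = (\<lambda>x. 0)"
| "prism f r s (u # us) c =
     (\<lambda>x. c (r u # s u # map s us) (f x) + prism f r s us (\<lambda>vs. c (r u # vs)) x)"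

lemma prism_add:
  "prism f r s us (\<lambda>vs y. a vs y + b vs y) x = prism f r s us a x + prism f r s us b x"
  by (induction us arbitrary: a b) (simp_all add: ac_simps)

lemma prism_eq_0:
  assumes "\<And>vs. length vs = Suc (length us) \<Longrightarrow> set vs \<subseteq> r ` set us \<union> s ` set us \<Longrightarrow> c vs (f x) = 0"
  shows "prism f r s us c x = 0"
  using assms
proof (induction us arbitrary: c)
  case (Cons u us)
  have "c (r u # s u # map s us) (f x) = 0" by (rule Cons.prems) auto
  moreover have "prism f r s us (\<lambda>vs. c (r u # vs)) x = 0"
    by (rule Cons.IH) (rule Cons.prems, auto)
  ultimately show ?case by simp
qed simp

lemma prism_locally_const:
  assumes "\<And>vs. length vs = Suc (length us) \<Longrightarrow> set vs \<subseteq> r ` set us \<union> s ` set us \<Longrightarrow>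
    locally_const X A (\<lambda>x. c vs (f x))"
  shows "locally_const X A (prism f r s us c)"
  using assms
proof (induction us arbitrary: c)
  case (Cons u us)
  have "locally_const X A (\<lambda>x. c (r u # s u # map s us) (f x))" by (rule Cons.prems) auto
  moreover have "locally_const X A (prism f r s us (\<lambda>vs. c (r u # vs)))"
    by (rule Cons.IH) (rule Cons.prems, auto)
  ultimately show ?case
    using locally_const_combine[of X A _ _ "(+)"] by simp
qed simp

text \<open>
  Every face of the prism other than its bottom and its top occurs twice and cancels.
\<close>

lemma prism_homotopy:
  "coboundary (\<lambda>us. prism f r s us c) us x + prism f r s us (coboundary c) x =
     pullback_cochain f r c us x + pullback_cochain f s c us x"
proof (induction us arbitrary: c)
  case Nil
  then show ?case by (simp add: pullback_cochain_def)
next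
  case (Cons u us)
  let ?r = "\<lambda>vs. c (r u # vs)"
  let ?rs = "\<lambda>vs. c (r u # s u # vs)"
  have 1: "coboundary (\<lambda>us. prism f r s us c) (u # us) x =
      prism f r s us c x + coboundary (pullback_cochain f s ?rs) us x
      + coboundary (\<lambda>us. prism f r s us ?r) us x"
  proof -
    have "(\<lambda>vs. prism f r s (u # vs) c) =
        (\<lambda>vs y. pullback_cochain f s ?rs vs y + prism f r s vs ?r y)"
      by (simp add: fun_eq_iff pullback_cochain_def)
    then show ?thesis by (simp add: coboundary_Cons coboundary_add add.assoc)
  qed
  have 2: "prism f r s (u # us) (coboundary c) x =
      c (s u # map s us) (f x) + c (r u # map s us) (f x)
      + coboundary ?rs (map s us) (f x) + prism f r s us c x + prism f r s us (coboundary ?r) x"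
  proof -
    have "(\<lambda>vs. coboundary c (r u # vs)) = (\<lambda>vs y. c vs y + coboundary ?r vs y)"
      by (simp add: fun_eq_iff coboundary_Cons)
    then show ?thesis by (simp add: coboundary_Cons prism_add ac_simps)
  qed
  have 3: "coboundary (pullback_cochain f s ?rs) us x = coboundary ?rs (map s us) (f x)"
    unfolding coboundary_pullback by (simp add: pullback_cochain_def)
  from Cons.IH[of ?r] show ?case
    unfolding 1 2 3 by (simp add: pullback_cochain_def ac_simps)
qed

section \<open>Killing tuples with repetitions\<close>

text \<open>
  A cochain on all tuples is homotopic to its sorted part, which sees only tuples without
  repetitions and only through the set of their entries. A simultaneous enumeration of all finite
  vertex sets that is compatible with deletion of a vertex is what makes sorting a chain map.
\<close>

definition coherent_enumeration :: "('v set \<Rightarrow> 'v list) \<Rightarrow> bool" where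
  "coherent_enumeration R \<longleftrightarrow>
     (\<forall>A. finite A \<longrightarrow> distinct (R A) \<and> set (R A) = A \<and> (\<forall>v. R (A - {v}) = remove1 v (R A)))"

text \<open>List every finite set increasingly with respect to a fixed linear order of all vertices.\<close>

lemma coherent_enumeration_exists: "\<exists>R :: 'v set \<Rightarrow> 'v list. coherent_enumeration R"
proof -
  obtain r :: "('v \<times> 'v) set" where r: "well_order_on UNIV r"
    using well_order_on by blast
  have lin: "class.linorder (\<lambda>x y. (x, y) \<in> r) (\<lambda>x y. (x, y) \<in> r \<and> x \<noteq> y)"
  proof
    show "((x, y) \<in> r \<and> x \<noteq> y) = ((x, y) \<in> r \<and> (y, x) \<notin> r)" for x y
      using r unfolding well_order_on_def linear_order_on_def partial_order_on_def preorder_on_def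
      by (metis antisymD refl_onD UNIV_I)
    show "(x, x) \<in> r" for x
      using r unfolding well_order_on_def linear_order_on_def partial_order_on_def preorder_on_def
      by (metis refl_onD UNIV_I)
    show "(x, z) \<in> r" if "(x, y) \<in> r" "(y, z) \<in> r" for x y z
      using that r unfolding well_order_on_def linear_order_on_def partial_order_on_def preorder_on_def
      by (metis transD)
    show "x = y" if "(x, y) \<in> r" "(y, x) \<in> r" for x y
      using that r unfolding well_order_on_def linear_order_on_def partial_order_on_def
      by (metis antisymD)
    show "(x, y) \<in> r \<or> (y, x) \<in> r" for x y
      using r unfolding well_order_on_def linear_order_on_def partial_order_on_def preorder_on_def total_on_def
      by (metis refl_onD UNIV_I)
  qed
  interpret linorder "\<lambda>x y. (x, y) \<in> r" "\<lambda>x y. (x, y) \<in> r \<and> x \<noteq> y" by (rule lin)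
  have "coherent_enumeration sorted_list_of_set"
    by (simp add: coherent_enumeration_def sorted_list_of_set_remove)
  then show ?thesis by blast
qed

definition sorted_part :: "('a set set \<Rightarrow> 'a set list) \<Rightarrow> 'a cochain \<Rightarrow> 'a cochain" where
  "sorted_part R c = (\<lambda>us x. if distinct us then c (R (set us)) x else 0)"

lemma face_eq_remove1:
  assumes "distinct us" "i < length us"
  shows "take i us @ drop (Suc i) us = remove1 (us ! i) us"
proof -
  have "us = take i us @ us ! i # drop (Suc i) us"
    using assms by (simp add: id_take_nth_drop)
  moreover have "us ! i \<notin> set (take i us)"
    using assms by (auto simp: in_set_conv_nth nth_eq_iff_index_eq)
  ultimately show ?thesis
    by (metis remove1.simps(2) remove1_append)
qed

lemma coboundary_distinct:
  assumes "distinct us"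
  shows "coboundary c us x = (\<Sum>v\<in>set us. c (remove1 v us) x)"
proof -
  have "coboundary c us x = (\<Sum>i<length us. c (remove1 (us ! i) us) x)"
    unfolding coboundary_def by (rule sum.cong) (auto simp: face_eq_remove1 assms)
  also have "\<dots> = (\<Sum>v\<in>set us. c (remove1 v us) x)"
    using sum.reindex_bij_betw[OF bij_betw_nth[OF assms refl refl], of "\<lambda>v. c (remove1 v us) x"]
    by simp
  finally show ?thesis .
qed

lemma count_mset_distinct_le: "distinct us \<Longrightarrow> count (mset us) v \<le> 1"
  by (simp add: distinct_count_atmost_1)

text \<open>
  On a tuple without repetitions both sides sum over the subsets of its entries with one vertex
  removed. On a tuple with a repetition the only faces that contribute omit one of two equal entries,
  so they come in a pair, which is zero modulo 2.
\<close>

lemma coboundary_sorted_part: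
  assumes R: "coherent_enumeration R"
  shows "coboundary (sorted_part R c) us x = sorted_part R (coboundary c) us x"
proof (cases "distinct us")
  case True
  have RS: "distinct (R (set us))" "set (R (set us)) = set us"
    using R by (auto simp: coherent_enumeration_def)
  have "coboundary (sorted_part R c) us x = (\<Sum>v\<in>set us. c (R (set us - {v})) x)"
    unfolding coboundary_distinct[OF True]
    by (rule sum.cong) (auto simp: sorted_part_def True)
  also have "\<dots> = (\<Sum>v\<in>set us. c (remove1 v (R (set us))) x)"
    using R by (simp add: coherent_enumeration_def)
  also have "\<dots> = coboundary c (R (set us)) x"
    using coboundary_distinct[OF RS(1)] RS(2) by simp
  finally show ?thesis using True by (simp add: sorted_part_def)
next
  case False
  then obtain v where "count (mset us) v \<noteq> (if v \<in> set us then 1 else 0)"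
    unfolding distinct_count_atmost_1 by blast
  then have v: "count (mset us) v \<ge> 2" "v \<in> set us"
    by (auto split: if_splits simp: count_mset_0_iff
        intro!: Suc_leI simp: less_le_not_le le_Suc_eq Suc_le_eq numeral_2_eq_2)
  \<comment> \<open>If a face of a tuple in which \<open>v\<close> is repeated has no repetitions, then it omits one of exactly two
    occurrences of \<open>v\<close>; the faces that omit either of them contribute equally.\<close>
  let ?face = "\<lambda>i. take i us @ drop (Suc i) us"
  define t where "t = (if distinct (remove1 v us) then c (R (set us)) x else 0)"
  have face: "sorted_part R c (?face i) x = (if us ! i = v then t else 0)" if i: "i < length us" for i
  proof -
    have "mset us = mset (take i us @ us ! i # drop (Suc i) us)"
      using i by (simp add: id_take_nth_drop[symmetric])
    then have m: "mset (?face i) = mset (remove1 (us ! i) us)" by simp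
    then have d: "distinct (?face i) \<longleftrightarrow> distinct (remove1 (us ! i) us)"
      by (rule mset_eq_imp_distinct_iff)
    have s: "set (?face i) = set (remove1 (us ! i) us)"
      using m by (rule mset_eq_setD)
    show ?thesis
    proof (cases "us ! i = v")
      case True
      have "count (mset (remove1 v us)) v \<ge> 1" using v by simp
      then have "v \<in> set (remove1 v us)" by (metis count_mset_0_iff not_one_le_zero)
      then have "set (remove1 v us) = set us"
        using set_remove1_subset[of v us] by (metis in_set_remove1 subset_antisym subsetI)
      with d s True show ?thesis by (simp add: sorted_part_def t_def del: distinct_append)
    next
      case False
      then have "count (mset (remove1 (us ! i) us)) v \<ge> 2" using v by simp
      then have "\<not> distinct (remove1 (us ! i) us)"
        using count_mset_distinct_le[of "remove1 (us ! i) us" v] by auto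
      with d False show ?thesis by (simp add: sorted_part_def del: distinct_append)
    qed
  qed
  have "coboundary (sorted_part R c) us x = (\<Sum>i<length us. if us ! i = v then t else 0)"
    unfolding coboundary_def by (rule sum.cong) (use face in auto)
  also have "\<dots> = (\<Sum>i\<in>{i. i < length us \<and> us ! i = v}. t)"
    using sum.inter_filter[of "{..<length us}" "\<lambda>i. t" "\<lambda>i. us ! i = v"]
    by (simp only: finite_lessThan lessThan_iff)
  also have "\<dots> = of_nat (count (mset us) v) * t"
  proof -
    have "count (mset us) v = card {i. i < length us \<and> us ! i = v}"
      unfolding count_mset count_list_eq_length_filter length_filter_conv_card by (rule arg_cong[where f = card]) auto
    then show ?thesis by (simp only: sum_constant)
  qed
  also have "\<dots> = 0"
  proof (cases "distinct (remove1 v us)")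
    case True
    then have "count (mset (remove1 v us)) v \<le> 1"
      by (rule count_mset_distinct_le)
    then have "count (mset us) v = 2" using v by simp
    then show ?thesis by simp
  qed (simp add: t_def)
  finally show ?thesis using False by (simp add: sorted_part_def)
qed

text \<open>
  The homotopy from the identity to the sorted part, built by the method of acyclic carriers: every
  tuple is coned off from its first vertex. The first argument is the length of the tuple.
\<close>

primrec sorting_homotopy ::
    "('a set set \<Rightarrow> 'a set list) \<Rightarrow> nat \<Rightarrow> 'a cochain \<Rightarrow> 'a cochain" where
  "sorting_homotopy R 0 c = (\<lambda>us x. 0)"
| "sorting_homotopy R (Suc n) c = (\<lambda>us x.
     c (hd us # us) x + sorted_part R (\<lambda>vs. c (hd us # vs)) us x
     + coboundary (sorting_homotopy R n (\<lambda>vs. c (hd us # vs))) us x)"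

lemma sorted_part_add:
  "sorted_part R (\<lambda>us x. a us x + b us x) us x = sorted_part R a us x + sorted_part R b us x"
  by (simp add: sorted_part_def)

lemma sorting_homotopy_add:
  "sorting_homotopy R n (\<lambda>us x. a us x + b us x) =
     (\<lambda>us x. sorting_homotopy R n a us x + sorting_homotopy R n b us x)"
proof (induction n arbitrary: a b)
  case (Suc n)
  show ?case
    by (simp add: fun_eq_iff Suc sorted_part_add coboundary_add ac_simps)
qed simp

text \<open>
  On a cone the value of \<open>\<delta>c\<close> is that of \<open>c\<close> on the base plus that of \<open>\<delta>\<close> of the coned cochain. The
  first part gives the right-hand side, and the second cancels by the induction hypothesis applied to
  the faces, as the sorted part is a chain map.
\<close>

lemma sorting_homotopy:
  assumes R: "coherent_enumeration R" and "length us = Suc n"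
  shows "coboundary (sorting_homotopy R n c) us x + sorting_homotopy R (Suc n) (coboundary c) us x =
    c us x + sorted_part R c us x"
  using assms(2)
proof (induction n arbitrary: c us)
  case 0
  then obtain v where us: "us = [v]" by (cases us) auto
  have "distinct (R {v})" "set (R {v}) = {v}"
    using R by (auto simp: coherent_enumeration_def)
  then have "R {v} = [v]"
    by (cases "R {v}"; cases "tl (R {v})") auto
  then show ?case by (simp add: us coboundary_Cons sorted_part_def)
next
  case (Suc n)
  let ?f = "\<lambda>vs. c (hd us # vs)"
  have K: "(\<lambda>vs. coboundary c (hd us # vs)) = (\<lambda>vs y. c vs y + coboundary ?f vs y)"
    by (simp add: fun_eq_iff coboundary_Cons)
  have "coboundary (sorting_homotopy R (Suc n) (coboundary ?f)) us x =
      coboundary (\<lambda>us x. ?f us x + sorted_part R ?f us x + coboundary (sorting_homotopy R n ?f) us x) us x"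
  proof (rule coboundary_cong)
    fix vs :: "'a set list" assume "length us = Suc (length vs)"
    then have "length vs = Suc n" using Suc.prems by simp
    from Suc.IH[OF this, of ?f]
    show "sorting_homotopy R (Suc n) (coboundary ?f) vs x =
        ?f vs x + sorted_part R ?f vs x + coboundary (sorting_homotopy R n ?f) vs x"
      unfolding bit_add_eq_iff .
  qed
  also have "\<dots> = coboundary ?f us x + sorted_part R (coboundary ?f) us x"
    by (simp add: coboundary_add coboundary_sorted_part[OF R] coboundary_coboundary)
  finally have 1: "coboundary (sorting_homotopy R (Suc n) (coboundary ?f)) us x =
      coboundary ?f us x + sorted_part R (coboundary ?f) us x" .
  have "sorting_homotopy R (Suc (Suc n)) (coboundary c) us x =
      (c us x + coboundary ?f us x) + (sorted_part R c us x + sorted_part R (coboundary ?f) us x)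
      + (coboundary (sorting_homotopy R (Suc n) c) us x
         + coboundary (sorting_homotopy R (Suc n) (coboundary ?f)) us x)"
    unfolding sorting_homotopy.simps(2)[of R "Suc n" "coboundary c"] K sorting_homotopy_add
      sorted_part_add coboundary_add
    by (simp add: coboundary_Cons)
  then show ?case unfolding 1 by (simp add: ac_simps)
qed

lemma sorting_homotopy_cong:
  assumes "coherent_enumeration R" and "length us = n"
    and "\<And>vs. length vs = Suc n \<Longrightarrow> set vs \<subseteq> set us \<Longrightarrow> a vs x = b vs x"
  shows "sorting_homotopy R n a us x = sorting_homotopy R n b us x"
  using assms(2,3)
proof (induction n arbitrary: a b us)
  case (Suc n)
  have us: "hd us \<in> set us" using Suc.prems(1) by (cases us) auto
  have "sorted_part R (\<lambda>vs. a (hd us # vs)) us x = sorted_part R (\<lambda>vs. b (hd us # vs)) us x"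
  proof (cases "distinct us")
    case True
    have "set (R (set us)) = set us" "distinct (R (set us))"
      using assms(1) by (auto simp: coherent_enumeration_def)
    moreover from this True have "length (R (set us)) = Suc n"
      by (metis Suc.prems(1) distinct_card)
    ultimately show ?thesis using us True by (simp add: sorted_part_def Suc.prems(2))
  qed (simp add: sorted_part_def)
  moreover have "a (hd us # us) x = b (hd us # us) x"
    using us Suc.prems(1) by (intro Suc.prems(2)) auto
  moreover have "coboundary (sorting_homotopy R n (\<lambda>vs. a (hd us # vs))) us x
      = coboundary (sorting_homotopy R n (\<lambda>vs. b (hd us # vs))) us x"
  proof (rule coboundary_cong)
    fix vs :: "'a set list" assume vs: "length us = Suc (length vs)" "set vs \<subseteq> set us"
    show "sorting_homotopy R n (\<lambda>vs. a (hd us # vs)) vs x = sorting_homotopy R n (\<lambda>vs. b (hd us # vs)) vs x"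
      by (rule Suc.IH) (use vs us Suc.prems in auto)
  qed
  ultimately show ?case by simp
qed simp

lemma locally_const_coboundary:
  assumes "\<And>vs. length us = Suc (length vs) \<Longrightarrow> set vs \<subseteq> set us \<Longrightarrow> locally_const X A (c vs)"
  shows "locally_const X A (coboundary c us)"
proof -
  have "locally_const X A (\<lambda>x. \<Sum>i<length us. c (take i us @ drop (Suc i) us) x)"
  proof (rule locally_const_sum)
    fix i assume "i \<in> {..<length us}"
    then show "locally_const X A (c (take i us @ drop (Suc i) us))"
      by (intro assms set_face_subset) auto
  qed simp
  then show ?thesis by (simp add: coboundary_def)
qed

lemma sorting_homotopy_locally_const:
  assumes "coherent_enumeration R" and "length us = n"
    and "\<And>vs. length vs = Suc n \<Longrightarrow> set vs \<subseteq> set us \<Longrightarrow> locally_const X A (c vs)"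
  shows "locally_const X A (sorting_homotopy R n c us)"
  using assms(2,3)
proof (induction n arbitrary: c us)
  case (Suc n)
  have us: "hd us \<in> set us" using Suc.prems(1) by (cases us) auto
  have "locally_const X A (sorted_part R (\<lambda>vs. c (hd us # vs)) us)"
  proof (cases "distinct us")
    case True
    have "set (R (set us)) = set us" "distinct (R (set us))"
      using assms(1) by (auto simp: coherent_enumeration_def)
    moreover from this True have "length (R (set us)) = Suc n"
      by (metis Suc.prems(1) distinct_card)
    ultimately show ?thesis using us True Suc.prems(2)[of "hd us # R (set us)"]
      by (simp add: sorted_part_def)
  qed (simp add: sorted_part_def)
  moreover have "locally_const X A (c (hd us # us))"
    using us Suc.prems(1) by (intro Suc.prems(2)) auto
  moreover have "locally_const X A (coboundary (sorting_homotopy R n (\<lambda>vs. c (hd us # vs))) us)"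
    by (intro locally_const_coboundary Suc.IH Suc.prems(2)) (use us Suc.prems(1) in auto)
  ultimately show ?case
    using locally_const_combine[of X A _ _ "(+)"] by simp
qed simp

section \<open>Cochains of covers\<close>

text \<open>
  The cochains one degree below \<open>n\<close>, indexed so that degree \<open>0\<close> needs no special treatment: there
  the only cochain below is \<open>0\<close>.
\<close>

definition primitives :: "nat \<Rightarrow> 'a topology \<Rightarrow> 'a set set \<Rightarrow> 'a cochain set" where
  "primitives n X \<U> =
     {e. \<forall>us. length us = n \<longrightarrow> set us \<subseteq> \<U> \<longrightarrow>
        locally_const X (\<Inter>(set us)) (e us) \<and> (us = [] \<longrightarrow> e us = (\<lambda>x. 0))}"

lemma cochains_iff:
  "c \<in> cochains n X \<U> \<longleftrightarrow>
     (\<forall>us. length us = Suc n \<longrightarrow> set us \<subseteq> \<U> \<longrightarrow> locally_const X (\<Inter>(set us)) (c us))"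
  by (auto simp: cochains_def tuples_def)

lemma primitives_Suc: "primitives (Suc n) X \<U> = cochains n X \<U>"
  by (auto simp: primitives_def cochains_iff)

lemma cochain_agree_iff:
  "cochain_agree n \<U> a b \<longleftrightarrow>
     (\<forall>us. length us = Suc n \<longrightarrow> set us \<subseteq> \<U> \<longrightarrow> (\<forall>x\<in>\<Inter>(set us). a us x = b us x))"
  by (auto simp: cochain_agree_def tuples_def)

lemma cocycles_iff:
  "c \<in> cocycles n X \<U> \<longleftrightarrow> c \<in> cochains n X \<U> \<and> cochain_agree (Suc n) \<U> (coboundary c) (\<lambda>us x. 0)"
  by (auto simp: cocycles_def)

lemma cohomologous_iff:
  "cohomologous n X \<U> a b \<longleftrightarrow>
     (\<exists>e\<in>primitives n X \<U>. cochain_agree n \<U> (\<lambda>us x. a us x + b us x) (coboundary e))"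
proof (cases n)
  case 0
  have "coboundary e us x = 0" if "e \<in> primitives 0 X \<U>" "length us = Suc 0" for e us x
  proof -
    from that obtain u where "us = [u]" by (cases us) auto
    with that show ?thesis by (simp add: coboundary_Cons primitives_def)
  qed
  moreover have "(\<lambda>us x. 0) \<in> primitives 0 X \<U>" by (simp add: primitives_def)
  ultimately show ?thesis
    unfolding 0 cohomologous_def nat.case cochain_agree_iff
    by (auto simp: bit_add_eq_0_iff intro!: bexI[of _ "\<lambda>us x. 0"])
qed (simp add: cohomologous_def primitives_Suc)

lemma cover_mapD:
  assumes "cover_map f \<U> \<V> \<phi>" "set us \<subseteq> \<U>"
  shows "\<phi> ` set us \<subseteq> \<V>" "x \<in> \<Inter>(set us) \<Longrightarrow> f x \<in> \<Inter>(\<phi> ` set us)"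
  using assms by (auto simp: cover_map_def)

lemma cover_map_comp:
  "cover_map f \<U> \<V> \<phi> \<Longrightarrow> cover_map g \<V> \<W> \<psi> \<Longrightarrow> cover_map (g \<circ> f) \<U> \<W> (\<psi> \<circ> \<phi>)"
  unfolding cover_map_def by fastforce

lemma cover_map_id: "cover_map id \<U> \<U> id"
  by (auto simp: cover_map_def)

lemma pullback_pullback:
  "pullback_cochain f \<phi> (pullback_cochain g \<psi> c) = pullback_cochain (g \<circ> f) (\<psi> \<circ> \<phi>) c"
  by (simp add: fun_eq_iff pullback_cochain_def)

lemma pullback_id: "pullback_cochain id id c = c"
  by (simp add: fun_eq_iff pullback_cochain_def)

lemma pullback_add:
  "pullback_cochain f \<phi> (\<lambda>us x. a us x + b us x) =
     (\<lambda>us x. pullback_cochain f \<phi> a us x + pullback_cochain f \<phi> b us x)"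
  by (simp add: fun_eq_iff pullback_cochain_def)

lemma pullback_const: "pullback_cochain f \<phi> (\<lambda>us x. k) = (\<lambda>us x. k)"
  by (simp add: fun_eq_iff pullback_cochain_def)

lemma locally_const_pullback:
  assumes "continuous_map X Y f" "cover_map f \<U> \<V> \<phi>" "set us \<subseteq> \<U>"
    and "locally_const Y (\<Inter>(\<phi> ` set us)) (c (map \<phi> us))"
  shows "locally_const X (\<Inter>(set us)) (pullback_cochain f \<phi> c us)"
  unfolding pullback_cochain_def
  using assms(1,4) by (rule locally_const_compose) (use cover_mapD[OF assms(2,3)] in blast)

lemma cochains_pullback:
  assumes "continuous_map X Y f" "cover_map f \<U> \<V> \<phi>" "c \<in> cochains n Y \<V>"
  shows "pullback_cochain f \<phi> c \<in> cochains n X \<U>"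
  unfolding cochains_iff
proof (intro allI impI)
  fix us :: "'a set list" assume us: "length us = Suc n" "set us \<subseteq> \<U>"
  then have "locally_const Y (\<Inter>(\<phi> ` set us)) (c (map \<phi> us))"
    using assms(3) cover_mapD(1)[OF assms(2) us(2)]
    unfolding cochains_iff by (metis length_map list.set_map)
  then show "locally_const X (\<Inter>(set us)) (pullback_cochain f \<phi> c us)"
    by (rule locally_const_pullback[OF assms(1,2) us(2)])
qed

lemma primitives_pullback:
  assumes "continuous_map X Y f" "cover_map f \<U> \<V> \<phi>" "c \<in> primitives n Y \<V>"
  shows "pullback_cochain f \<phi> c \<in> primitives n X \<U>"
  unfolding primitives_def mem_Collect_eq
proof (intro allI impI conjI)
  fix us :: "'a set list" assume us: "length us = n" "set us \<subseteq> \<U>"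
  then have *: "locally_const Y (\<Inter>(\<phi> ` set us)) (c (map \<phi> us)) \<and> (map \<phi> us = [] \<longrightarrow> c (map \<phi> us) = (\<lambda>x. 0))"
    using assms(3) cover_mapD(1)[OF assms(2) us(2)]
    unfolding primitives_def mem_Collect_eq by (metis length_map list.set_map)
  then show "locally_const X (\<Inter>(set us)) (pullback_cochain f \<phi> c us)"
    by (intro locally_const_pullback[OF assms(1,2) us(2)]) simp
  show "pullback_cochain f \<phi> c us = (\<lambda>x. 0)" if "us = []"
    using * that by (simp add: pullback_cochain_def)
qed

lemma cochain_agree_pullback:
  assumes "cover_map f \<U> \<V> \<phi>" "cochain_agree n \<V> a b"
  shows "cochain_agree n \<U> (pullback_cochain f \<phi> a) (pullback_cochain f \<phi> b)"
  unfolding cochain_agree_iff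
proof (intro allI impI ballI)
  fix us :: "'a set list" and x assume us: "length us = Suc n" "set us \<subseteq> \<U>" "x \<in> \<Inter>(set us)"
  have "length (map \<phi> us) = Suc n" "set (map \<phi> us) \<subseteq> \<V>" "f x \<in> \<Inter>(set (map \<phi> us))"
    using us cover_mapD[OF assms(1) us(2)] by simp_all
  then show "pullback_cochain f \<phi> a us x = pullback_cochain f \<phi> b us x"
    using assms(2) unfolding cochain_agree_iff pullback_cochain_def by blast
qed

lemma cocycles_pullback:
  assumes "continuous_map X Y f" "cover_map f \<U> \<V> \<phi>" "c \<in> cocycles n Y \<V>"
  shows "pullback_cochain f \<phi> c \<in> cocycles n X \<U>"
  using assms cochain_agree_pullback[of f \<U> \<V> \<phi> "Suc n" "coboundary c" "\<lambda>us x. 0"]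
  by (simp add: cocycles_iff cochains_pullback coboundary_pullback pullback_const)

lemma cochains_add:
  "a \<in> cochains n X \<U> \<Longrightarrow> b \<in> cochains n X \<U> \<Longrightarrow> (\<lambda>us x. a us x + b us x) \<in> cochains n X \<U>"
  by (simp add: cochains_iff locally_const_combine)

lemma primitives_add:
  "a \<in> primitives n X \<U> \<Longrightarrow> b \<in> primitives n X \<U> \<Longrightarrow> (\<lambda>us x. a us x + b us x) \<in> primitives n X \<U>"
  by (simp add: primitives_def locally_const_combine)

lemma cocycles_add:
  "a \<in> cocycles n X \<U> \<Longrightarrow> b \<in> cocycles n X \<U> \<Longrightarrow> (\<lambda>us x. a us x + b us x) \<in> cocycles n X \<U>"
  by (simp add: cocycles_iff cochains_add cochain_agree_iff coboundary_add)

lemma cocycles_zero: "(\<lambda>us x. 0) \<in> cocycles n X \<U>"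
  by (simp add: cocycles_iff cochains_iff cochain_agree_iff)

lemma cohomologousI:
  assumes "e \<in> primitives n X \<U>"
    and "\<And>us x. length us = Suc n \<Longrightarrow> set us \<subseteq> \<U> \<Longrightarrow> x \<in> \<Inter>(set us) \<Longrightarrow>
      a us x + b us x = coboundary e us x"
  shows "cohomologous n X \<U> a b"
  unfolding cohomologous_iff cochain_agree_iff using assms by blast

lemma cohomologousE:
  assumes "cohomologous n X \<U> a b"
  obtains e where "e \<in> primitives n X \<U>"
    and "\<And>us x. length us = Suc n \<Longrightarrow> set us \<subseteq> \<U> \<Longrightarrow> x \<in> \<Inter>(set us) \<Longrightarrow>
      a us x + b us x = coboundary e us x"
  using assms unfolding cohomologous_iff cochain_agree_iff by blast

lemma cohomologous_agree: "cochain_agree n \<U> a b \<Longrightarrow> cohomologous n X \<U> a b"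
  by (rule cohomologousI[of "\<lambda>us x. 0"]) (auto simp: primitives_def cochain_agree_iff)

lemma cohomologous_refl: "cohomologous n X \<U> a a"
  by (rule cohomologous_agree) (simp add: cochain_agree_iff)

lemma cohomologous_sym: "cohomologous n X \<U> a b \<Longrightarrow> cohomologous n X \<U> b a"
  unfolding cohomologous_iff by (simp add: add.commute)

lemma cohomologous_add:
  assumes "cohomologous n X \<U> a b" "cohomologous n X \<U> c d"
  shows "cohomologous n X \<U> (\<lambda>us x. a us x + c us x) (\<lambda>us x. b us x + d us x)"
proof -
  from assms obtain e h where "e \<in> primitives n X \<U>" "h \<in> primitives n X \<U>"
    and *: "\<And>us x. length us = Suc n \<Longrightarrow> set us \<subseteq> \<U> \<Longrightarrow> x \<in> \<Inter>(set us) \<Longrightarrow>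
      coboundary e us x = a us x + b us x \<and> coboundary h us x = c us x + d us x"
    by (elim cohomologousE) metis
  then show ?thesis
    by (intro cohomologousI[OF primitives_add[of e n X \<U> h]]) (simp_all add: coboundary_add ac_simps)
qed

lemma cohomologous_sum_iff:
  "cohomologous n X \<U> (\<lambda>us x. a us x + b us x) (\<lambda>us x. 0) \<longleftrightarrow> cohomologous n X \<U> a b"
  by (simp add: cohomologous_iff)

lemma cohomologous_trans:
  assumes "cohomologous n X \<U> a b" "cohomologous n X \<U> b c"
  shows "cohomologous n X \<U> a c"
  using cohomologous_add[OF assms]
  by (subst cohomologous_sum_iff[symmetric], subst (asm) cohomologous_sum_iff[symmetric])
     (simp add: ac_simps)

lemma cohomologous_pullback:
  assumes "continuous_map X Y f" "cover_map f \<U> \<V> \<phi>" "cohomologous n Y \<V> a b"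
  shows "cohomologous n X \<U> (pullback_cochain f \<phi> a) (pullback_cochain f \<phi> b)"
proof -
  from assms(3) obtain e where e: "e \<in> primitives n Y \<V>"
    "cochain_agree n \<V> (\<lambda>us x. a us x + b us x) (coboundary e)"
    by (auto simp: cohomologous_iff)
  from cochain_agree_pullback[OF assms(2) e(2)] primitives_pullback[OF assms(1,2) e(1)]
  show ?thesis
    unfolding cohomologous_iff
    by (intro bexI[of _ "pullback_cochain f \<phi> e"]) (simp_all add: pullback_add coboundary_pullback)
qed

text \<open>Two maps of covers over the same map of spaces are homotopic by the prism operator.\<close>

lemma cohomologous_cover_maps:
  assumes f: "continuous_map X Y f" and "cover_map f \<U> \<V> r" "cover_map f \<U> \<V> s"
    and c: "c \<in> cocycles n Y \<V>"
  shows "cohomologous n X \<U> (pullback_cochain f r c) (pullback_cochain f s c)"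
proof (rule cohomologousI)
  have sub: "set vs \<subseteq> \<V>" "x \<in> \<Inter>(set us) \<Longrightarrow> f x \<in> \<Inter>(set vs)"
    if "set us \<subseteq> \<U>" "set vs \<subseteq> r ` set us \<union> s ` set us" for us vs x
    using that cover_mapD[OF assms(2) that(1)] cover_mapD[OF assms(3) that(1)] by blast+
  show "(\<lambda>us. prism f r s us c) \<in> primitives n X \<U>"
    unfolding primitives_def mem_Collect_eq
  proof (intro allI impI conjI)
    fix us :: "'a set list" assume us: "length us = n" "set us \<subseteq> \<U>"
    show "locally_const X (\<Inter>(set us)) (prism f r s us c)"
    proof (rule prism_locally_const)
      fix vs assume vs: "length vs = Suc (length us)" "set vs \<subseteq> r ` set us \<union> s ` set us"
      have "locally_const Y (\<Inter>(set vs)) (c vs)"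
        using c vs us sub(1)[OF us(2) vs(2)] by (simp add: cocycles_iff cochains_iff)
      with f show "locally_const X (\<Inter>(set us)) (\<lambda>x. c vs (f x))"
        by (rule locally_const_compose) (use sub(2)[OF us(2) vs(2)] in blast)
    qed
    show "prism f r s us c = (\<lambda>x. 0)" if "us = []" using that by simp
  qed
  fix us :: "'a set list" and x assume us: "length us = Suc n" "set us \<subseteq> \<U>" "x \<in> \<Inter>(set us)"
  have "prism f r s us (coboundary c) x = 0"
  proof (rule prism_eq_0)
    fix vs assume vs: "length vs = Suc (length us)" "set vs \<subseteq> r ` set us \<union> s ` set us"
    show "coboundary c vs (f x) = 0"
      using c vs us sub[OF us(2) vs(2)] by (simp add: cocycles_iff cochain_agree_iff)
  qed
  with prism_homotopy[of f r s c us x]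
  show "pullback_cochain f r c us x + pullback_cochain f s c us x = coboundary (\<lambda>us. prism f r s us c) us x"
    by simp
qed

section \<open>Cup products of cochains\<close>

lemma cup_cochain_sets:
  assumes "length us = Suc (p + q)"
  shows "length (take (Suc p) us) = Suc p" "length (drop p us) = Suc q"
    "set (take (Suc p) us) \<subseteq> set us" "set (drop p us) \<subseteq> set us"
  using assms by (auto dest: in_set_takeD in_set_dropD)

lemma cup_cochains:
  assumes "a \<in> cochains p X \<U>" "b \<in> cochains q X \<U>"
  shows "cup_cochain p a b \<in> cochains (p + q) X \<U>"
  unfolding cochains_iff cup_cochain_def
proof (intro allI impI)
  fix us :: "'a set list" assume us: "length us = Suc (p + q)" "set us \<subseteq> \<U>"
  note t = cup_cochain_sets[OF us(1)]
  have "locally_const X (\<Inter>(set (take (Suc p) us))) (a (take (Suc p) us))"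
    using assms(1) t us(2) unfolding cochains_iff by blast
  moreover have "locally_const X (\<Inter>(set (drop p us))) (b (drop p us))"
    using assms(2) t us(2) unfolding cochains_iff by blast
  ultimately show "locally_const X (\<Inter>(set us)) (\<lambda>x. a (take (Suc p) us) x * b (drop p us) x)"
    using t by (intro locally_const_combine[of _ _ _ _ "(*)"]) (auto elim!: locally_const_mono)
qed

lemma cochain_agree_cup:
  assumes "cochain_agree p \<U> a a'" "cochain_agree q \<U> b b'"
  shows "cochain_agree (p + q) \<U> (cup_cochain p a b) (cup_cochain p a' b')"
  unfolding cochain_agree_iff
proof (intro allI impI ballI)
  fix us :: "'a set list" and x assume us: "length us = Suc (p + q)" "set us \<subseteq> \<U>" "x \<in> \<Inter>(set us)"
  note t = cup_cochain_sets[OF us(1)]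
  have "a (take (Suc p) us) x = a' (take (Suc p) us) x"
    using assms(1) t us unfolding cochain_agree_iff by blast
  moreover have "b (drop p us) x = b' (drop p us) x"
    using assms(2) t us unfolding cochain_agree_iff by blast
  ultimately show "cup_cochain p a b us x = cup_cochain p a' b' us x"
    by (simp add: cup_cochain_def)
qed

lemma cup_zero: "cup_cochain p (\<lambda>us x. 0) b = (\<lambda>us x. 0)" "cup_cochain p a (\<lambda>us x. 0) = (\<lambda>us x. 0)"
  by (simp_all add: cup_cochain_def fun_eq_iff)

lemma cup_add_left:
  "cup_cochain p (\<lambda>us x. a us x + a' us x) b = (\<lambda>us x. cup_cochain p a b us x + cup_cochain p a' b us x)"
  by (simp add: cup_cochain_def fun_eq_iff distrib_right)

lemma cup_add_right:
  "cup_cochain p a (\<lambda>us x. b us x + b' us x) = (\<lambda>us x. cup_cochain p a b us x + cup_cochain p a b' us x)"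
  by (simp add: cup_cochain_def fun_eq_iff distrib_left)

lemma coboundary_cup_agree:
  "cochain_agree (Suc (p + q)) \<U> (coboundary (cup_cochain p a b))
     (\<lambda>us x. cup_cochain (Suc p) (coboundary a) b us x + cup_cochain p a (coboundary b) us x)"
  by (simp add: cochain_agree_iff coboundary_cup)

lemma cup_cocycles:
  assumes "a \<in> cocycles p X \<U>" "b \<in> cocycles q X \<U>"
  shows "cup_cochain p a b \<in> cocycles (p + q) X \<U>"
proof -
  have "cochain_agree (Suc p + q) \<U> (cup_cochain (Suc p) (coboundary a) b) (\<lambda>us x. 0)"
    using cochain_agree_cup[of "Suc p" \<U> "coboundary a" "\<lambda>us x. 0" q b b] assms(1)
    by (simp add: cocycles_iff cup_zero) (simp add: cochain_agree_iff)
  moreover have "cochain_agree (p + Suc q) \<U> (cup_cochain p a (coboundary b)) (\<lambda>us x. 0)"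
    using cochain_agree_cup[of p \<U> a a "Suc q" "coboundary b" "\<lambda>us x. 0"] assms(2)
    by (simp add: cocycles_iff cup_zero) (simp add: cochain_agree_iff)
  ultimately have "cochain_agree (Suc (p + q)) \<U> (coboundary (cup_cochain p a b)) (\<lambda>us x. 0)"
    using coboundary_cup_agree[of p q \<U> a b] by (simp add: cochain_agree_iff)
  then show ?thesis using assms by (simp add: cocycles_iff cup_cochains)
qed

text \<open>
  A primitive \<open>e\<close> of the difference in one factor gives the primitive \<open>e \<union> b\<close> or \<open>a' \<union> e\<close> of the
  difference of the products, the other factor being a cocycle.
\<close>

lemma cohomologous_cup:
  assumes aa': "cohomologous p X \<U> a a'" and b: "b \<in> cocycles q X \<U>" and bb': "cohomologous q X \<U> b b'"
    and a': "a' \<in> cocycles p X \<U>"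
  shows "cohomologous (p + q) X \<U> (cup_cochain p a b) (cup_cochain p a' b')"
proof (rule cohomologous_trans)
  show "cohomologous (p + q) X \<U> (cup_cochain p a b) (cup_cochain p a' b)"
  proof (cases p)
    case 0
    with aa' have "cochain_agree p \<U> a a'" by (simp add: cohomologous_def)
    then show ?thesis
      by (intro cohomologous_agree cochain_agree_cup) (simp_all add: cochain_agree_iff)
  next
    case (Suc m)
    from aa' obtain e where e: "e \<in> cochains m X \<U>"
      "cochain_agree p \<U> (\<lambda>us x. a us x + a' us x) (coboundary e)"
      by (auto simp: cohomologous_iff Suc primitives_Suc)
    have "cochain_agree (p + q) \<U> (cup_cochain p (\<lambda>us x. a us x + a' us x) b) (cup_cochain p (coboundary e) b)"
      by (rule cochain_agree_cup[OF e(2)]) (simp add: cochain_agree_iff)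
    moreover have "cochain_agree (m + Suc q) \<U> (cup_cochain m e (coboundary b)) (\<lambda>us x. 0)"
      using cochain_agree_cup[of m \<U> e e "Suc q" "coboundary b" "\<lambda>us x. 0"] b
      by (simp add: cocycles_iff cup_zero) (simp add: cochain_agree_iff)
    moreover note coboundary_cup_agree[of m q \<U> e b]
    ultimately have "cochain_agree (p + q) \<U> (\<lambda>us x. cup_cochain p a b us x + cup_cochain p a' b us x)
        (coboundary (cup_cochain m e b))"
      by (simp add: cochain_agree_iff Suc cup_add_left)
    moreover have "cup_cochain m e b \<in> cochains (m + q) X \<U>"
      using e(1) b by (intro cup_cochains) (auto simp: cocycles_iff)
    ultimately show ?thesis by (auto simp: cohomologous_iff Suc primitives_Suc)
  qed
  show "cohomologous (p + q) X \<U> (cup_cochain p a' b) (cup_cochain p a' b')"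
  proof (cases q)
    case 0
    with bb' have "cochain_agree q \<U> b b'" by (simp add: cohomologous_def)
    then show ?thesis
      by (intro cohomologous_agree cochain_agree_cup) (simp_all add: cochain_agree_iff)
  next
    case (Suc m)
    from bb' obtain e where e: "e \<in> cochains m X \<U>"
      "cochain_agree q \<U> (\<lambda>us x. b us x + b' us x) (coboundary e)"
      by (auto simp: cohomologous_iff Suc primitives_Suc)
    have "cochain_agree (p + q) \<U> (cup_cochain p a' (\<lambda>us x. b us x + b' us x)) (cup_cochain p a' (coboundary e))"
      by (rule cochain_agree_cup[OF _ e(2)]) (simp add: cochain_agree_iff)
    moreover have "cochain_agree (Suc p + m) \<U> (cup_cochain (Suc p) (coboundary a') e) (\<lambda>us x. 0)"
      using cochain_agree_cup[of "Suc p" \<U> "coboundary a'" "\<lambda>us x. 0" m e e] a'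
      by (simp add: cocycles_iff cup_zero) (simp add: cochain_agree_iff)
    moreover note coboundary_cup_agree[of p m \<U> a' e]
    ultimately have "cochain_agree (p + q) \<U> (\<lambda>us x. cup_cochain p a' b us x + cup_cochain p a' b' us x)
        (coboundary (cup_cochain p a' e))"
      by (simp add: cochain_agree_iff Suc cup_add_right)
    moreover have "cup_cochain p a' e \<in> cochains (p + m) X \<U>"
      using e(1) a' by (intro cup_cochains) (auto simp: cocycles_iff)
    ultimately show ?thesis by (auto simp: cohomologous_iff Suc primitives_Suc)
  qed
qed

section \<open>Cech classes and their representatives\<close>

lemma open_coverD: "open_cover X \<U> \<Longrightarrow> U \<in> \<U> \<Longrightarrow> U \<subseteq> topspace X"
  by (auto simp: open_cover_def)

definition preimage_cover :: "'a topology \<Rightarrow> ('a \<Rightarrow> 'b) \<Rightarrow> 'b set set \<Rightarrow> 'a set set" where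
  "preimage_cover X f \<V> = (\<lambda>V. {x \<in> topspace X. f x \<in> V}) ` \<V>"

lemma open_cover_preimage:
  assumes "continuous_map X Y f" "open_cover Y \<V>"
  shows "open_cover X (preimage_cover X f \<V>)"
  using assms unfolding open_cover_def preimage_cover_def continuous_map_def Pi_def
  by auto

lemma cover_map_preimage: "\<exists>\<phi>. cover_map f (preimage_cover X f \<V>) \<V> \<phi>"
proof -
  have "\<forall>U\<in>preimage_cover X f \<V>. \<exists>V. V \<in> \<V> \<and> f ` U \<subseteq> V"
    by (auto simp: preimage_cover_def)
  then show ?thesis unfolding cover_map_def by (rule bchoice)
qed

lemma common_refinement:
  assumes "open_cover X \<U>" "open_cover X \<V>"
  obtains \<W> r s where "open_cover X \<W>" "cover_map id \<W> \<U> r" "cover_map id \<W> \<V> s"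
proof -
  define \<W> where "\<W> = {U \<inter> V | U V. U \<in> \<U> \<and> V \<in> \<V>}"
  have "\<forall>W\<in>\<W>. openin X W" using assms by (auto simp: \<W>_def open_cover_def)
  moreover have "\<Union>\<W> = \<Union>\<U> \<inter> \<Union>\<V>" unfolding \<W>_def by blast
  ultimately have 1: "open_cover X \<W>" using assms by (simp add: open_cover_def)
  have "\<forall>W\<in>\<W>. \<exists>U. U \<in> \<U> \<and> id ` W \<subseteq> U" "\<forall>W\<in>\<W>. \<exists>V. V \<in> \<V> \<and> id ` W \<subseteq> V"
    unfolding \<W>_def by auto
  from this[THEN bchoice] obtain r s where "cover_map id \<W> \<U> r" "cover_map id \<W> \<V> s"
    unfolding cover_map_def by blast
  with 1 show ?thesis by (rule that)
qed

lemma cech_rel_iff: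
  "((\<U>, a), (\<V>, b)) \<in> cech_rel n X \<longleftrightarrow>
     open_cover X \<U> \<and> a \<in> cocycles n X \<U> \<and> open_cover X \<V> \<and> b \<in> cocycles n X \<V> \<and>
     (\<exists>\<W> r s. open_cover X \<W> \<and> cover_map id \<W> \<U> r \<and> cover_map id \<W> \<V> s \<and>
        cohomologous n X \<W> (pullback_cochain id r a) (pullback_cochain id s b))"
  by (auto simp: cech_rel_def cech_cocycles_def)

text \<open>
  Equivalent cocycles become cohomologous on every sufficiently fine cover, whichever refinement maps
  are used.
\<close>

lemma cech_rel_fine:
  assumes "((\<U>, a), (\<V>, b)) \<in> cech_rel n X"
  obtains \<W> where "open_cover X \<W>"
    and "\<And>Z f \<A> t \<phi> \<psi>. continuous_map Z X f \<Longrightarrow> cover_map f \<A> \<W> t \<Longrightarrow> cover_map f \<A> \<U> \<phi> \<Longrightarrow>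
      cover_map f \<A> \<V> \<psi> \<Longrightarrow>
      cohomologous n (Z :: 'z topology) \<A> (pullback_cochain f \<phi> a) (pullback_cochain f \<psi> b)"
proof -
  from assms obtain \<W> r s where a: "a \<in> cocycles n X \<U>" and b: "b \<in> cocycles n X \<V>"
    and W: "open_cover X \<W>" and r: "cover_map id \<W> \<U> r" and s: "cover_map id \<W> \<V> s"
    and coh: "cohomologous n X \<W> (pullback_cochain id r a) (pullback_cochain id s b)"
    by (auto simp: cech_rel_iff)
  have "cohomologous n Z \<A> (pullback_cochain f \<phi> a) (pullback_cochain f \<psi> b)"
    if f: "continuous_map Z X f" and t: "cover_map f \<A> \<W> t" and \<phi>: "cover_map f \<A> \<U> \<phi>"
      and \<psi>: "cover_map f \<A> \<V> \<psi>"
    for Z :: "'z topology" and f \<A> t \<phi> \<psi>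
  proof -
    have "cohomologous n Z \<A> (pullback_cochain f \<phi> a) (pullback_cochain f (r \<circ> t) a)"
      using cover_map_comp[OF t r] by (intro cohomologous_cover_maps[OF f \<phi> _ a]) simp
    moreover have "cohomologous n Z \<A> (pullback_cochain f (r \<circ> t) a) (pullback_cochain f (s \<circ> t) b)"
      using cohomologous_pullback[OF f t coh] by (simp add: pullback_pullback)
    moreover have "cohomologous n Z \<A> (pullback_cochain f (s \<circ> t) b) (pullback_cochain f \<psi> b)"
      using cover_map_comp[OF t s] by (intro cohomologous_cover_maps[OF f _ \<psi> b]) simp
    ultimately show ?thesis by (blast intro: cohomologous_trans)
  qed
  with W show ?thesis by (rule that)
qed

text \<open>
  Transitivity is the point: on a common refinement of everything the two given refinement maps to
  the middle cover may differ, and the preceding lemma makes this difference irrelevant.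
\<close>

lemma equiv_cech_rel: "equiv (cech_cocycles n X) (cech_rel n X)"
proof (rule equivI)
  show "cech_rel n X \<subseteq> cech_cocycles n X \<times> cech_cocycles n X"
    by (auto simp: cech_rel_def)
  show "refl_on (cech_cocycles n X) (cech_rel n X)"
  proof (rule refl_onI)
    fix p assume "p \<in> cech_cocycles n X"
    then show "(p, p) \<in> cech_rel n X"
      by (cases p) (auto simp: cech_cocycles_def cech_rel_iff intro: cover_map_id cohomologous_refl)
  qed
  show "sym (cech_rel n X)"
    by (rule symI) (clarsimp simp: cech_rel_iff, blast intro: cohomologous_sym)
  show "trans (cech_rel n X)"
  proof (rule transI)
    fix p q r assume pq: "(p, q) \<in> cech_rel n X" and qr: "(q, r) \<in> cech_rel n X"
    obtain \<U> a \<V> b \<W> c where eqs: "p = (\<U>, a)" "q = (\<V>, b)" "r = (\<W>, c)"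
      by (cases p; cases q; cases r)
    from pq obtain \<A> where A: "open_cover X \<A>"
      "\<And>\<Z> t \<phi> \<psi>. cover_map id \<Z> \<A> t \<Longrightarrow> cover_map id \<Z> \<U> \<phi> \<Longrightarrow> cover_map id \<Z> \<V> \<psi> \<Longrightarrow>
        cohomologous n X \<Z> (pullback_cochain id \<phi> a) (pullback_cochain id \<psi> b)"
      unfolding eqs by (rule cech_rel_fine) (use continuous_map_id in blast)
    from qr obtain \<B> where B: "open_cover X \<B>"
      "\<And>\<Z> t \<phi> \<psi>. cover_map id \<Z> \<B> t \<Longrightarrow> cover_map id \<Z> \<V> \<phi> \<Longrightarrow> cover_map id \<Z> \<W> \<psi> \<Longrightarrow>
        cohomologous n X \<Z> (pullback_cochain id \<phi> b) (pullback_cochain id \<psi> c)"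
      unfolding eqs by (rule cech_rel_fine) (use continuous_map_id in blast)
    have covers: "open_cover X \<U>" "open_cover X \<V>" "open_cover X \<W>"
      using pq qr by (auto simp: eqs cech_rel_iff)
    obtain \<C> a1 b1 where C: "open_cover X \<C>" "cover_map id \<C> \<A> a1" "cover_map id \<C> \<B> b1"
      using common_refinement[OF A(1) B(1)] .
    obtain \<D> c2 u2 where D: "open_cover X \<D>" "cover_map id \<D> \<C> c2" "cover_map id \<D> \<U> u2"
      using common_refinement[OF C(1) covers(1)] .
    obtain \<E> d3 v3 where E: "open_cover X \<E>" "cover_map id \<E> \<D> d3" "cover_map id \<E> \<V> v3"
      using common_refinement[OF D(1) covers(2)] .
    obtain \<F> e4 w4 where F: "open_cover X \<F>" "cover_map id \<F> \<E> e4" "cover_map id \<F> \<W> w4"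
      using common_refinement[OF E(1) covers(3)] .
    note comp = cover_map_comp[of id _ _ _ id, simplified]
    have FD: "cover_map id \<F> \<D> (d3 \<circ> e4)" and FV: "cover_map id \<F> \<V> (v3 \<circ> e4)"
      using comp[OF F(2) E(2)] comp[OF F(2) E(3)] by auto
    have FU: "cover_map id \<F> \<U> (u2 \<circ> (d3 \<circ> e4))" and FC: "cover_map id \<F> \<C> (c2 \<circ> (d3 \<circ> e4))"
      using comp[OF FD D(3)] comp[OF FD D(2)] by auto
    show "(p, r) \<in> cech_rel n X"
      using cohomologous_trans[OF A(2)[OF comp[OF FC C(2)] FU FV] B(2)[OF comp[OF FC C(3)] FV F(3)]]
        pq qr F(1,3) FU unfolding eqs cech_rel_iff by blast
  qed
qed

lemma cech_class_eq_iff: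
  assumes "open_cover X \<U>" "a \<in> cocycles n X \<U>" "open_cover X \<V>" "b \<in> cocycles n X \<V>"
  shows "cech_class_of n X \<U> a = cech_class_of n X \<V> b \<longleftrightarrow> ((\<U>, a), (\<V>, b)) \<in> cech_rel n X"
  unfolding cech_class_of_def
  by (rule eq_equiv_class_iff[OF equiv_cech_rel]) (use assms in \<open>auto simp: cech_cocycles_def\<close>)

lemma cech_class_of_carrier:
  "open_cover X \<U> \<Longrightarrow> a \<in> cocycles n X \<U> \<Longrightarrow>
     cech_class_of n X \<U> a \<in> carrier (cech_cohomology n X)"
  by (auto simp: cech_cohomology_def cech_class_of_def cech_cocycles_def intro!: quotientI)

lemma mem_cech_class_iff: "(\<V>, b) \<in> cech_class_of n X \<U> a \<longleftrightarrow> ((\<U>, a), (\<V>, b)) \<in> cech_rel n X"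
  by (simp add: cech_class_of_def)

lemma cech_class_self:
  "open_cover X \<U> \<Longrightarrow> a \<in> cocycles n X \<U> \<Longrightarrow> (\<U>, a) \<in> cech_class_of n X \<U> a"
  by (simp add: mem_cech_class_iff flip: cech_class_eq_iff)

lemma cech_class_refine:
  assumes "open_cover X \<U>" "a \<in> cocycles n X \<U>" "open_cover X \<W>" "cover_map id \<W> \<U> r"
  shows "cech_class_of n X \<W> (pullback_cochain id r a) = cech_class_of n X \<U> a"
proof (subst cech_class_eq_iff)
  show *: "pullback_cochain id r a \<in> cocycles n X \<W>"
    using assms by (intro cocycles_pullback) simp_all
  show "((\<W>, pullback_cochain id r a), (\<U>, a)) \<in> cech_rel n X"
    unfolding cech_rel_iff
    using assms * cover_map_id[of \<W>] cohomologous_refl by (metis pullback_id)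
qed (use assms in auto)

text \<open>The cocycle \<open>c\<close> represents the zero class; see \<open>cech_class_zero_iff\<close>.\<close>

definition cech_vanishes :: "nat \<Rightarrow> 'a topology \<Rightarrow> 'a set set \<Rightarrow> 'a cochain \<Rightarrow> bool" where
  "cech_vanishes n X \<U> c \<longleftrightarrow>
     (\<exists>\<W> r. open_cover X \<W> \<and> cover_map id \<W> \<U> r \<and>
        cohomologous n X \<W> (pullback_cochain id r c) (\<lambda>us x. 0))"

lemma cech_vanishes_refine:
  assumes "cover_map id \<W> \<U> r" "cech_vanishes n X \<W> (pullback_cochain id r c)"
  shows "cech_vanishes n X \<U> c"
proof -
  from assms(2) obtain \<Z> s where "open_cover X \<Z>" "cover_map id \<Z> \<W> s"
    "cohomologous n X \<Z> (pullback_cochain id s (pullback_cochain id r c)) (\<lambda>us x. 0)"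
    by (auto simp: cech_vanishes_def)
  with cover_map_comp[OF this(2) assms(1)] show ?thesis
    unfolding cech_vanishes_def by (auto simp: pullback_pullback)
qed

lemma cech_vanishes_cohomologous:
  assumes "cohomologous n X \<U> a b" "cech_vanishes n X \<U> b"
  shows "cech_vanishes n X \<U> a"
proof -
  from assms(2) obtain \<W> r where W: "open_cover X \<W>" "cover_map id \<W> \<U> r"
    "cohomologous n X \<W> (pullback_cochain id r b) (\<lambda>us x. 0)"
    by (auto simp: cech_vanishes_def)
  moreover have "cohomologous n X \<W> (pullback_cochain id r a) (pullback_cochain id r b)"
    using assms(1) W(2) by (intro cohomologous_pullback) simp_all
  ultimately show ?thesis unfolding cech_vanishes_def by (blast intro: cohomologous_trans)
qed

lemma cech_vanishes_agree:
  "cochain_agree n \<U> a b \<Longrightarrow> cech_vanishes n X \<U> b \<Longrightarrow> cech_vanishes n X \<U> a"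
  by (rule cech_vanishes_cohomologous[OF cohomologous_agree])

lemma cech_vanishesI:
  assumes "open_cover X \<U>" "cohomologous n X \<U> a (\<lambda>us x. 0)"
  shows "cech_vanishes n X \<U> a"
  unfolding cech_vanishes_def using assms cover_map_id[of \<U>] pullback_id by metis

text \<open>
  A cover on which \<open>c\<close> bounds need not pull back to a refinement of \<open>\<A>\<close>; on a common refinement the
  map of covers through \<open>\<W>\<close> replaces the one through \<open>\<A>\<close> up to homotopy.
\<close>

lemma cech_vanishes_pullback:
  assumes f: "continuous_map X Y f" and A: "open_cover X \<A>" and \<phi>: "cover_map f \<A> \<U> \<phi>"
    and c: "c \<in> cocycles n Y \<U>" and van: "cech_vanishes n Y \<U> c"
  shows "cech_vanishes n X \<A> (pullback_cochain f \<phi> c)"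
proof -
  from van obtain \<W> r where W: "open_cover Y \<W>" "cover_map id \<W> \<U> r"
    "cohomologous n Y \<W> (pullback_cochain id r c) (\<lambda>us x. 0)"
    by (auto simp: cech_vanishes_def)
  obtain \<psi> where \<psi>: "cover_map f (preimage_cover X f \<W>) \<W> \<psi>"
    using cover_map_preimage by blast
  obtain \<B> s t where B: "open_cover X \<B>" "cover_map id \<B> \<A> s" "cover_map id \<B> (preimage_cover X f \<W>) t"
    using common_refinement[OF A open_cover_preimage[OF f W(1)]] .
  have t: "cover_map f \<B> \<W> (\<psi> \<circ> t)" using cover_map_comp[OF B(3) \<psi>] by simp
  have "cohomologous n X \<B> (pullback_cochain f (\<phi> \<circ> s) c) (pullback_cochain f (r \<circ> (\<psi> \<circ> t)) c)"
    using cover_map_comp[OF B(2) \<phi>] cover_map_comp[OF t W(2)]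
    by (intro cohomologous_cover_maps[OF f _ _ c]) simp_all
  moreover have "cohomologous n X \<B> (pullback_cochain f (r \<circ> (\<psi> \<circ> t)) c) (\<lambda>us x. 0)"
    using cohomologous_pullback[OF f t W(3)] by (simp add: pullback_pullback pullback_const)
  ultimately have "cohomologous n X \<B> (pullback_cochain id s (pullback_cochain f \<phi> c)) (\<lambda>us x. 0)"
    using cohomologous_trans by (fastforce simp: pullback_pullback)
  with B show ?thesis unfolding cech_vanishes_def by blast
qed

lemma cech_class_eq_iff_vanishes:
  assumes U: "open_cover X \<U>" and a: "a \<in> cocycles n X \<U>" and b: "b \<in> cocycles n X \<U>"
  shows "cech_class_of n X \<U> a = cech_class_of n X \<U> b \<longleftrightarrow>
    cech_vanishes n X \<U> (\<lambda>us x. a us x + b us x)"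
proof
  assume "cech_class_of n X \<U> a = cech_class_of n X \<U> b"
  then have "((\<U>, a), (\<U>, b)) \<in> cech_rel n X" by (simp add: cech_class_eq_iff assms)
  then obtain \<W> where W: "open_cover X \<W>"
    "\<And>\<Z> t \<phi> \<psi>. cover_map id \<Z> \<W> t \<Longrightarrow> cover_map id \<Z> \<U> \<phi> \<Longrightarrow> cover_map id \<Z> \<U> \<psi> \<Longrightarrow>
        cohomologous n X \<Z> (pullback_cochain id \<phi> a) (pullback_cochain id \<psi> b)"
    by (rule cech_rel_fine) (use continuous_map_id in blast)
  obtain \<Z> r s where Z: "open_cover X \<Z>" "cover_map id \<Z> \<U> r" "cover_map id \<Z> \<W> s"
    using common_refinement[OF U W(1)] .
  from W(2)[OF Z(3,2,2)] have "cohomologous n X \<Z> (pullback_cochain id r (\<lambda>us x. a us x + b us x)) (\<lambda>us x. 0)"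
    by (simp add: pullback_add cohomologous_sum_iff)
  with Z show "cech_vanishes n X \<U> (\<lambda>us x. a us x + b us x)"
    unfolding cech_vanishes_def by blast
next
  assume "cech_vanishes n X \<U> (\<lambda>us x. a us x + b us x)"
  then obtain \<W> r where "open_cover X \<W>" "cover_map id \<W> \<U> r"
    "cohomologous n X \<W> (pullback_cochain id r a) (pullback_cochain id r b)"
    by (auto simp: cech_vanishes_def pullback_add cohomologous_sum_iff)
  then show "cech_class_of n X \<U> a = cech_class_of n X \<U> b"
    using assms by (auto simp: cech_class_eq_iff cech_rel_iff)
qed

lemma open_cover_topspace: "open_cover X {topspace X}"
  by (simp add: open_cover_def)

lemma cover_map_topspace:
  "open_cover X \<U> \<Longrightarrow> cover_map id \<U> {topspace X} (\<lambda>U. topspace X)"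
  by (auto simp: cover_map_def open_cover_def)

lemma cech_zero_eq: "open_cover X \<U> \<Longrightarrow> cech_zero n X = cech_class_of n X \<U> (\<lambda>us x. 0)"
  using cech_class_refine[OF open_cover_topspace cocycles_zero _ cover_map_topspace, of X \<U> n]
  by (simp add: cech_zero_def pullback_const)

lemma cech_class_zero_iff:
  assumes "open_cover X \<U>" "a \<in> cocycles n X \<U>"
  shows "cech_class_of n X \<U> a = cech_zero n X \<longleftrightarrow> cech_vanishes n X \<U> a"
  using cech_class_eq_iff_vanishes[OF assms cocycles_zero] by (simp add: cech_zero_eq[OF assms(1)])

text \<open>
  The union that defines the induced map has only one member: any two choices of representative,
  cover and map of covers become cohomologous on a common refinement.
\<close>

lemma cech_induced_class:
  assumes f: "continuous_map X Y f" and V: "open_cover Y \<V>" and b: "b \<in> cocycles n Y \<V>"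
    and A: "open_cover X \<A>" and \<phi>: "cover_map f \<A> \<V> \<phi>"
  shows "cech_induced n X Y f (cech_class_of n Y \<V> b) = cech_class_of n X \<A> (pullback_cochain f \<phi> b)"
proof -
  have eq: "cech_class_of n X \<A>' (pullback_cochain f \<phi>' b') = cech_class_of n X \<A> (pullback_cochain f \<phi> b)"
    if b': "(\<V>', b') \<in> cech_class_of n Y \<V> b" and A': "open_cover X \<A>'" and \<phi>': "cover_map f \<A>' \<V>' \<phi>'"
    for \<V>' b' \<A>' \<phi>'
  proof -
    from b' have rel: "((\<V>, b), (\<V>', b')) \<in> cech_rel n Y" by (simp add: mem_cech_class_iff)
    then have "b' \<in> cocycles n Y \<V>'" by (simp add: cech_rel_iff)
    note coc = cocycles_pullback[OF f \<phi> b] cocycles_pullback[OF f \<phi>' this]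
    from rel obtain \<W> where W: "open_cover Y \<W>"
      "\<And>\<Z> t \<phi> \<psi>. cover_map f \<Z> \<W> t \<Longrightarrow> cover_map f \<Z> \<V> \<phi> \<Longrightarrow> cover_map f \<Z> \<V>' \<psi> \<Longrightarrow>
        cohomologous n X \<Z> (pullback_cochain f \<phi> b) (pullback_cochain f \<psi> b')"
      by (rule cech_rel_fine) (use f in blast)
    obtain \<psi> where \<psi>: "cover_map f (preimage_cover X f \<W>) \<W> \<psi>"
      using cover_map_preimage by blast
    obtain \<B> s t where B: "open_cover X \<B>" "cover_map id \<B> \<A> s" "cover_map id \<B> (preimage_cover X f \<W>) t"
      using common_refinement[OF A open_cover_preimage[OF f W(1)]] .
    obtain \<C> u v where C: "open_cover X \<C>" "cover_map id \<C> \<B> u" "cover_map id \<C> \<A>' v"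
      using common_refinement[OF B(1) A'] .
    note comp = cover_map_comp[of id _ _ _ id, simplified]
    have s: "cover_map id \<C> \<A> (s \<circ> u)" and t: "cover_map id \<C> (preimage_cover X f \<W>) (t \<circ> u)"
      using comp[OF C(2)] B by auto
    note fcomp = cover_map_comp[of id _ _ _ f, simplified]
    from W(2)[OF fcomp[OF t \<psi>] fcomp[OF s \<phi>] fcomp[OF C(3) \<phi>']]
    have "cohomologous n X \<C> (pullback_cochain id (s \<circ> u) (pullback_cochain f \<phi> b))
        (pullback_cochain id v (pullback_cochain f \<phi>' b'))"
      by (simp add: pullback_pullback)
    then have "((\<A>, pullback_cochain f \<phi> b), (\<A>', pullback_cochain f \<phi>' b')) \<in> cech_rel n X"
      using coc A A' C s unfolding cech_rel_iff by blast
    with coc A A' show ?thesis by (simp add: cech_class_eq_iff[symmetric])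
  qed
  have "{cech_class_of n X \<U> (pullback_cochain f \<phi> b') | \<U> \<phi> \<V>' b'.
      (\<V>', b') \<in> cech_class_of n Y \<V> b \<and> open_cover X \<U> \<and> cover_map f \<U> \<V>' \<phi>}
      = {cech_class_of n X \<A> (pullback_cochain f \<phi> b)}"
    using eq cech_class_self[OF V b] A \<phi> by blast
  then show ?thesis by (simp add: cech_induced_def)
qed

lemma cech_cup_class:
  assumes V: "open_cover X \<V>" and a: "a \<in> cocycles p X \<V>" and b: "b \<in> cocycles q X \<V>"
  shows "cech_cup p q X (cech_class_of p X \<V> a) (cech_class_of q X \<V> b) =
    cech_class_of (p + q) X \<V> (cup_cochain p a b)"
proof -
  have eq: "cech_class_of (p + q) X \<U> (cup_cochain p a' b') = cech_class_of (p + q) X \<V> (cup_cochain p a b)"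
    if a': "(\<U>, a') \<in> cech_class_of p X \<V> a" and b': "(\<U>, b') \<in> cech_class_of q X \<V> b" for \<U> a' b'
  proof -
    from a' have ra: "((\<V>, a), (\<U>, a')) \<in> cech_rel p X" by (simp add: mem_cech_class_iff)
    from b' have rb: "((\<V>, b), (\<U>, b')) \<in> cech_rel q X" by (simp add: mem_cech_class_iff)
    from ra rb have coc: "open_cover X \<U>" "a' \<in> cocycles p X \<U>" "b' \<in> cocycles q X \<U>"
      by (auto simp: cech_rel_iff)
    from ra obtain \<A> where A: "open_cover X \<A>"
      "\<And>\<Z> t \<phi> \<psi>. cover_map id \<Z> \<A> t \<Longrightarrow> cover_map id \<Z> \<V> \<phi> \<Longrightarrow> cover_map id \<Z> \<U> \<psi> \<Longrightarrow>
        cohomologous p X \<Z> (pullback_cochain id \<phi> a) (pullback_cochain id \<psi> a')"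
      by (rule cech_rel_fine) (use continuous_map_id in blast)
    from rb obtain \<B> where B: "open_cover X \<B>"
      "\<And>\<Z> t \<phi> \<psi>. cover_map id \<Z> \<B> t \<Longrightarrow> cover_map id \<Z> \<V> \<phi> \<Longrightarrow> cover_map id \<Z> \<U> \<psi> \<Longrightarrow>
        cohomologous q X \<Z> (pullback_cochain id \<phi> b) (pullback_cochain id \<psi> b')"
      by (rule cech_rel_fine) (use continuous_map_id in blast)
    obtain \<C> a1 b1 where C: "open_cover X \<C>" "cover_map id \<C> \<A> a1" "cover_map id \<C> \<B> b1"
      using common_refinement[OF A(1) B(1)] .
    obtain \<D> c2 u2 where D: "open_cover X \<D>" "cover_map id \<D> \<C> c2" "cover_map id \<D> \<U> u2"
      using common_refinement[OF C(1) coc(1)] .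
    obtain \<E> d3 v3 where E: "open_cover X \<E>" "cover_map id \<E> \<D> d3" "cover_map id \<E> \<V> v3"
      using common_refinement[OF D(1) V] .
    note comp = cover_map_comp[of id _ _ _ id, simplified]
    have EC: "cover_map id \<E> \<C> (c2 \<circ> d3)" and EU: "cover_map id \<E> \<U> (u2 \<circ> d3)"
      using comp[OF E(2) D(2)] comp[OF E(2) D(3)] by auto
    have "cohomologous (p + q) X \<E> (cup_cochain p (pullback_cochain id v3 a) (pullback_cochain id v3 b))
       (cup_cochain p (pullback_cochain id (u2 \<circ> d3) a') (pullback_cochain id (u2 \<circ> d3) b'))"
      by (intro cohomologous_cup A(2)[OF comp[OF EC C(2)] E(3) EU] B(2)[OF comp[OF EC C(3)] E(3) EU]
          cocycles_pullback[OF _ E(3) b] cocycles_pullback[OF _ EU coc(2)]) simp_all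
    then have "((\<V>, cup_cochain p a b), (\<U>, cup_cochain p a' b')) \<in> cech_rel (p + q) X"
      using E EU coc V cup_cocycles[OF a b] cup_cocycles[OF coc(2,3)]
      unfolding cech_rel_iff pullback_cup[symmetric] by blast
    with coc V cup_cocycles[OF a b] cup_cocycles[OF coc(2,3)] show ?thesis
      by (simp add: cech_class_eq_iff[symmetric])
  qed
  have "{cech_class_of (p + q) X \<U> (cup_cochain p a' b') | \<U> a' b'.
      (\<U>, a') \<in> cech_class_of p X \<V> a \<and> (\<U>, b') \<in> cech_class_of q X \<V> b}
      = {cech_class_of (p + q) X \<V> (cup_cochain p a b)}"
    using eq cech_class_self[OF V a] cech_class_self[OF V b] by blast
  then show ?thesis by (simp add: cech_cup_def)
qed

section \<open>Cohomology above the covering dimension\<close>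

text \<open>A finite infimum of integers is attained, and the bound on the order is monotone.\<close>

lemma covering_dim_eqD:
  assumes "covering_dim X = ereal (real k)"
  shows "covering_dim_le X (int k)"
proof -
  have "\<exists>n\<in>{n. - 1 \<le> n \<and> covering_dim_le X n}. n \<le> int k"
  proof (rule ccontr)
    assume "\<not> ?thesis"
    then have "ereal (real_of_int (int k + 1)) \<le> covering_dim X"
      unfolding covering_dim_def by (intro INF_greatest) force
    with assms show False by simp
  qed
  then obtain n where n: "covering_dim_le X n" "n \<le> int k" by blast
  show ?thesis
    unfolding covering_dim_le_def
  proof (intro allI impI)
    fix \<U> assume "open_cover X \<U>"
    with n(1) obtain \<V> where "open_cover X \<V>" "refines \<V> \<U>"
      "\<forall>x\<in>topspace X. finite {V \<in> \<V>. x \<in> V} \<and> int (card {V \<in> \<V>. x \<in> V}) \<le> n + 1"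
      unfolding covering_dim_le_def by blast
    with n(2) show "\<exists>\<V>. open_cover X \<V> \<and> refines \<V> \<U> \<and>
        (\<forall>x\<in>topspace X. finite {V \<in> \<V>. x \<in> V} \<and> int (card {V \<in> \<V>. x \<in> V}) \<le> int k + 1)"
      by (intro exI[of _ \<V>]) force
  qed
qed

text \<open>
  On a cover of order at most \<open>k + 1\<close> every tuple of more than \<open>k + 1\<close> members with a common point
  has a repetition, so that the sorted part of a cochain vanishes there.
\<close>

lemma cech_vanishes_above_dim:
  assumes dim: "covering_dim_le X (int k)" and "k < n" and U: "open_cover X \<U>" and c: "c \<in> cocycles n X \<U>"
  shows "cech_vanishes n X \<U> c"
proof -
  from dim U obtain \<V> where V: "open_cover X \<V>" "refines \<V> \<U>"
    and order: "\<And>x. x \<in> topspace X \<Longrightarrow> finite {V \<in> \<V>. x \<in> V} \<and> int (card {V \<in> \<V>. x \<in> V}) \<le> int k + 1"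
    unfolding covering_dim_le_def by blast
  from V(2) have "\<forall>V\<in>\<V>. \<exists>U. U \<in> \<U> \<and> id ` V \<subseteq> U" by (auto simp: refines_def)
  from bchoice[OF this] obtain r where r: "cover_map id \<V> \<U> r" by (auto simp: cover_map_def)
  define b where "b = pullback_cochain id r c"
  have b: "b \<in> cocycles n X \<V>" unfolding b_def by (rule cocycles_pullback[OF _ r c]) simp
  obtain R :: "'a set set \<Rightarrow> 'a set list" where R: "coherent_enumeration R"
    using coherent_enumeration_exists by blast
  have "cohomologous n X \<V> b (\<lambda>us x. 0)"
  proof (rule cohomologousI)
    show "sorting_homotopy R n b \<in> primitives n X \<V>"
      unfolding primitives_def mem_Collect_eq
    proof (intro allI impI conjI)
      fix us assume us: "length us = n" "set us \<subseteq> \<V>"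
      show "locally_const X (\<Inter>(set us)) (sorting_homotopy R n b us)"
      proof (rule sorting_homotopy_locally_const[OF R us(1)])
        fix vs assume vs: "length vs = Suc n" "set vs \<subseteq> set us"
        with us b have "locally_const X (\<Inter>(set vs)) (b vs)"
          by (auto simp: cocycles_iff cochains_iff)
        then show "locally_const X (\<Inter>(set us)) (b vs)"
          by (rule locally_const_mono) (use vs in auto)
      qed
      show "sorting_homotopy R n b us = (\<lambda>x. 0)" if "us = []"
        using that \<open>k < n\<close> us by simp
    qed
    fix us x assume us: "length us = Suc n" "set us \<subseteq> \<V>" "x \<in> \<Inter>(set us)"
    have "us \<noteq> []" using us(1) by auto
    then have x: "x \<in> topspace X"
      using us V(1) by (meson Inter_iff hd_in_set open_coverD subsetD)
    have "\<not> distinct us"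
    proof
      assume "distinct us"
      then have "card (set us) = Suc n" using us(1) by (simp add: distinct_card)
      moreover have "card (set us) \<le> card {V \<in> \<V>. x \<in> V}"
        using order[OF x] us by (intro card_mono) auto
      ultimately show False using order[OF x] \<open>k < n\<close> by simp
    qed
    then have "sorted_part R b us x = 0" by (simp add: sorted_part_def)
    moreover have "sorting_homotopy R (Suc n) (coboundary b) us x = sorting_homotopy R (Suc n) (\<lambda>us x. 0) us x"
    proof (rule sorting_homotopy_cong[OF R us(1)])
      fix vs assume "length vs = Suc (Suc n)" "set vs \<subseteq> set us"
      with us b show "coboundary b vs x = 0"
        unfolding cocycles_iff cochain_agree_iff by (meson Inter_iff subset_trans subsetD)
    qed
    moreover have "sorting_homotopy R m (\<lambda>us x. 0) = (\<lambda>us x. 0)" for m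
      by (induction m) (simp_all add: sorted_part_def)
    ultimately show "b us x + 0 = coboundary (sorting_homotopy R n b) us x"
      using sorting_homotopy[OF R us(1), of b x] by (simp del: sorting_homotopy.simps)
  qed
  with V(1) r show ?thesis unfolding cech_vanishes_def b_def by blast
qed

section \<open>Orbit spaces of free involutions\<close>

abbreviation orb :: "('a \<Rightarrow> 'a) \<Rightarrow> 'a \<Rightarrow> 'a set" where
  "orb S x \<equiv> {x, S x}"

lemma free_Z2_spaceD:
  assumes "free_Z2_space X S"
  shows "continuous_map X X S"
    and "x \<in> topspace X \<Longrightarrow> S (S x) = x" "x \<in> topspace X \<Longrightarrow> S x \<noteq> x"
    and "x \<in> topspace X \<Longrightarrow> S x \<in> topspace X"
  using assms by (auto simp: free_Z2_space_def continuous_map_def)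

lemma topspace_orbit_space: "topspace (orbit_space X S) = orb S ` topspace X"
  using quotient_imp_surjective_map[OF quotient_map_orbit_space[of X S]] by simp

lemma continuous_map_orb: "continuous_map X (orbit_space X S) (orb S)"
  by (rule quotient_imp_continuous_map[OF quotient_map_orbit_space])

lemma orb_involution: "free_Z2_space X S \<Longrightarrow> x \<in> topspace X \<Longrightarrow> orb S (S x) = orb S x"
  by (auto simp: free_Z2_spaceD)

lemma orb_eqD: "orb S x = orb S y \<Longrightarrow> x = y \<or> x = S y"
  by (metis insertI1 insertE singletonD)

text \<open>The saturation of \<open>G\<close> is \<open>G \<union> S\<^sup>-\<^sup>1 G\<close>; hence the orbit map of an involution is open.\<close>

lemma openin_orb_image:
  assumes S: "continuous_map X X S" "\<And>x. x \<in> topspace X \<Longrightarrow> S (S x) = x" and G: "openin X G"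
  shows "openin (orbit_space X S) (orb S ` G)"
proof -
  have sub: "G \<subseteq> topspace X" using G by (rule openin_subset)
  have "{x \<in> topspace X. orb S x \<in> orb S ` G} = G \<union> {x \<in> topspace X. S x \<in> G}"
  proof (intro equalityI subsetI)
    fix x assume "x \<in> {x \<in> topspace X. orb S x \<in> orb S ` G}"
    then obtain g where g: "x \<in> topspace X" "g \<in> G" "orb S g = orb S x" by blast
    from orb_eqD[where S = S, OF g(3)] g(1,2) show "x \<in> G \<union> {x \<in> topspace X. S x \<in> G}" by blast
  next
    fix x assume "x \<in> G \<union> {x \<in> topspace X. S x \<in> G}"
    then consider "x \<in> G" | "x \<in> topspace X" "S x \<in> G" by blast
    then show "x \<in> {x \<in> topspace X. orb S x \<in> orb S ` G}"
    proof cases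
      case 2
      then have "orb S x = orb S (S x)" using S(2) by auto
      with 2 show ?thesis by blast
    qed (use sub in blast)
  qed
  moreover have "openin X {x \<in> topspace X. S x \<in> G}"
    using S(1) G by (rule openin_continuous_map_preimage)
  ultimately have "openin X {x \<in> topspace X. orb S x \<in> orb S ` G}"
    using openin_Un[OF G] by (simp only:)
  then show ?thesis using sub unfolding openin_orbit_space by blast
qed

lemma locally_const_orbit_space:
  assumes X: "free_Z2_space X S"
    and g: "locally_const X {x \<in> topspace X. orb S x \<in> A} (\<lambda>x. g (orb S x))"
  shows "locally_const (orbit_space X S) A g"
  unfolding locally_const_iff
proof
  fix b assume "b \<in> topspace (orbit_space X S) \<inter> A"
  then obtain x where x: "x \<in> topspace X" "b = orb S x" "b \<in> A"
    by (auto simp: topspace_orbit_space)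
  with g obtain U where U: "openin X U" "x \<in> U"
    "\<forall>y\<in>U \<inter> {x \<in> topspace X. orb S x \<in> A}. g (orb S y) = g (orb S x)"
    unfolding locally_const_iff by blast
  have "openin (orbit_space X S) (orb S ` U)"
    using openin_orb_image[OF _ _ U(1)] free_Z2_spaceD[OF X] by blast
  moreover have "\<forall>c\<in>orb S ` U \<inter> A. g c = g b"
    using U(3) openin_subset[OF U(1)] x(2) by blast
  ultimately show "\<exists>U. openin (orbit_space X S) U \<and> b \<in> U \<and> (\<forall>c\<in>U \<inter> A. g c = g b)"
    using U(2) x(2) by blast
qed

text \<open>
  By the Hausdorff property a free involution is a covering transformation: every point lies in a
  sheet, an open set disjoint from its image.
\<close>

lemma separating_neighbourhood:
  assumes X: "free_Z2_space X S" and x: "x \<in> topspace X"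
  obtains G where "openin X G" "x \<in> G" "G \<inter> S ` G = {}"
proof -
  note S = free_Z2_spaceD[OF X]
  have "Hausdorff_space X" using X by (simp add: free_Z2_space_def)
  then obtain U V where UV: "openin X U" "openin X V" "x \<in> U" "S x \<in> V" "disjnt U V"
    using x S(3)[OF x] S(4)[OF x] unfolding Hausdorff_space_def by metis
  let ?G = "U \<inter> {y \<in> topspace X. S y \<in> V}"
  have "openin X ?G"
    using UV openin_continuous_map_preimage[OF S(1)] by blast
  moreover have "?G \<inter> S ` ?G = {}" using UV(5) by (auto simp: disjnt_def)
  ultimately show ?thesis using that UV x by blast
qed

text \<open>
  Meaningful at the orbits at whose two points \<open>h\<close> takes equal values; the choice of a point is then
  immaterial.
\<close>

definition descend :: "'a topology \<Rightarrow> ('a \<Rightarrow> 'a) \<Rightarrow> ('a \<Rightarrow> bit) \<Rightarrow> 'a set \<Rightarrow> bit" where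
  "descend X S h b = h (SOME x. x \<in> topspace X \<and> orb S x = b)"

lemma descend_orb:
  assumes x: "x \<in> topspace X" and h: "h (S x) = h x"
  shows "descend X S h (orb S x) = h x"
proof -
  define y where "y = (SOME y. y \<in> topspace X \<and> orb S y = orb S x)"
  have "y \<in> topspace X \<and> orb S y = orb S x"
    unfolding y_def by (rule someI[of "\<lambda>y. y \<in> topspace X \<and> orb S y = orb S x" x]) (simp add: x)
  then have "orb S y = orb S x" by (rule conjunct2)
  then have "y = x \<or> y = S x" by (rule orb_eqD[where S = S])
  then show ?thesis unfolding descend_def y_def[symmetric] using h by blast
qed

section \<open>The characteristic class of a double cover\<close>

text \<open>
  For every member \<open>V\<close> of a cover of \<open>X/S\<close> the function \<open>\<epsilon> V\<close> distinguishes the two sheets over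
  \<open>V\<close>; it is a trivialization of the double cover. On \<open>X\<close> the cocycle \<open>w\<close> becomes the coboundary of
  \<open>\<epsilon>\<close>; all the rest follows from this relation.
\<close>

definition double_cover_signs ::
    "'a topology \<Rightarrow> ('a \<Rightarrow> 'a) \<Rightarrow> 'a set set set \<Rightarrow> ('a set set \<Rightarrow> 'a \<Rightarrow> bit) \<Rightarrow> 'a set cochain \<Rightarrow> bool" where
  "double_cover_signs X S \<V> \<epsilon> w \<longleftrightarrow>
     open_cover (orbit_space X S) \<V> \<and>
     (\<forall>V\<in>\<V>. locally_const X {x \<in> topspace X. orb S x \<in> V} (\<epsilon> V) \<and>
        (\<forall>x\<in>topspace X. orb S x \<in> V \<longrightarrow> \<epsilon> V (S x) = \<epsilon> V x + 1)) \<and>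
     (\<forall>U\<in>\<V>. \<forall>V\<in>\<V>. \<forall>x\<in>topspace X. orb S x \<in> U \<inter> V \<longrightarrow> w [U, V] (orb S x) = \<epsilon> U x + \<epsilon> V x)"

lemma double_cover_signsD:
  assumes "double_cover_signs X S \<V> \<epsilon> w"
  shows "open_cover (orbit_space X S) \<V>"
    and "V \<in> \<V> \<Longrightarrow> locally_const X {x \<in> topspace X. orb S x \<in> V} (\<epsilon> V)"
    and "V \<in> \<V> \<Longrightarrow> x \<in> topspace X \<Longrightarrow> orb S x \<in> V \<Longrightarrow> \<epsilon> V (S x) = \<epsilon> V x + 1"
    and "U \<in> \<V> \<Longrightarrow> V \<in> \<V> \<Longrightarrow> x \<in> topspace X \<Longrightarrow> orb S x \<in> U \<Longrightarrow> orb S x \<in> V \<Longrightarrow>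
      w [U, V] (orb S x) = \<epsilon> U x + \<epsilon> V x"
  using assms by (simp_all add: double_cover_signs_def)

lemma open_cover_orbit_pointE:
  assumes "open_cover (orbit_space X S) \<V>" "V \<in> \<V>" "b \<in> V"
  obtains x where "x \<in> topspace X" "b = orb S x"
  using open_coverD[OF assms(1,2)] assms(3) by (auto simp: topspace_orbit_space)

lemma double_cover_signs_cocycle:
  assumes X: "free_Z2_space X S" and w: "double_cover_signs X S \<V> \<epsilon> w"
  shows "w \<in> cocycles 1 (orbit_space X S) \<V>"
  unfolding cocycles_iff cochains_iff cochain_agree_iff
proof (intro conjI allI impI ballI)
  note D = double_cover_signsD[OF w]
  fix us :: "'a set set list" assume us: "length us = Suc 1" "set us \<subseteq> \<V>"
  then obtain U V where UV: "us = [U, V]" "U \<in> \<V>" "V \<in> \<V>"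
    by (cases us; cases "tl us") auto
  show "locally_const (orbit_space X S) (\<Inter>(set us)) (w us)"
  proof (rule locally_const_orbit_space[OF X])
    let ?A = "{x \<in> topspace X. orb S x \<in> \<Inter>(set us)}"
    have "locally_const X ?A (\<epsilon> U)" "locally_const X ?A (\<epsilon> V)"
      by (rule locally_const_mono[OF D(2)], use UV in auto)+
    then have "locally_const X ?A (\<lambda>x. \<epsilon> U x + \<epsilon> V x)" by (rule locally_const_combine)
    then show "locally_const X ?A (\<lambda>x. w us (orb S x))"
      by (rule locally_const_cong) (use D(4) UV in simp)
  qed
next
  note D = double_cover_signsD[OF w]
  fix us :: "'a set set list" and b assume us: "length us = Suc (Suc 1)" "set us \<subseteq> \<V>" "b \<in> \<Inter>(set us)"
  then obtain U V W where UVW: "us = [U, V, W]" "U \<in> \<V>" "V \<in> \<V>" "W \<in> \<V>"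
    by (cases us; cases "tl us"; cases "tl (tl us)") auto
  then obtain x where "x \<in> topspace X" "b = orb S x"
    using us by (auto intro: open_cover_orbit_pointE[OF D(1)])
  then show "coboundary w us b = 0"
    using D(4) UVW us by (simp add: coboundary_Cons ac_simps)
qed

text \<open>
  Two trivializations differ over each member of a common refinement by a function that is the same
  on both sheets. It descends to \<open>X/S\<close>, and its coboundary is the difference of the two cocycles.
\<close>

lemma double_cover_signs_unique:
  assumes X: "free_Z2_space X S"
    and w: "double_cover_signs X S \<V> \<epsilon> w" and w': "double_cover_signs X S \<V>' \<epsilon>' w'"
  shows "cech_class_of 1 (orbit_space X S) \<V> w = cech_class_of 1 (orbit_space X S) \<V>' w'"
proof -
  let ?B = "orbit_space X S"
  note D = double_cover_signsD[OF w] and D' = double_cover_signsD[OF w']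
  note coc = double_cover_signs_cocycle[OF X w] double_cover_signs_cocycle[OF X w']
  obtain \<W> r s where W: "open_cover ?B \<W>" and r: "cover_map id \<W> \<V> r" and s: "cover_map id \<W> \<V>' s"
    using common_refinement[OF D(1) D'(1)] .
  have rs: "r W \<in> \<V>" "s W \<in> \<V>'" "W \<subseteq> r W" "W \<subseteq> s W" if "W \<in> \<W>" for W
    using r s that by (auto simp: cover_map_def)
  \<comment> \<open>The two trivializations over \<open>W\<close> differ by a locally constant function on \<open>W\<close>.\<close>
  define h where "h W x = \<epsilon> (r W) x + \<epsilon>' (s W) x" for W x
  have h: "descend X S (h W) (orb S x) = h W x" if "W \<in> \<W>" "x \<in> topspace X" "orb S x \<in> W" for W x
  proof (rule descend_orb)
    have "orb S x \<in> r W" "orb S x \<in> s W"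
      by (rule subsetD[OF rs(3)[OF that(1)] that(3)], rule subsetD[OF rs(4)[OF that(1)] that(3)])
    then show "h W (S x) = h W x"
      using D(3) D'(3) rs that by (simp add: h_def ac_simps)
  qed fact
  have "cohomologous 1 ?B \<W> (pullback_cochain id r w) (pullback_cochain id s w')"
  proof (rule cohomologousI)
    show "(\<lambda>us. descend X S (h (hd us))) \<in> primitives 1 ?B \<W>"
      unfolding primitives_def mem_Collect_eq
    proof (intro allI impI conjI)
      fix us assume us: "length us = 1" "set us \<subseteq> \<W>"
      then obtain W where W: "us = [W]" "W \<in> \<W>" by (cases us) auto
      show "locally_const ?B (\<Inter>(set us)) (descend X S (h (hd us)))"
      proof (rule locally_const_orbit_space[OF X])
        let ?A = "{x \<in> topspace X. orb S x \<in> \<Inter>(set us)}"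
        have "locally_const X ?A (\<epsilon> (r W))"
          by (rule locally_const_mono[OF D(2)[OF rs(1)[OF W(2)]]]) (use W rs(3)[OF W(2)] in auto)
        moreover have "locally_const X ?A (\<epsilon>' (s W))"
          by (rule locally_const_mono[OF D'(2)[OF rs(2)[OF W(2)]]]) (use W rs(4)[OF W(2)] in auto)
        ultimately have "locally_const X ?A (h W)" unfolding h_def by (rule locally_const_combine)
        then show "locally_const X ?A (\<lambda>x. descend X S (h (hd us)) (orb S x))"
          by (rule locally_const_cong) (use W h in simp)
      qed
    qed simp
    fix us b assume us: "length us = Suc 1" "set us \<subseteq> \<W>" "b \<in> \<Inter>(set us)"
    then obtain U V where UV: "us = [U, V]" "U \<in> \<W>" "V \<in> \<W>"
      by (cases us; cases "tl us") auto
    then obtain x where x: "x \<in> topspace X" "b = orb S x"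
      using us by (auto intro: open_cover_orbit_pointE[OF W])
    have "b \<in> U" "b \<in> V" using us UV by auto
    moreover from this have "b \<in> r U" "b \<in> r V" "b \<in> s U" "b \<in> s V"
      using rs(3,4)[OF UV(2)] rs(3,4)[OF UV(3)] by blast+
    ultimately show "pullback_cochain id r w us b + pullback_cochain id s w' us b =
        coboundary (\<lambda>us. descend X S (h (hd us))) us b"
      using D(4) D'(4) UV x rs h
      by (simp add: pullback_cochain_def coboundary_Cons h_def ac_simps)
  qed
  then have "((\<V>, w), (\<V>', w')) \<in> cech_rel 1 ?B"
    unfolding cech_rel_iff using D(1) D'(1) coc W r s by blast
  then show ?thesis using D(1) D'(1) coc by (simp add: cech_class_eq_iff)
qed

abbreviation line_bundle :: "'a topology \<Rightarrow> ('a \<Rightarrow> 'a) \<Rightarrow> ('a \<times> real) set topology" where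
  "line_bundle X S \<equiv> orbit_space (prod_topology X euclideanreal) (\<lambda>(x, t). (S x, - t))"

definition line_bundle_section :: "'a topology \<Rightarrow> ('a \<Rightarrow> 'a) \<Rightarrow> 'a set set \<Rightarrow> ('a set \<Rightarrow> ('a \<times> real) set) \<Rightarrow> bool" where
  "line_bundle_section X S U s \<longleftrightarrow>
     nonvanishing_section (orbit_space X S) (line_bundle X S) (\<lambda>e. fst ` e)
       (\<lambda>r e. (\<lambda>(x, t). (x, r * t)) ` e) U s"

lemma line_bundle_section_value:
  assumes X: "free_Z2_space X S" and s: "line_bundle_section X S U s"
    and x: "x \<in> topspace X" "orb S x \<in> U"
  obtains t where "t \<noteq> 0" "s (orb S x) = {(x, t), (S x, - t)}"
proof -
  note S = free_Z2_spaceD[OF X]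
  have b: "orb S x \<in> topspace (subtopology (orbit_space X S) U)"
    using x by (simp add: topspace_orbit_space)
  have "continuous_map (subtopology (orbit_space X S) U) (line_bundle X S) s"
    using s by (simp add: line_bundle_section_def nonvanishing_section_def)
  with b have "s (orb S x) \<in> topspace (line_bundle X S)"
    by (auto simp: continuous_map_def)
  then obtain y t where y: "y \<in> topspace X" "s (orb S x) = {(y, t), (S y, - t)}"
    unfolding topspace_orbit_space by auto
  have *: "\<forall>b\<in>U. fst ` s b = b \<and> s b \<noteq> (\<lambda>(x, t). (x, 0 * t)) ` s b"
    using s unfolding line_bundle_section_def nonvanishing_section_def by (rule conjunct2)
  note fst = conjunct1[OF bspec[OF * x(2)]] and nz = conjunct2[OF bspec[OF * x(2)]]
  have "orb S y = orb S x"
    using fst unfolding y(2) by (simp only: image_insert image_empty fst_conv)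
  moreover have "t \<noteq> 0"
    using nz unfolding y(2) by auto
  moreover note orb_eqD[where S = S, OF \<open>orb S y = orb S x\<close>]
  ultimately consider "y = x" "t \<noteq> 0" | "y = S x" "t \<noteq> 0" by blast
  then show ?thesis
  proof cases
    case 1
    with y(2) show ?thesis by (intro that[of t]) simp_all
  next
    case 2
    with y(2) S(2)[OF x(1)] show ?thesis by (intro that[of "- t"]) auto
  qed
qed

definition trivializing_sections ::
    "'a topology \<Rightarrow> ('a \<Rightarrow> 'a) \<Rightarrow> 'a set set set \<Rightarrow> ('a set set \<Rightarrow> 'a set \<Rightarrow> ('a \<times> real) set) \<Rightarrow>
      'a set cochain \<Rightarrow> bool" where
  "trivializing_sections X S \<U> s c \<longleftrightarrow>
     open_cover (orbit_space X S) \<U> \<and> (\<forall>U\<in>\<U>. line_bundle_section X S U (s U)) \<and>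
     (\<forall>U\<in>\<U>. \<forall>V\<in>\<U>. \<forall>b\<in>U \<inter> V.
        \<exists>g. s V b = (\<lambda>(x, t). (x, g * t)) ` s U b \<and> c [U, V] b = of_bool (g < 0))"

text \<open>
  The sign of the fibre coordinate of a nonvanishing section, lifted to \<open>X\<close>, distinguishes the
  two sheets.
\<close>

lemma double_cover_signs_of_sections:
  assumes X: "free_Z2_space X S" and triv: "trivializing_sections X S \<U> s c"
  shows "double_cover_signs X S \<U> (\<lambda>U x. of_bool (\<exists>t<0. (x, t) \<in> s U (orb S x))) c"
proof -
  have U: "open_cover (orbit_space X S) \<U>"
    and s: "\<And>U. U \<in> \<U> \<Longrightarrow> line_bundle_section X S U (s U)"
    and c: "\<And>U V b. U \<in> \<U> \<Longrightarrow> V \<in> \<U> \<Longrightarrow> b \<in> U \<inter> V \<Longrightarrow>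
      \<exists>g. s V b = (\<lambda>(x, t). (x, g * t)) ` s U b \<and> c [U, V] b = of_bool (g < 0)"
    using triv by (simp_all add: trivializing_sections_def)
  note S = free_Z2_spaceD[OF X]
  define \<epsilon> :: "'a set set \<Rightarrow> 'a \<Rightarrow> bit" where "\<epsilon> U x = of_bool (\<exists>t<0. (x, t) \<in> s U (orb S x))" for U x
  have eps: "\<epsilon> U x = of_bool (t < 0)" "\<epsilon> U (S x) = of_bool (0 < t)"
    if "x \<in> topspace X" "s U (orb S x) = {(x, t), (S x, - t)}" for U x t
    using that S(2)[OF that(1)] S(3)[OF that(1)] S(3)[OF that(1), symmetric] orb_involution[OF X that(1)]
    by (auto simp: \<epsilon>_def)
  have lc: "locally_const X {x \<in> topspace X. orb S x \<in> U} (\<epsilon> U)" if UU: "U \<in> \<U>" for U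
    unfolding locally_const_iff
  proof
    fix x assume "x \<in> topspace X \<inter> {x \<in> topspace X. orb S x \<in> U}"
    then have x: "x \<in> topspace X" "orb S x \<in> U" by auto
    obtain t where t: "t \<noteq> 0" "s U (orb S x) = {(x, t), (S x, - t)}"
      using line_bundle_section_value[OF X s[OF UU] x] .
    obtain G where G: "openin X G" "x \<in> G" "G \<inter> S ` G = {}"
      using separating_neighbourhood[OF X x(1)] .
    \<comment> \<open>Over the sheet \<open>G\<close> the bundle is a product, and the vectors of the same sign as \<open>t\<close> form an open set.\<close>
    define N where "N = orb (\<lambda>(x, t). (S x, - t)) ` (G \<times> {r. r * t > 0})"
    have "openin (line_bundle X S) N"
      unfolding N_def
    proof (rule openin_orb_image)
      show "continuous_map (prod_topology X euclideanreal) (prod_topology X euclideanreal) (\<lambda>(x, t). (S x, - t))"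
        unfolding case_prod_unfold continuous_map_pairwise o_def fst_conv snd_conv
        by (intro conjI continuous_map_minus continuous_map_compose[OF continuous_map_fst S(1), unfolded o_def]
            continuous_map_snd)
      have "open {r. r * t > 0}" by (intro open_Collect_less continuous_intros)
      then show "openin (prod_topology X euclideanreal) (G \<times> {r. r * t > 0})"
        using G(1) by (simp add: openin_prod_Times_iff)
    qed (use S in auto)
    moreover have "continuous_map (subtopology (orbit_space X S) U) (line_bundle X S) (s U)"
      using s[OF UU] by (simp add: line_bundle_section_def nonvanishing_section_def)
    ultimately have "openin (subtopology (orbit_space X S) U)
        {b \<in> topspace (subtopology (orbit_space X S) U). s U b \<in> N}"
      by (intro openin_continuous_map_preimage)
    then obtain O' where O': "openin (orbit_space X S) O'"
      "{b \<in> topspace (subtopology (orbit_space X S) U). s U b \<in> N} = O' \<inter> U"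
      unfolding openin_subtopology by blast
    have inN: "s U b \<in> N \<longleftrightarrow> b \<in> O'" if "b \<in> topspace (orbit_space X S)" "b \<in> U" for b
      using O'(2) that by auto
    let ?N = "G \<inter> {y \<in> topspace X. orb S y \<in> O'}"
    have "openin X ?N"
      using G(1) openin_continuous_map_preimage[OF continuous_map_orb O'(1)] by blast
    moreover have "s U (orb S x) \<in> N"
      unfolding t N_def using G(2) t(1) by (intro image_eqI[of _ _ "(x, t)"]) (auto simp: zero_less_mult_iff)
    then have "x \<in> ?N" using inN x G(2) by (auto simp: topspace_orbit_space)
    moreover have "\<epsilon> U y = \<epsilon> U x" if y: "y \<in> ?N \<inter> {x \<in> topspace X. orb S x \<in> U}" for y
    proof -
      have y': "y \<in> topspace X" "orb S y \<in> U" "y \<in> G" using y by auto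
      obtain r where r: "s U (orb S y) = {(y, r), (S y, - r)}"
        using line_bundle_section_value[OF X s[OF UU] y'(1,2)] .
      have "s U (orb S y) \<in> N" using inN y by (auto simp: topspace_orbit_space)
      then obtain z q where z: "z \<in> G" "q * t > 0" "{(y, r), (S y, - r)} = {(z, q), (S z, - q)}"
        unfolding r N_def by auto
      have "y \<noteq> S z" using G(3) z(1) y'(3) by auto
      moreover have "(y, r) \<in> {(z, q), (S z, - q)}" using z(3) by (metis insertI1)
      ultimately have "r = q" by simp
      then show ?thesis using eps(1)[OF y'(1) r] eps(1)[OF x(1) t(2)] z(2) t(1)
        by (auto simp: zero_less_mult_iff)
    qed
    ultimately show "\<exists>W. openin X W \<and> x \<in> W \<and> (\<forall>y\<in>W \<inter> {x \<in> topspace X. orb S x \<in> U}. \<epsilon> U y = \<epsilon> U x)"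
      by blast
  qed
  have flip: "\<epsilon> U (S x) = \<epsilon> U x + 1" if Ux: "U \<in> \<U>" "x \<in> topspace X" "orb S x \<in> U" for U x
  proof -
    obtain t where t: "t \<noteq> 0" "s U (orb S x) = {(x, t), (S x, - t)}"
      using line_bundle_section_value[OF X s[OF Ux(1)] Ux(2,3)] .
    then show ?thesis using eps[OF Ux(2) t(2)] by (cases "t < 0") auto
  qed
  have trans: "c [U, V] (orb S x) = \<epsilon> U x + \<epsilon> V x"
    if Ux: "U \<in> \<U>" "V \<in> \<U>" "x \<in> topspace X" "orb S x \<in> U \<inter> V" for U V x
  proof -
    obtain t where t: "t \<noteq> 0" "s U (orb S x) = {(x, t), (S x, - t)}"
      using line_bundle_section_value[OF X s[OF Ux(1)] Ux(3) IntD1[OF Ux(4)]] .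
    obtain r where r: "r \<noteq> 0" "s V (orb S x) = {(x, r), (S x, - r)}"
      using line_bundle_section_value[OF X s[OF Ux(2)] Ux(3) IntD2[OF Ux(4)]] .
    obtain g where g: "s V (orb S x) = (\<lambda>(x, t). (x, g * t)) ` s U (orb S x)"
      "c [U, V] (orb S x) = of_bool (g < 0)"
      using c[OF Ux(1,2,4)] by blast
    have "(x, r) \<in> (\<lambda>(x, t). (x, g * t)) ` {(x, t), (S x, - t)}"
      using g(1) unfolding t r by (metis insertI1)
    then have "r = g * t" using S(3)[OF Ux(3)] by auto
    then have "g < 0 \<longleftrightarrow> (t < 0) \<noteq> (r < 0)" using t(1) r(1) by (auto simp: mult_less_0_iff)
    then show ?thesis
      using eps(1)[OF Ux(3) t(2)] eps(1)[OF Ux(3) r(2)] g(2) by auto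
  qed
  have "double_cover_signs X S \<U> \<epsilon> c"
    unfolding double_cover_signs_def using U lc flip trans by blast
  then show ?thesis unfolding \<epsilon>_def[abs_def] .
qed

text \<open>A sheet \<open>P\<close> over \<open>V\<close> gives the section of the points \<open>[x, 1]\<close> with \<open>x \<in> P\<close>.\<close>

lemma line_bundle_sections_exist:
  assumes X: "free_Z2_space X S"
  obtains \<U> s c where "trivializing_sections X S \<U> s c"
proof -
  note S = free_Z2_spaceD[OF X]
  let ?B = "orbit_space X S" and ?E = "line_bundle X S"
  let ?q = "orb (\<lambda>(x, t). (S x, - t)) :: 'a \<times> real \<Rightarrow> ('a \<times> real) set"
  define \<U> where "\<U> = {orb S ` P | P. openin X P \<and> P \<inter> S ` P = {}}"
  have opn: "openin ?B (orb S ` P)" if "openin X P" for P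
    using openin_orb_image[OF _ _ that] S by blast
  have cover: "open_cover ?B \<U>"
    unfolding open_cover_def
  proof (intro conjI ballI equalityI)
    show *: "openin ?B U" if "U \<in> \<U>" for U using that opn by (auto simp: \<U>_def)
    show "\<Union>\<U> \<subseteq> topspace ?B" using * openin_subset by blast
    show "topspace ?B \<subseteq> \<Union>\<U>"
    proof
      fix b assume "b \<in> topspace ?B"
      then obtain x where x: "x \<in> topspace X" "b = orb S x" by (auto simp: topspace_orbit_space)
      obtain G where "openin X G" "x \<in> G" "G \<inter> S ` G = {}"
        using separating_neighbourhood[OF X x(1)] .
      with x show "b \<in> \<Union>\<U>" by (auto simp: \<U>_def)
    qed
  qed
  have "\<forall>U\<in>\<U>. \<exists>P. openin X P \<and> P \<inter> S ` P = {} \<and> U = orb S ` P" by (auto simp: \<U>_def)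
  from bchoice[OF this] obtain P where
    *: "\<forall>U\<in>\<U>. openin X (P U) \<and> P U \<inter> S ` P U = {} \<and> U = orb S ` P U" ..
  note P = bspec[OF *, THEN conjunct1] bspec[OF *, THEN conjunct2, THEN conjunct1]
    bspec[OF *, THEN conjunct2, THEN conjunct2, THEN equalityD1]
    bspec[OF *, THEN conjunct2, THEN conjunct2, THEN equalityD2]
  have PX: "x \<in> topspace X" if "U \<in> \<U>" "x \<in> P U" for U x
    using openin_subset[OF P(1)[OF that(1)]] that(2) by blast
  define p where "p U b = (SOME x. x \<in> P U \<and> orb S x = b)" for U b
  have p: "p U b \<in> P U" "orb S (p U b) = b" if "U \<in> \<U>" "b \<in> U" for U b
  proof -
    have "\<exists>x. x \<in> P U \<and> orb S x = b" using P(3)[OF that(1)] that(2) by blast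
    from someI_ex[OF this] show "p U b \<in> P U" "orb S (p U b) = b" by (auto simp: p_def)
  qed
  have p_orb: "p U (orb S x) = x" if "U \<in> \<U>" "x \<in> P U" for U x
  proof -
    have "orb S x \<in> U" using P(4)[OF that(1)] that(2) by blast
    note p = p[OF that(1) this]
    have "p U (orb S x) \<in> P U" "p U (orb S x) = x \<or> p U (orb S x) = S x"
      by (rule p(1), rule orb_eqD[where S = S, OF p(2)])
    then show ?thesis using P(2)[OF that(1)] that(2) by auto
  qed
  define s where "s U b = ?q (p U b, 1)" for U b
  define c :: "'a set cochain" where "c us b = of_bool (p (us ! 0) b \<noteq> p (us ! 1) b)" for us b
  have "line_bundle_section X S U (s U)" if U: "U \<in> \<U>" for U
    unfolding line_bundle_section_def nonvanishing_section_def
  proof (intro conjI ballI)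
    have UB: "U \<subseteq> topspace ?B" using cover U by (rule open_coverD)
    have cont: "continuous_map X ?E (\<lambda>x. ?q (x, 1))"
      using continuous_map_compose[of X "prod_topology X euclideanreal" "\<lambda>x. (x, 1)",
          OF _ continuous_map_orb[of _ "\<lambda>(x, t). (S x, - t)"]]
      by (simp add: o_def continuous_map_pairwise)
    show "continuous_map (subtopology ?B U) ?E (s U)"
      unfolding continuous_map_def
    proof (intro conjI allI impI)
      show "s U \<in> topspace (subtopology ?B U) \<rightarrow> topspace ?E"
        using p U PX by (auto simp: s_def topspace_orbit_space)
      fix N assume N: "openin ?E N"
      have "{b \<in> topspace (subtopology ?B U). s U b \<in> N} = orb S ` (P U \<inter> {x \<in> topspace X. ?q (x, 1) \<in> N})"
      proof (intro equalityI subsetI)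
        fix b assume "b \<in> {b \<in> topspace (subtopology ?B U). s U b \<in> N}"
        then have b: "b \<in> U" "s U b \<in> N" by auto
        then show "b \<in> orb S ` (P U \<inter> {x \<in> topspace X. ?q (x, 1) \<in> N})"
          using p[OF U b(1)] PX[OF U] by (intro image_eqI[of _ _ "p U b"]) (auto simp: s_def)
      next
        fix b assume "b \<in> orb S ` (P U \<inter> {x \<in> topspace X. ?q (x, 1) \<in> N})"
        then obtain x where x: "x \<in> P U" "?q (x, 1) \<in> N" "b = orb S x" by blast
        then have "b \<in> U" using P(4)[OF U] by blast
        then show "b \<in> {b \<in> topspace (subtopology ?B U). s U b \<in> N}"
          using x p_orb[OF U x(1)] UB by (auto simp: s_def)
      qed
      moreover have "openin ?B (orb S ` (P U \<inter> {x \<in> topspace X. ?q (x, 1) \<in> N}))"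
        using P(1)[OF U] openin_continuous_map_preimage[OF cont N] by (intro opn) blast
      ultimately have "openin ?B {b \<in> topspace (subtopology ?B U). s U b \<in> N}"
        by (simp only:)
      then have "openin (subtopology ?B U) ({b \<in> topspace (subtopology ?B U). s U b \<in> N} \<inter> U)"
        by (rule openin_subtopology_Int)
      also have "{b \<in> topspace (subtopology ?B U). s U b \<in> N} \<inter> U = {b \<in> topspace (subtopology ?B U). s U b \<in> N}"
        by auto
      finally show "openin (subtopology ?B U) {b \<in> topspace (subtopology ?B U). s U b \<in> N}" .
    qed
    fix b assume b: "b \<in> U"
    show "fst ` s U b = b" using p(2)[OF U b] by (simp add: s_def)
    have "(p U b, 1) \<in> s U b" by (simp add: s_def)
    moreover have "(p U b, 1) \<notin> (\<lambda>(x, t). (x, 0 * t)) ` s U b" by auto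
    ultimately show "s U b \<noteq> (\<lambda>(x, t). (x, 0 * t)) ` s U b" by metis
  qed
  moreover have "\<exists>g. s V b = (\<lambda>(x, t). (x, g * t)) ` s U b \<and> c [U, V] b = of_bool (g < 0)"
    if U: "U \<in> \<U>" and V: "V \<in> \<U>" and b: "b \<in> U \<inter> V" for U V b
  proof (cases "p U b = p V b")
    case True
    then show ?thesis by (intro exI[of _ 1]) (auto simp: s_def c_def)
  next
    case False
    have bb: "orb S (p U b) = b" "orb S (p V b) = b" "p U b \<in> topspace X"
      using p(2)[OF U] p(2)[OF V] p(1)[OF U] PX[OF U] b by auto
    from bb have "orb S (p V b) = orb S (p U b)" by (simp only:)
    from orb_eqD[where S = S, OF this] False have "p V b = S (p U b)" by auto
    then show ?thesis
      using S(2)[OF bb(3)] False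
      by (intro exI[of _ "-1"]) (auto simp: s_def c_def)
  qed
  ultimately have "trivializing_sections X S \<U> s c"
    unfolding trivializing_sections_def using cover by (intro conjI ballI)
  then show ?thesis by (rule that)
qed

lemma double_cover_signs_exist:
  assumes "free_Z2_space X S"
  obtains \<V> \<epsilon> w where "double_cover_signs X S \<V> \<epsilon> w"
  by (rule line_bundle_sections_exist[OF assms], rule that, rule double_cover_signs_of_sections[OF assms])

text \<open>
  Every choice in the definition of the first Stiefel--Whitney class gives signs of the double cover,
  so that all of them give the same class, and the union is over one class only.
\<close>

lemma w_class_eq:
  assumes X: "free_Z2_space X S" and w: "double_cover_signs X S \<V> \<epsilon> w"
  shows "w_class X S = cech_class_of 1 (orbit_space X S) \<V> w"
proof -
  obtain \<U> s c where sec: "trivializing_sections X S \<U> s c"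
    using line_bundle_sections_exist[OF X] .
  have eq: "cech_class_of 1 (orbit_space X S) \<U> c = cech_class_of 1 (orbit_space X S) \<V> w"
    if "trivializing_sections X S \<U> s c" for \<U> s c
    by (rule double_cover_signs_unique[OF X double_cover_signs_of_sections[OF X that] w])
  have "w_class X S = \<Union>{cech_class_of 1 (orbit_space X S) \<U> c | \<U> c. \<exists>s. trivializing_sections X S \<U> s c}"
    unfolding w_class_def first_SW_class_def trivializing_sections_def line_bundle_section_def
    by (simp only: ex_simps)
  also have "{cech_class_of 1 (orbit_space X S) \<U> c | \<U> c. \<exists>s. trivializing_sections X S \<U> s c}
      = {cech_class_of 1 (orbit_space X S) \<V> w}" (is "?L = {?c}")
  proof (intro equalityI subsetI)
    fix k assume "k \<in> ?L"
    with eq show "k \<in> {?c}" by blast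
  next
    fix k assume "k \<in> {?c}"
    then have "k = cech_class_of 1 (orbit_space X S) \<U> c" using eq[OF sec] by simp
    with sec show "k \<in> ?L" by blast
  qed
  finally show ?thesis by simp
qed

section \<open>Equivariant maps\<close>

definition equivariant_map ::
    "'a topology \<Rightarrow> ('a \<Rightarrow> 'a) \<Rightarrow> 'b topology \<Rightarrow> ('b \<Rightarrow> 'b) \<Rightarrow> ('a \<Rightarrow> 'b) \<Rightarrow> bool" where
  "equivariant_map X S Y T f \<longleftrightarrow> continuous_map X Y f \<and> (\<forall>x\<in>topspace X. f (S x) = T (f x))"

lemma equivariant_map_id: "equivariant_map X S X S id"
  by (simp add: equivariant_map_def)

lemma equivariant_orb: "equivariant_map X S Y T f \<Longrightarrow> x \<in> topspace X \<Longrightarrow> f ` orb S x = orb T (f x)"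
  by (simp add: equivariant_map_def)

lemma continuous_map_orbit_spaces:
  assumes "equivariant_map X S Y T f"
  shows "continuous_map (orbit_space X S) (orbit_space Y T) ((`) f)"
proof (rule continuous_compose_quotient_map[OF quotient_map_orbit_space])
  have "continuous_map X (orbit_space Y T) (orb T \<circ> f)"
    using assms continuous_map_compose[OF _ continuous_map_orb] by (auto simp: equivariant_map_def)
  then show "continuous_map X (orbit_space Y T) ((`) f \<circ> orb S)"
    by (rule continuous_map_eq) (use equivariant_orb[OF assms] in simp)
qed

lemma double_cover_signs_pullback:
  assumes f: "equivariant_map X S Y T f" and w: "double_cover_signs Y T \<V> \<epsilon> w"
    and U: "open_cover (orbit_space X S) \<U>" and \<phi>: "cover_map ((`) f) \<U> \<V> \<phi>"
  shows "double_cover_signs X S \<U> (\<lambda>U x. \<epsilon> (\<phi> U) (f x)) (pullback_cochain ((`) f) \<phi> w)"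
proof -
  note D = double_cover_signsD[OF w]
  have cont: "continuous_map X Y f" and fX: "\<And>x. x \<in> topspace X \<Longrightarrow> f x \<in> topspace Y"
    and fS: "\<And>x. x \<in> topspace X \<Longrightarrow> f (S x) = T (f x)"
    using f by (auto simp: equivariant_map_def continuous_map_def)
  have \<phi>V: "\<phi> U \<in> \<V>" if "U \<in> \<U>" for U using \<phi> that by (auto simp: cover_map_def)
  have \<phi>o: "orb T (f x) \<in> \<phi> U" if "U \<in> \<U>" "x \<in> topspace X" "orb S x \<in> U" for U x
  proof -
    have "f ` orb S x \<in> \<phi> U" using \<phi> that(1,3) unfolding cover_map_def by blast
    then show ?thesis by (simp only: equivariant_orb[OF f that(2)])
  qed
  show ?thesis
    unfolding double_cover_signs_def
  proof (intro conjI ballI impI U)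
    fix U assume U: "U \<in> \<U>"
    show "locally_const X {x \<in> topspace X. orb S x \<in> U} (\<lambda>x. \<epsilon> (\<phi> U) (f x))"
      using cont D(2)[OF \<phi>V[OF U]] by (rule locally_const_compose) (use \<phi>o[OF U] fX in simp)
    fix x assume x: "x \<in> topspace X" "orb S x \<in> U"
    show "\<epsilon> (\<phi> U) (f (S x)) = \<epsilon> (\<phi> U) (f x) + 1"
      unfolding fS[OF x(1)] by (rule D(3)[OF \<phi>V[OF U] fX[OF x(1)] \<phi>o[OF U x]])
  next
    fix U V x assume UV: "U \<in> \<U>" "V \<in> \<U>" and x: "x \<in> topspace X" "orb S x \<in> U \<inter> V"
    have "pullback_cochain ((`) f) \<phi> w [U, V] (orb S x) = w [\<phi> U, \<phi> V] (orb T (f x))"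
      by (simp only: pullback_cochain_def list.map equivariant_orb[OF f x(1)])
    also have "\<dots> = \<epsilon> (\<phi> U) (f x) + \<epsilon> (\<phi> V) (f x)"
      using x by (intro D(4) \<phi>V UV fX \<phi>o) auto
    finally show "pullback_cochain ((`) f) \<phi> w [U, V] (orb S x) = \<epsilon> (\<phi> U) (f x) + \<epsilon> (\<phi> V) (f x)" .
  qed
qed

lemma double_cover_signs_refine:
  assumes "double_cover_signs X S \<V> \<epsilon> w" "open_cover (orbit_space X S) \<W>" "cover_map id \<W> \<V> r"
  shows "double_cover_signs X S \<W> (\<lambda>W. \<epsilon> (r W)) (pullback_cochain id r w)"
  using double_cover_signs_pullback[OF equivariant_map_id assms(1,2), of r] assms(3) by simp

primrec sw_power :: "'a cochain \<Rightarrow> nat \<Rightarrow> 'a cochain" where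
  "sw_power w 0 = (\<lambda>us x. 1)"
| "sw_power w (Suc n) = cup_cochain n (sw_power w n) w"

lemma pullback_sw_power:
  "pullback_cochain f \<phi> (sw_power w n) = sw_power (pullback_cochain f \<phi> w) n"
  by (induction n) (simp_all add: pullback_cup pullback_const)

lemma one_cocycle: "(\<lambda>us x. 1) \<in> cocycles 0 X \<U>"
  unfolding cocycles_iff cochains_iff cochain_agree_iff
proof (intro conjI allI impI ballI)
  fix us :: "'a set list" and x assume "length us = Suc (Suc 0)"
  then obtain u v where "us = [u, v]" by (cases us; cases "tl us") auto
  then show "coboundary (\<lambda>us x. 1) us x = 0" by (simp add: coboundary_Cons)
qed simp

lemma sw_power_cocycle:
  assumes "w \<in> cocycles 1 X \<U>"
  shows "sw_power w n \<in> cocycles n X \<U>"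
  by (induction n) (use one_cocycle cup_cocycles[OF _ assms] in auto)

lemma w_power_nonzero_iff:
  assumes X: "free_Z2_space X S" and w: "double_cover_signs X S \<V> \<epsilon> w"
  shows "w_power_nonzero X S n \<longleftrightarrow> \<not> cech_vanishes n (orbit_space X S) \<V> (sw_power w n)"
proof -
  let ?B = "orbit_space X S"
  have V: "open_cover ?B \<V>" using w by (rule double_cover_signsD)
  note coc = double_cover_signs_cocycle[OF X w]
  have "cech_power ?B (w_class X S) n = cech_class_of n ?B \<V> (sw_power w n)"
  proof (induction n)
    case 0
    show ?case
      using cech_class_refine[OF open_cover_topspace one_cocycle V cover_map_topspace[OF V]]
      by (simp add: cech_unit_def pullback_const)
  next
    case (Suc n)
    then show ?case
      using cech_cup_class[OF V sw_power_cocycle[OF coc] coc] by (simp add: w_class_eq[OF X w])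
  qed
  then show ?thesis
    by (simp add: w_power_nonzero_def cech_class_zero_iff[OF V sw_power_cocycle[OF coc]])
qed

section \<open>Lifting cochains to the double cover, and transfer\<close>

abbreviation lifted_cover :: "'a topology \<Rightarrow> ('a \<Rightarrow> 'a) \<Rightarrow> 'a set set set \<Rightarrow> 'a set set" where
  "lifted_cover X S \<V> \<equiv> preimage_cover X (orb S) \<V>"

lemma open_cover_lifted: "open_cover (orbit_space X S) \<V> \<Longrightarrow> open_cover X (lifted_cover X S \<V>)"
  by (rule open_cover_preimage[OF continuous_map_orb])

lemma orb_image_lifted:
  assumes "open_cover (orbit_space X S) \<V>" "V \<in> \<V>"
  shows "orb S ` {x \<in> topspace X. orb S x \<in> V} = V"
  using open_coverD[OF assms] unfolding topspace_orbit_space by blast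

lemma lifted_coverD:
  assumes V: "open_cover (orbit_space X S) \<V>" and A: "A \<in> lifted_cover X S \<V>"
  shows "orb S ` A \<in> \<V>" "A = {x \<in> topspace X. orb S x \<in> orb S ` A}"
proof -
  from A obtain V where "V \<in> \<V>" "A = {x \<in> topspace X. orb S x \<in> V}"
    by (auto simp: preimage_cover_def)
  with orb_image_lifted[OF V this(1)]
  show "orb S ` A \<in> \<V>" "A = {x \<in> topspace X. orb S x \<in> orb S ` A}" by simp_all
qed

lemma cover_map_orb:
  "open_cover (orbit_space X S) \<V> \<Longrightarrow> cover_map (orb S) (lifted_cover X S \<V>) \<V> ((`) (orb S))"
  by (simp add: cover_map_def lifted_coverD)

definition sheet_coordinate :: "('a \<Rightarrow> 'a) \<Rightarrow> ('a set set \<Rightarrow> 'a \<Rightarrow> bit) \<Rightarrow> 'a cochain" where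
  "sheet_coordinate S \<epsilon> = (\<lambda>us x. \<epsilon> (orb S ` hd us) x)"

abbreviation lift_pullback :: "('a \<Rightarrow> 'a) \<Rightarrow> 'a set cochain \<Rightarrow> 'a cochain" where
  "lift_pullback S \<equiv> pullback_cochain (orb S) ((`) (orb S))"

text \<open>
  Since the coboundary of the sheet coordinate is the pullback of \<open>w\<close>, a cocycle \<open>z\<close> of \<open>X/S\<close> with
  \<open>z \<union> w = \<delta>g\<close> lifts to the cocycle \<open>z \<union> \<epsilon> + g\<close> of \<open>X\<close>. Its image under the transfer is \<open>z\<close>.
\<close>

definition lift_cochain ::
    "('a \<Rightarrow> 'a) \<Rightarrow> ('a set set \<Rightarrow> 'a \<Rightarrow> bit) \<Rightarrow> nat \<Rightarrow> 'a set cochain \<Rightarrow> 'a set cochain \<Rightarrow> 'a cochain" where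
  "lift_cochain S \<epsilon> n z g = (\<lambda>us x.
     cup_cochain n (lift_pullback S z) (sheet_coordinate S \<epsilon>) us x + lift_pullback S g us x)"

lemma lift_cochain_apply:
  assumes "length us = Suc n"
  shows "lift_cochain S \<epsilon> n z g us x =
    z (map ((`) (orb S)) us) (orb S x) * \<epsilon> (orb S ` last us) x + g (map ((`) (orb S)) us) (orb S x)"
proof -
  have "hd (drop n us) = last us"
    using assms by (simp add: hd_drop_conv_nth last_conv_nth[of us] flip: length_greater_0_conv)
  then show ?thesis
    using assms by (simp add: lift_cochain_def cup_cochain_def sheet_coordinate_def pullback_cochain_def)
qed

lemma lift_cochain_add:
  "lift_cochain S \<epsilon> n (\<lambda>us b. z us b + z' us b) (\<lambda>us b. g us b + g' us b) =
     (\<lambda>us x. lift_cochain S \<epsilon> n z g us x + lift_cochain S \<epsilon> n z' g' us x)"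
  by (simp add: lift_cochain_def pullback_add cup_add_left ac_simps)

lemma sheet_coordinate_cochain:
  assumes w: "double_cover_signs X S \<V> \<epsilon> w"
  shows "sheet_coordinate S \<epsilon> \<in> cochains 0 X (lifted_cover X S \<V>)"
  unfolding cochains_iff
proof (intro allI impI)
  note D = double_cover_signsD[OF w]
  fix us assume us: "length us = Suc 0" "set us \<subseteq> lifted_cover X S \<V>"
  then obtain A where A: "us = [A]" "A \<in> lifted_cover X S \<V>" by (cases us) auto
  show "locally_const X (\<Inter>(set us)) (sheet_coordinate S \<epsilon> us)"
    unfolding sheet_coordinate_def
    by (rule locally_const_mono[OF D(2)[OF lifted_coverD(1)[OF D(1)]]]) (use A in auto)
qed

lemma coboundary_sheet_coordinate:
  assumes w: "double_cover_signs X S \<V> \<epsilon> w"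
  shows "cochain_agree 1 (lifted_cover X S \<V>) (coboundary (sheet_coordinate S \<epsilon>)) (lift_pullback S w)"
  unfolding cochain_agree_iff
proof (intro allI impI ballI)
  note D = double_cover_signsD[OF w]
  fix us x assume us: "length us = Suc 1" "set us \<subseteq> lifted_cover X S \<V>" "x \<in> \<Inter>(set us)"
  then obtain A C where AC: "us = [A, C]" "A \<in> lifted_cover X S \<V>" "C \<in> lifted_cover X S \<V>"
    by (cases us; cases "tl us") auto
  have "x \<in> A" "x \<in> C" using us AC by auto
  then have "x \<in> topspace X" using open_coverD[OF open_cover_lifted[OF D(1)] AC(2)] by blast
  then have "w [orb S ` A, orb S ` C] (orb S x) = \<epsilon> (orb S ` A) x + \<epsilon> (orb S ` C) x"
    using lifted_coverD(1)[OF D(1)] AC \<open>x \<in> A\<close> \<open>x \<in> C\<close> by (intro D(4)) auto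
  then show "coboundary (sheet_coordinate S \<epsilon>) us x = lift_pullback S w us x"
    by (simp add: AC(1) sheet_coordinate_def coboundary_Cons pullback_cochain_def add.commute)
qed

lemma lift_pullback_cochains:
  "open_cover (orbit_space X S) \<V> \<Longrightarrow> z \<in> cochains n (orbit_space X S) \<V> \<Longrightarrow>
     lift_pullback S z \<in> cochains n X (lifted_cover X S \<V>)"
  by (rule cochains_pullback[OF continuous_map_orb cover_map_orb])

lemma coboundary_cup_sheet_coordinate:
  assumes w: "double_cover_signs X S \<V> \<epsilon> w"
  shows "cochain_agree (Suc n) (lifted_cover X S \<V>)
    (coboundary (cup_cochain n (lift_pullback S z) (sheet_coordinate S \<epsilon>)))
    (\<lambda>us x. cup_cochain (Suc n) (lift_pullback S (coboundary z)) (sheet_coordinate S \<epsilon>) us x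
      + lift_pullback S (cup_cochain n z w) us x)"
proof -
  have "cochain_agree (n + 1) (lifted_cover X S \<V>)
      (cup_cochain n (lift_pullback S z) (coboundary (sheet_coordinate S \<epsilon>)))
      (cup_cochain n (lift_pullback S z) (lift_pullback S w))"
    by (rule cochain_agree_cup[OF _ coboundary_sheet_coordinate[OF w]]) (simp add: cochain_agree_iff)
  with coboundary_cup_agree[of n 0 "lifted_cover X S \<V>" "lift_pullback S z" "sheet_coordinate S \<epsilon>"]
  show ?thesis
    by (simp add: cochain_agree_iff pullback_cup coboundary_pullback)
qed

lemma lift_cochain_cocycle:
  assumes w: "double_cover_signs X S \<V> \<epsilon> w"
    and z: "z \<in> cocycles n (orbit_space X S) \<V>" and g: "g \<in> cochains n (orbit_space X S) \<V>"
    and zw: "cochain_agree (Suc n) \<V> (cup_cochain n z w) (coboundary g)"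
  shows "lift_cochain S \<epsilon> n z g \<in> cocycles n X (lifted_cover X S \<V>)"
proof -
  let ?L = "lifted_cover X S \<V>"
  have V: "open_cover (orbit_space X S) \<V>" using w by (rule double_cover_signsD)
  have "cup_cochain n (lift_pullback S z) (sheet_coordinate S \<epsilon>) \<in> cochains (n + 0) X ?L"
    using z by (intro cup_cochains lift_pullback_cochains V sheet_coordinate_cochain[OF w])
      (simp add: cocycles_iff)
  then have "lift_cochain S \<epsilon> n z g \<in> cochains n X ?L"
    unfolding lift_cochain_def using lift_pullback_cochains[OF V g] by (intro cochains_add) simp_all
  moreover have "cochain_agree (Suc n) ?L (coboundary (lift_cochain S \<epsilon> n z g)) (\<lambda>us x. 0)"
  proof -
    have "cochain_agree (Suc n) ?L (lift_pullback S (coboundary z)) (\<lambda>us x. 0)"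
      using cochain_agree_pullback[OF cover_map_orb[OF V]] z
      by (fastforce simp: cocycles_iff pullback_const)
    from cochain_agree_cup[OF this, of 0 "sheet_coordinate S \<epsilon>" "sheet_coordinate S \<epsilon>"]
    have 1: "cochain_agree (Suc n) ?L
        (cup_cochain (Suc n) (lift_pullback S (coboundary z)) (sheet_coordinate S \<epsilon>)) (\<lambda>us x. 0)"
      by (simp add: cup_zero) (simp add: cochain_agree_iff)
    have 2: "cochain_agree (Suc n) ?L (lift_pullback S (cup_cochain n z w)) (lift_pullback S (coboundary g))"
      by (rule cochain_agree_pullback[OF cover_map_orb[OF V] zw])
    show ?thesis
      using 1 2 coboundary_cup_sheet_coordinate[OF w, of n z]
      unfolding lift_cochain_def by (simp add: cochain_agree_iff coboundary_add coboundary_pullback)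
  qed
  ultimately show ?thesis by (simp add: cocycles_iff)
qed

text \<open>
  The map of lifted covers over \<open>f\<close> is the one induced by \<open>\<phi>\<close> on orbit spaces. For \<open>f = id\<close> this is
  compatibility of the lift with refinement.
\<close>

lemma lift_cochain_natural:
  assumes f: "equivariant_map X S Y T f"
    and U: "open_cover (orbit_space X S) \<U>" and V: "open_cover (orbit_space Y T) \<V>"
    and \<phi>: "cover_map ((`) f) \<U> \<V> \<phi>"
  shows "\<exists>\<psi>. cover_map f (lifted_cover X S \<U>) (lifted_cover Y T \<V>) \<psi> \<and>
    (\<forall>\<epsilon> n z g. cochain_agree n (lifted_cover X S \<U>)
      (pullback_cochain f \<psi> (lift_cochain T \<epsilon> n z g))
      (lift_cochain S (\<lambda>U x. \<epsilon> (\<phi> U) (f x)) n (pullback_cochain ((`) f) \<phi> z) (pullback_cochain ((`) f) \<phi> g)))"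
proof -
  define \<psi> where "\<psi> A = {y \<in> topspace Y. orb T y \<in> \<phi> (orb S ` A)}" for A
  have fX: "\<And>x. x \<in> topspace X \<Longrightarrow> f x \<in> topspace Y"
    using f by (auto simp: equivariant_map_def continuous_map_def)
  have \<phi>V: "\<phi> (orb S ` A) \<in> \<V>" if "A \<in> lifted_cover X S \<U>" for A
    using \<phi> lifted_coverD(1)[OF U that] by (auto simp: cover_map_def)
  have cov: "cover_map f (lifted_cover X S \<U>) (lifted_cover Y T \<V>) \<psi>"
    unfolding cover_map_def
  proof (intro ballI conjI subsetI)
    fix A assume A: "A \<in> lifted_cover X S \<U>"
    show "\<psi> A \<in> lifted_cover Y T \<V>" using \<phi>V[OF A] by (auto simp: \<psi>_def preimage_cover_def)
    fix y assume "y \<in> f ` A"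
    then obtain x where x: "x \<in> A" "y = f x" by blast
    then have "x \<in> topspace X" using open_coverD[OF open_cover_lifted[OF U] A] by blast
    have "(`) f ` (orb S ` A) \<subseteq> \<phi> (orb S ` A)"
      using \<phi> lifted_coverD(1)[OF U A] by (simp add: cover_map_def)
    then have "f ` orb S x \<in> \<phi> (orb S ` A)" by (rule subsetD[OF _ imageI[OF imageI[OF x(1)]]])
    then have "orb T (f x) \<in> \<phi> (orb S ` A)"
      by (simp only: equivariant_orb[OF f \<open>x \<in> topspace X\<close>])
    then show "y \<in> \<psi> A"
      unfolding \<psi>_def x(2) mem_Collect_eq by (intro conjI fX \<open>x \<in> topspace X\<close>)
  qed
  have im: "orb T ` \<psi> A = \<phi> (orb S ` A)" if "A \<in> lifted_cover X S \<U>" for A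
    unfolding \<psi>_def by (rule orb_image_lifted[OF V \<phi>V[OF that]])
  have "cochain_agree n (lifted_cover X S \<U>)
      (pullback_cochain f \<psi> (lift_cochain T \<epsilon> n z g))
      (lift_cochain S (\<lambda>U x. \<epsilon> (\<phi> U) (f x)) n (pullback_cochain ((`) f) \<phi> z) (pullback_cochain ((`) f) \<phi> g))"
    for \<epsilon> n z g
    unfolding cochain_agree_iff
  proof (intro allI impI ballI)
    fix us x assume us: "length us = Suc n" "set us \<subseteq> lifted_cover X S \<U>" "x \<in> \<Inter>(set us)"
    then have "us \<noteq> []" by auto
    then have l: "last us \<in> set us" by simp
    have x: "x \<in> topspace X"
      using open_coverD[OF open_cover_lifted[OF U], of "last us"] us l by blast
    have m: "map ((`) (orb T)) (map \<psi> us) = map \<phi> (map ((`) (orb S)) us)"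
      unfolding map_map o_def by (rule map_cong[OF refl]) (use im us(2) in blast)
    have l': "orb T ` last (map \<psi> us) = \<phi> (orb S ` last us)"
    proof -
      have "last (map \<psi> us) = \<psi> (last us)" using \<open>us \<noteq> []\<close> by (simp add: last_map)
      then show ?thesis using im[of "last us"] us(2) l by (auto simp only:)
    qed
    show "pullback_cochain f \<psi> (lift_cochain T \<epsilon> n z g) us x =
      lift_cochain S (\<lambda>U x. \<epsilon> (\<phi> U) (f x)) n (pullback_cochain ((`) f) \<phi> z) (pullback_cochain ((`) f) \<phi> g) us x"
      unfolding pullback_cochain_def lift_cochain_apply[OF us(1)]
        lift_cochain_apply[of "map \<psi> us", unfolded length_map, OF us(1)] m l' equivariant_orb[OF f x] ..
  qed
  with cov show ?thesis by blast
qed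

lemma lift_cochain_refine:
  assumes "open_cover (orbit_space X S) \<V>" "open_cover (orbit_space X S) \<W>" "cover_map id \<W> \<V> r"
    and "cech_vanishes n X (lifted_cover X S \<W>)
      (lift_cochain S (\<lambda>W. \<epsilon> (r W)) n (pullback_cochain id r z) (pullback_cochain id r g))"
  shows "cech_vanishes n X (lifted_cover X S \<V>) (lift_cochain S \<epsilon> n z g)"
proof -
  have "cover_map ((`) id) \<W> \<V> r" using assms(3) by simp
  obtain \<psi> where \<psi>: "cover_map id (lifted_cover X S \<W>) (lifted_cover X S \<V>) \<psi>"
    "\<forall>\<epsilon> n z g. cochain_agree n (lifted_cover X S \<W>) (pullback_cochain id \<psi> (lift_cochain S \<epsilon> n z g))
      (lift_cochain S (\<lambda>U x. \<epsilon> (r U) (id x)) n (pullback_cochain ((`) id) r z) (pullback_cochain ((`) id) r g))"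
    using lift_cochain_natural[OF equivariant_map_id assms(2,1) \<open>cover_map ((`) id) \<W> \<V> r\<close>] by blast
  have "cech_vanishes n X (lifted_cover X S \<W>) (pullback_cochain id \<psi> (lift_cochain S \<epsilon> n z g))"
    using \<psi>(2)[rule_format, of n \<epsilon> z g] by (rule cech_vanishes_agree) (use assms(4) in simp)
  with \<psi>(1) show ?thesis by (rule cech_vanishes_refine)
qed

text \<open>
  A cover of \<open>X\<close> is refined by the sheets over a cover of \<open>X/S\<close> by evenly covered sets.
  The values of a cochain at the two tuples of sheets over a tuple of evenly covered sets add up to a
  cochain of \<open>X/S\<close>; this operation, the transfer, commutes with coboundaries and takes \<open>z \<union> \<epsilon> + g\<close> to \<open>z\<close>, because
  the two values of \<open>\<epsilon>\<close> add up to \<open>1\<close> and those of \<open>g\<close> cancel.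
\<close>

lemma transfer:
  assumes X: "free_Z2_space X S" and w: "double_cover_signs X S \<V> \<epsilon> w"
    and coc: "lift_cochain S \<epsilon> n z g \<in> cocycles n X (lifted_cover X S \<V>)"
    and van: "cech_vanishes n X (lifted_cover X S \<V>) (lift_cochain S \<epsilon> n z g)"
  shows "cech_vanishes n (orbit_space X S) \<V> z"
proof -
  let ?B = "orbit_space X S" and ?Z = "lift_cochain S \<epsilon> n z g"
  note S = free_Z2_spaceD[OF X] and D = double_cover_signsD[OF w]
  from van obtain \<W> r where W: "open_cover X \<W>" and r: "cover_map id \<W> (lifted_cover X S \<V>) r"
    and coh: "cohomologous n X \<W> (pullback_cochain id r ?Z) (\<lambda>us x. 0)"
    by (auto simp: cech_vanishes_def)
  \<comment> \<open>The evenly covered open sets whose two sheets are subordinate to \<open>\<W>\<close>.\<close>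
  define good where "good Q P V \<longleftrightarrow> openin X P \<and> P \<inter> S ` P = {} \<and> orb S ` P = Q \<and> V \<in> \<V> \<and> Q \<subseteq> V \<and>
      (\<exists>W\<in>\<W>. P \<subseteq> W) \<and> (\<exists>W\<in>\<W>. S ` P \<subseteq> W)" for Q P V
  define \<Q> where "\<Q> = {Q. \<exists>P V. good Q P V}"
  have "\<forall>Q\<in>\<Q>. \<exists>PV. good Q (fst PV) (snd PV)" by (auto simp: \<Q>_def)
  from bchoice[OF this] obtain PV where PV: "\<forall>Q\<in>\<Q>. good Q (fst (PV Q)) (snd (PV Q))" ..
  define P where "P Q = fst (PV Q)" for Q
  define V where "V Q = snd (PV Q)" for Q
  have G: "good Q (P Q) (V Q)" if "Q \<in> \<Q>" for Q using PV that by (simp add: P_def V_def)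
  have P: "openin X (P Q)" "P Q \<inter> S ` P Q = {}" "orb S ` P Q = Q" "V Q \<in> \<V>" "Q \<subseteq> V Q"
    "\<exists>W\<in>\<W>. P Q \<subseteq> W" "\<exists>W\<in>\<W>. S ` P Q \<subseteq> W" if "Q \<in> \<Q>" for Q
    using G[OF that] unfolding good_def by - (elim conjE, assumption)+
  have PX: "P Q \<subseteq> topspace X" if "Q \<in> \<Q>" for Q using P(1)[OF that] by (rule openin_subset)
  have SP: "S ` P Q = {x \<in> topspace X. S x \<in> P Q}" if "Q \<in> \<Q>" for Q
  proof (intro equalityI subsetI)
    fix x assume "x \<in> {x \<in> topspace X. S x \<in> P Q}"
    then show "x \<in> S ` P Q" using S(2)[of x] by (intro image_eqI[of _ _ "S x"]) auto
  qed (use PX[OF that] S(2,4) in auto)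
  have openSP: "openin X (S ` P Q)" if "Q \<in> \<Q>" for Q
    unfolding SP[OF that] using S(1) P(1)[OF that] by (rule openin_continuous_map_preimage)
  have cases: "x \<in> P Q \<or> x \<in> S ` P Q" if "Q \<in> \<Q>" "x \<in> topspace X" "orb S x \<in> Q" for Q x
  proof -
    have "orb S x \<in> orb S ` P Q" using that(3) P(3)[OF that(1)] by simp
    then obtain y where "y \<in> P Q" "orb S x = orb S y" by blast
    with orb_eqD[where S = S, OF this(2)] show ?thesis by blast
  qed
  have orbSP: "orb S ` S ` P Q = Q" if "Q \<in> \<Q>" for Q
  proof -
    have "orb S ` S ` P Q = orb S ` P Q"
      unfolding image_image by (rule image_cong[OF refl]) (use PX[OF that] orb_involution[OF X] in blast)
    then show ?thesis using P(3)[OF that] by simp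
  qed
  have openQ: "openin ?B Q" if "Q \<in> \<Q>" for Q
    using openin_orb_image[OF _ _ P(1)[OF that]] S P(3)[OF that] by metis
  have coverQ: "open_cover ?B \<Q>"
    unfolding open_cover_def
  proof (intro conjI ballI equalityI openQ)
    show "\<Union>\<Q> \<subseteq> topspace ?B" using openQ openin_subset by blast
    show "topspace ?B \<subseteq> \<Union>\<Q>"
    proof
      fix b assume b: "b \<in> topspace ?B"
      then obtain x where x: "x \<in> topspace X" "b = orb S x" by (auto simp: topspace_orbit_space)
      obtain V where V: "V \<in> \<V>" "b \<in> V" using D(1) b unfolding open_cover_def by blast
      obtain W1 W2 where W12: "W1 \<in> \<W>" "x \<in> W1" "W2 \<in> \<W>" "S x \<in> W2"
        using W x(1) S(4)[OF x(1)] unfolding open_cover_def by blast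
      obtain G where G: "openin X G" "x \<in> G" "G \<inter> S ` G = {}"
        using separating_neighbourhood[OF X x(1)] .
      define N where "N = G \<inter> W1 \<inter> {y \<in> topspace X. S y \<in> W2} \<inter> {y \<in> topspace X. orb S y \<in> V}"
      have "openin X W1" "openin X W2" "openin ?B V"
        using W W12 D(1) V by (auto simp: open_cover_def)
      then have "openin X N"
        unfolding N_def using G(1)
        by (intro openin_Int openin_continuous_map_preimage[OF S(1)]
            openin_continuous_map_preimage[OF continuous_map_orb])
      moreover have "N \<inter> S ` N = {}" using G(3) by (auto simp: N_def)
      moreover have "orb S ` N \<subseteq> V" "N \<subseteq> W1" "S ` N \<subseteq> W2" by (auto simp: N_def)
      ultimately have "good (orb S ` N) N V" unfolding good_def using V(1) W12 by blast
      then have "orb S ` N \<in> \<Q>" unfolding \<Q>_def by blast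
      moreover have "x \<in> N" using x V(2) W12 G(2) by (simp add: N_def)
      ultimately show "b \<in> \<Union>\<Q>" using x(2) by blast
    qed
  qed
  define \<A> where "\<A> = P ` \<Q> \<union> (\<lambda>Q. S ` P Q) ` \<Q>"
  have orbA: "orb S ` A \<in> \<Q>" "A \<subseteq> topspace X" "\<exists>W. W \<in> \<W> \<and> id ` A \<subseteq> W" if A: "A \<in> \<A>" for A
  proof -
    obtain Q where Q: "Q \<in> \<Q>" "A = P Q \<or> A = S ` P Q" using A unfolding \<A>_def by blast
    have "orb S ` A = Q" using Q(2) P(3)[OF Q(1)] orbSP[OF Q(1)] by (elim disjE) (simp_all only:)
    with Q(1) show "orb S ` A \<in> \<Q>" by simp
    show "A \<subseteq> topspace X" using Q(2) PX[OF Q(1)] SP[OF Q(1)] by blast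
    show "\<exists>W. W \<in> \<W> \<and> id ` A \<subseteq> W" using Q(2) P(6,7)[OF Q(1)] by auto
  qed
  from orbA(3) obtain t where t: "cover_map id \<A> \<W> t"
    unfolding cover_map_def by (metis bchoice)
  have openA: "openin X A" if "A \<in> \<A>" for A using that P(1) openSP unfolding \<A>_def by blast
  \<comment> \<open>Up to homotopy the map from the sheets to the lifted cover may be taken to factor through \<open>\<Q>\<close>.\<close>
  define \<rho> where "\<rho> A = {x \<in> topspace X. orb S x \<in> V (orb S ` A)}" for A
  have \<rho>: "cover_map id \<A> (lifted_cover X S \<V>) \<rho>"
    unfolding cover_map_def
  proof (intro ballI conjI subsetI)
    fix A assume A: "A \<in> \<A>"
    show "\<rho> A \<in> lifted_cover X S \<V>"
      using P(4)[OF orbA(1)[OF A]] by (auto simp: \<rho>_def preimage_cover_def)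
    show "x \<in> \<rho> A" if "x \<in> id ` A" for x
      using that orbA(2)[OF A] P(5)[OF orbA(1)[OF A]] by (auto simp: \<rho>_def)
  qed
  have "cohomologous n X \<A> (pullback_cochain id \<rho> ?Z) (pullback_cochain id (r \<circ> t) ?Z)"
    using cover_map_comp[OF t r] \<rho> by (intro cohomologous_cover_maps[OF _ _ _ coc]) simp_all
  moreover have "cohomologous n X \<A> (pullback_cochain id (r \<circ> t) ?Z) (\<lambda>us x. 0)"
    using cohomologous_pullback[OF _ t coh] by (simp add: pullback_pullback pullback_const)
  ultimately have "cohomologous n X \<A> (pullback_cochain id \<rho> ?Z) (\<lambda>us x. 0)"
    by (rule cohomologous_trans)
  then obtain h where h: "h \<in> primitives n X \<A>"
    "\<And>us x. length us = Suc n \<Longrightarrow> set us \<subseteq> \<A> \<Longrightarrow> x \<in> \<Inter>(set us) \<Longrightarrow>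
      pullback_cochain id \<rho> ?Z us x = coboundary h us x"
    by (auto elim!: cohomologousE)
  define sheet where "sheet x Q = (if x \<in> P Q then P Q else S ` P Q)" for x Q
  have sheetA: "sheet x Q \<in> \<A>" if "Q \<in> \<Q>" for x Q using that by (auto simp: sheet_def \<A>_def)
  have mem_sheet: "x \<in> sheet x Q" if "Q \<in> \<Q>" "x \<in> topspace X" "orb S x \<in> Q" for x Q
    using cases[OF that] by (auto simp: sheet_def)
  have orb_sheet: "orb S ` sheet x Q = Q" if "Q \<in> \<Q>" for x Q
    using P(3)[OF that] orbSP[OF that] by (simp add: sheet_def)
  have sheet_eq: "sheet y Q = sheet x Q" if "Q \<in> \<Q>" "y \<in> sheet x Q" for x y Q
    using that P(2)[OF that(1)] by (auto simp: sheet_def split: if_splits)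
  define up where "up us x = h (map (sheet x) us) x" for us x
  define down where "down us = descend X S (\<lambda>x. up us x + up us (S x))" for us
  have down: "down us (orb S x) = up us x + up us (S x)" if "x \<in> topspace X" for us x
    unfolding down_def by (rule descend_orb) (simp_all add: that S(2) add.commute)
  have up_lc: "locally_const X {x \<in> topspace X. orb S x \<in> \<Inter>(set us)} (up us)"
    if us: "length us = n" "set us \<subseteq> \<Q>" for us
    unfolding locally_const_iff
  proof
    let ?A = "{x \<in> topspace X. orb S x \<in> \<Inter>(set us)}"
    fix x assume "x \<in> topspace X \<inter> ?A"
    then have x: "x \<in> topspace X" "\<And>Q. Q \<in> set us \<Longrightarrow> orb S x \<in> Q" by auto
    let ?I = "\<Inter>(set (map (sheet x) us))"
    have "locally_const X ?I (h (map (sheet x) us))"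
    proof -
      have "length (map (sheet x) us) = n" "set (map (sheet x) us) \<subseteq> \<A>"
        using us sheetA by auto
      then show ?thesis using h(1) unfolding primitives_def by blast
    qed
    moreover have "x \<in> topspace X \<inter> ?I" using x mem_sheet us(2) by auto
    ultimately obtain U where U: "openin X U" "x \<in> U"
      "\<forall>y\<in>U \<inter> ?I. h (map (sheet x) us) y = h (map (sheet x) us) x"
      unfolding locally_const_iff by blast
    let ?N = "U \<inter> (topspace X \<inter> ?I)"
    have "openin X (topspace X \<inter> ?I)"
    proof (cases "us = []")
      case False
      then have "openin X ?I" using us(2) sheetA openA by (intro openin_Inter) auto
      then show ?thesis by blast
    qed simp
    then have "openin X ?N" using U(1) by blast
    moreover have "x \<in> ?N" using U(2) \<open>x \<in> topspace X \<inter> ?I\<close> by blast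
    moreover have "up us y = up us x" if y: "y \<in> ?N \<inter> ?A" for y
    proof -
      have "map (sheet y) us = map (sheet x) us"
        by (rule map_cong[OF refl], rule sheet_eq) (use y us(2) in auto)
      moreover have "h (map (sheet x) us) y = h (map (sheet x) us) x" using U(3) y by blast
      ultimately show ?thesis unfolding up_def by (simp only:)
    qed
    ultimately show "\<exists>U. openin X U \<and> x \<in> U \<and> (\<forall>y\<in>U \<inter> ?A. up us y = up us x)" by blast
  qed
  have "cohomologous n ?B \<Q> (pullback_cochain id V z) (\<lambda>us x. 0)"
  proof (rule cohomologousI)
    show "down \<in> primitives n ?B \<Q>"
      unfolding primitives_def mem_Collect_eq
    proof (intro allI impI conjI)
      fix us assume us: "length us = n" "set us \<subseteq> \<Q>"
      show "locally_const ?B (\<Inter>(set us)) (down us)"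
      proof (rule locally_const_orbit_space[OF X])
        let ?A = "{x \<in> topspace X. orb S x \<in> \<Inter>(set us)}"
        have "locally_const X ?A (\<lambda>x. up us (S x))"
          using S(1) up_lc[OF us]
        proof (rule locally_const_compose)
          fix x assume "x \<in> ?A"
          then show "S x \<in> ?A"
            unfolding mem_Collect_eq using S(4) orb_involution[OF X] by metis
        qed
        from locally_const_combine[OF up_lc[OF us] this, of "(+)"]
        show "locally_const X ?A (\<lambda>x. down us (orb S x))"
          by (rule locally_const_cong) (simp add: down)
      qed
      have "h [] = (\<lambda>x. 0)" if "us = []" using h(1) us that by (simp add: primitives_def)
      then show "down us = (\<lambda>x. 0)" if "us = []" using that
        by (simp add: down_def up_def descend_def fun_eq_iff)
    qed
    fix us b assume us: "length us = Suc n" "set us \<subseteq> \<Q>" "b \<in> \<Inter>(set us)"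
    have "us \<noteq> []" using us(1) by auto
    then have l: "last us \<in> set us" by simp
    then obtain x where x: "x \<in> topspace X" "b = orb S x"
      using us open_cover_orbit_pointE[OF coverQ, of "last us" b] by blast
    have up: "z (map V us) b * \<epsilon> (V (last us)) y + g (map V us) b = coboundary h (map (sheet y) us) y"
      if y: "y \<in> topspace X" "orb S y = b" for y
    proof -
      let ?us = "map (sheet y) us"
      have A: "set ?us \<subseteq> \<A>" using us(2) sheetA by auto
      have "y \<in> \<Inter>(set ?us)" using us y mem_sheet by auto
      from h(2)[OF _ A this] have "coboundary h ?us y = pullback_cochain id \<rho> ?Z ?us y"
        using us(1) by simp
      also have "\<dots> = lift_cochain S \<epsilon> n z g (map \<rho> ?us) y"
        by (simp add: pullback_cochain_def)
      also have "\<dots> = z (map ((`) (orb S)) (map \<rho> ?us)) b * \<epsilon> (orb S ` last (map \<rho> ?us)) y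
          + g (map ((`) (orb S)) (map \<rho> ?us)) b"
        using us(1) unfolding y(2)[symmetric] by (intro lift_cochain_apply) simp
      also have "map ((`) (orb S)) (map \<rho> ?us) = map V us"
        unfolding map_map o_def
      proof (rule map_cong[OF refl])
        fix Q assume "Q \<in> set us"
        then have Q: "Q \<in> \<Q>" using us(2) by blast
        show "orb S ` \<rho> (sheet y Q) = V Q"
          unfolding \<rho>_def orb_sheet[OF Q] by (rule orb_image_lifted[OF D(1) P(4)[OF Q]])
      qed
      also have "orb S ` last (map \<rho> ?us) = V (last us)"
      proof -
        have Q: "last us \<in> \<Q>" using us(2) l by blast
        have "last (map \<rho> ?us) = \<rho> (sheet y (last us))"
          using \<open>us \<noteq> []\<close> by (simp add: last_map)
        then show ?thesis
          unfolding \<rho>_def orb_sheet[OF Q] by (simp only: orb_image_lifted[OF D(1) P(4)[OF Q]])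
      qed
      finally show ?thesis by (rule sym)
    qed
    have "b \<in> V (last us)" using us l P(5) by blast
    then have flip: "\<epsilon> (V (last us)) (S x) = \<epsilon> (V (last us)) x + 1"
      using us(2) l x P(4) by (intro D(3)) auto
    have Sx: "S x \<in> topspace X" "orb S (S x) = b"
      using S(4)[OF x(1)] orb_involution[OF X x(1)] x(2) by auto
    have "coboundary down us b = coboundary h (map (sheet x) us) x + coboundary h (map (sheet (S x)) us) (S x)"
      unfolding coboundary_def x(2) down[OF x(1)] up_def
      by (simp add: sum.distrib take_map drop_map)
    also have "\<dots> = z (map V us) b"
      unfolding up[OF Sx, symmetric] up[OF x(1) x(2)[symmetric], symmetric] flip
      by (simp add: algebra_simps)
    finally show "pullback_cochain id V z us b + 0 = coboundary down us b"
      by (simp add: pullback_cochain_def)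
  qed
  moreover have "cover_map id \<Q> \<V> V" using P(4,5) by (simp add: cover_map_def)
  ultimately show ?thesis unfolding cech_vanishes_def using coverQ by blast
qed

section \<open>Nilpotency and the index\<close>

lemma cohomologous_zeroE:
  assumes "cohomologous (Suc n) X \<U> a (\<lambda>us x. 0)"
  obtains g where "g \<in> cochains n X \<U>" "cochain_agree (Suc n) \<U> a (coboundary g)"
  using assms by (auto simp: cohomologous_iff primitives_Suc)

text \<open>
  Exactness of the Gysin sequence at \<open>H\<^sup>n(X/S)\<close>: the kernel of the product with \<open>w\<close> is the image of
  the transfer, which is zero if \<open>H\<^sup>n(X)\<close> is.
\<close>

lemma cup_w_injective:
  assumes X: "free_Z2_space X S" and w: "double_cover_signs X S \<V> \<epsilon> w"
    and H: "\<And>\<A> c. open_cover X \<A> \<Longrightarrow> c \<in> cocycles n X \<A> \<Longrightarrow> cech_vanishes n X \<A> c"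
    and z: "z \<in> cocycles n (orbit_space X S) \<V>"
    and van: "cech_vanishes (Suc n) (orbit_space X S) \<V> (cup_cochain n z w)"
  shows "cech_vanishes n (orbit_space X S) \<V> z"
proof -
  let ?B = "orbit_space X S"
  from van obtain \<W> r where W: "open_cover ?B \<W>" and r: "cover_map id \<W> \<V> r"
    and coh: "cohomologous (Suc n) ?B \<W> (pullback_cochain id r (cup_cochain n z w)) (\<lambda>us x. 0)"
    by (auto simp: cech_vanishes_def)
  from coh obtain g where g: "g \<in> cochains n ?B \<W>"
    "cochain_agree (Suc n) \<W> (cup_cochain n (pullback_cochain id r z) (pullback_cochain id r w)) (coboundary g)"
    unfolding pullback_cup by (rule cohomologous_zeroE)
  note w' = double_cover_signs_refine[OF w W r]
  have "pullback_cochain id r z \<in> cocycles n ?B \<W>"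
    by (rule cocycles_pullback[OF _ r z]) simp
  from lift_cochain_cocycle[OF w' this g]
  have "cech_vanishes n ?B \<W> (pullback_cochain id r z)"
    by (intro transfer[OF X w'] H open_cover_lifted W)
  with r show ?thesis by (rule cech_vanishes_refine)
qed

text \<open>
  In degrees above \<open>k = dim X\<close> the product with \<open>w\<close> is injective, and it is nilpotent if a power of
  \<open>w\<close> is zero. In this way the dimension of \<open>X/S\<close> need not be compared with that of \<open>X\<close>.
\<close>

lemma cup_w_vanishes:
  assumes X: "free_Z2_space X S" and dim: "covering_dim_le X (int k)"
    and w: "double_cover_signs X S \<V> \<epsilon> w"
    and z: "z \<in> cocycles k (orbit_space X S) \<V>"
    and van: "cech_vanishes (Suc k) (orbit_space X S) \<V> (sw_power w (Suc k))"
  shows "cech_vanishes (Suc k) (orbit_space X S) \<V> (cup_cochain k z w)"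
proof -
  let ?B = "orbit_space X S"
  note coc = double_cover_signs_cocycle[OF X w]
  define Q where "Q m \<longleftrightarrow> cech_vanishes (k + m) ?B \<V> (cup_cochain k z (sw_power w m))" for m
  have top: "Q (Suc k)"
  proof -
    from van obtain \<W> r where W: "open_cover ?B \<W>" and r: "cover_map id \<W> \<V> r"
      and coh: "cohomologous (Suc k) ?B \<W> (pullback_cochain id r (sw_power w (Suc k))) (\<lambda>us x. 0)"
      by (auto simp: cech_vanishes_def)
    have z': "pullback_cochain id r z \<in> cocycles k ?B \<W>"
      by (rule cocycles_pullback[OF _ r z]) simp
    have p': "pullback_cochain id r (sw_power w (Suc k)) \<in> cocycles (Suc k) ?B \<W>"
      by (rule cocycles_pullback[OF _ r sw_power_cocycle[OF coc]]) simp
    have "cohomologous (k + Suc k) ?B \<W> (cup_cochain k (pullback_cochain id r z)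
        (pullback_cochain id r (sw_power w (Suc k)))) (cup_cochain k (pullback_cochain id r z) (\<lambda>us x. 0))"
      by (rule cohomologous_cup[OF cohomologous_refl p' coh z'])
    then show ?thesis
      unfolding Q_def cech_vanishes_def pullback_cup cup_zero using W r by blast
  qed
  have step: "Q m" if "1 \<le> m" "Q (Suc m)" for m
  proof -
    have "cup_cochain k z (sw_power w (Suc m)) = cup_cochain (k + m) (cup_cochain k z (sw_power w m)) w"
      by (simp add: cup_cochain_assoc)
    with that(2) have 1: "cech_vanishes (Suc (k + m)) ?B \<V> (cup_cochain (k + m) (cup_cochain k z (sw_power w m)) w)"
      by (simp add: Q_def)
    have 2: "cup_cochain k z (sw_power w m) \<in> cocycles (k + m) ?B \<V>"
      by (rule cup_cocycles[OF z sw_power_cocycle[OF coc]])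
    have 3: "cech_vanishes (k + m) X \<A> c" if "open_cover X \<A>" "c \<in> cocycles (k + m) X \<A>" for \<A> c
      using dim _ that by (rule cech_vanishes_above_dim) (use \<open>1 \<le> m\<close> in simp)
    show ?thesis unfolding Q_def using 3 2 1 by (rule cup_w_injective[OF X w])
  qed
  have "1 \<le> Suc k" by simp
  then have "Q 1" using top by (rule inc_induct) (rule step)
  moreover have "sw_power w 1 = w" by (simp add: cup_cochain_def)
  ultimately show ?thesis by (simp add: Q_def)
qed

text \<open>
  If \<open>a = \<delta>d\<close>, then \<open>a \<union> \<epsilon> + e\<close> differs by the coboundary of \<open>d \<union> \<epsilon>\<close> from the pullback of
  \<open>z = d \<union> w + e\<close>: this is exactness of the Gysin sequence at \<open>H\<^sup>k(X)\<close>. In degree \<open>0\<close> the cochain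
  \<open>a\<close> is itself zero, and \<open>z = e\<close>.
\<close>

lemma lift_of_coboundary:
  assumes w: "double_cover_signs X S \<V> \<epsilon> w" and wc: "w \<in> cocycles 1 (orbit_space X S) \<V>"
    and a: "a \<in> cocycles k (orbit_space X S) \<V>" "cohomologous k (orbit_space X S) \<V> a (\<lambda>us x. 0)"
    and e: "e \<in> cochains k (orbit_space X S) \<V>" "cochain_agree (Suc k) \<V> (cup_cochain k a w) (coboundary e)"
  obtains z where "z \<in> cocycles k (orbit_space X S) \<V>"
    and "cohomologous k X (lifted_cover X S \<V>) (lift_cochain S \<epsilon> k a e) (lift_pullback S z)"
proof (cases k)
  case 0
  let ?B = "orbit_space X S" and ?L = "lifted_cover X S \<V>"
  have V: "open_cover ?B \<V>" using w by (rule double_cover_signsD)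
  have a0: "cochain_agree 0 \<V> a (\<lambda>us x. 0)" using a(2) by (simp add: cohomologous_def 0)
  have "cochain_agree (0 + 1) \<V> (cup_cochain 0 a w) (cup_cochain 0 (\<lambda>us x. 0) w)"
    by (rule cochain_agree_cup[OF a0]) (simp add: cochain_agree_iff)
  with e(2) have "cochain_agree (Suc k) \<V> (coboundary e) (\<lambda>us x. 0)"
    by (simp add: cup_zero cochain_agree_iff 0)
  with e(1) have e': "e \<in> cocycles k ?B \<V>" by (simp add: cocycles_iff)
  have "cochain_agree (0 + 0) ?L (cup_cochain 0 (lift_pullback S a) (sheet_coordinate S \<epsilon>))
      (cup_cochain 0 (lift_pullback S (\<lambda>us x. 0)) (sheet_coordinate S \<epsilon>))"
    by (rule cochain_agree_cup[OF cochain_agree_pullback[OF cover_map_orb[OF V] a0]])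
       (simp add: cochain_agree_iff)
  then have "cochain_agree k ?L (lift_cochain S \<epsilon> k a e) (lift_pullback S e)"
    by (simp add: lift_cochain_def cochain_agree_iff 0 pullback_const cup_zero)
  then show ?thesis using that e' cohomologous_agree by blast
next
  case (Suc m)
  let ?B = "orbit_space X S" and ?L = "lifted_cover X S \<V>"
  have V: "open_cover ?B \<V>" using w by (rule double_cover_signsD)
  from a(2) obtain d where d: "d \<in> cochains m ?B \<V>" "cochain_agree k \<V> a (coboundary d)"
    unfolding Suc by (rule cohomologous_zeroE)
  define z where "z us x = cup_cochain m d w us x + e us x" for us x
  have z: "z \<in> cocycles k ?B \<V>"
  proof -
    have "cup_cochain m d w \<in> cochains (m + 1) ?B \<V>"
      using d(1) wc by (intro cup_cochains) (simp_all add: cocycles_iff)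
    then have "z \<in> cochains k ?B \<V>"
      unfolding z_def[abs_def] using e(1) Suc by (intro cochains_add) simp_all
    moreover have "cochain_agree (k + 1) \<V> (cup_cochain k a w) (cup_cochain k (coboundary d) w)"
      by (rule cochain_agree_cup[OF d(2)]) (simp add: cochain_agree_iff)
    moreover have "cochain_agree (m + Suc 1) \<V> (cup_cochain m d (coboundary w)) (cup_cochain m d (\<lambda>us x. 0))"
      by (rule cochain_agree_cup) (use wc in \<open>simp_all add: cocycles_iff cochain_agree_iff\<close>)
    ultimately show ?thesis
      using coboundary_cup_agree[of m 1 \<V> d w] e(2)
      unfolding cocycles_iff z_def[abs_def] by (simp add: cochain_agree_iff coboundary_add Suc cup_zero)
  qed
  have "cohomologous k X ?L (lift_cochain S \<epsilon> k a e) (lift_pullback S z)"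
  proof -
    let ?E = "cup_cochain m (lift_pullback S d) (sheet_coordinate S \<epsilon>)"
    have "?E \<in> cochains (m + 0) X ?L"
      by (intro cup_cochains lift_pullback_cochains V d(1) sheet_coordinate_cochain[OF w])
    then have E: "?E \<in> primitives k X ?L" by (simp add: Suc primitives_Suc)
    have "cochain_agree (k + 0) ?L (cup_cochain k (lift_pullback S a) (sheet_coordinate S \<epsilon>))
        (cup_cochain k (lift_pullback S (coboundary d)) (sheet_coordinate S \<epsilon>))"
      by (rule cochain_agree_cup[OF cochain_agree_pullback[OF cover_map_orb[OF V] d(2)]])
         (simp add: cochain_agree_iff)
    with coboundary_cup_sheet_coordinate[OF w, of m d]
    have "cochain_agree k ?L (\<lambda>us x. lift_cochain S \<epsilon> k a e us x + lift_pullback S z us x) (coboundary ?E)"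
      unfolding lift_cochain_def z_def[abs_def] pullback_add
      by (simp add: cochain_agree_iff Suc ac_simps)
    with E show ?thesis unfolding cohomologous_iff by blast
  qed
  with z show ?thesis by (rule that)
qed

text \<open>
  Here \<open>w\<^sup>k\<close> is a coboundary, so that the class of its lift comes from a class \<open>z\<close> of \<open>X/S\<close>. Then \<open>z\<close>
  has a lift as well, which is zero or equal to the lift of \<open>w\<^sup>k\<close> because there is only one nonzero
  class on \<open>X\<close>. In both cases transfer shows that \<open>z\<close> is zero.
\<close>

lemma lift_of_sw_power_vanishes:
  assumes X: "free_Z2_space X S" and dim: "covering_dim_le X (int k)"
    and unique: "\<And>A C. A \<in> carrier (cech_cohomology k X) \<Longrightarrow> C \<in> carrier (cech_cohomology k X) \<Longrightarrow>
      A \<noteq> cech_zero k X \<Longrightarrow> C \<noteq> cech_zero k X \<Longrightarrow> A = C"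
    and w: "double_cover_signs X S \<V> \<epsilon> w"
    and e: "e \<in> cochains k (orbit_space X S) \<V>"
      "cochain_agree (Suc k) \<V> (sw_power w (Suc k)) (coboundary e)"
    and coh: "cohomologous k (orbit_space X S) \<V> (sw_power w k) (\<lambda>us x. 0)"
  shows "cech_vanishes k X (lifted_cover X S \<V>) (lift_cochain S \<epsilon> k (sw_power w k) e)"
proof (rule ccontr)
  let ?B = "orbit_space X S"
  assume nonzero: "\<not> cech_vanishes k X (lifted_cover X S \<V>) (lift_cochain S \<epsilon> k (sw_power w k) e)"
  have V: "open_cover ?B \<V>" using w by (rule double_cover_signsD)
  note coc = double_cover_signs_cocycle[OF X w]
  obtain z where z: "z \<in> cocycles k ?B \<V>"
    and coh_z: "cohomologous k X (lifted_cover X S \<V>) (lift_cochain S \<epsilon> k (sw_power w k) e) (lift_pullback S z)"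
    using lift_of_coboundary[OF w coc sw_power_cocycle[OF coc] coh e(1)] e(2) by auto
  \<comment> \<open>Nilpotency of \<open>w\<close> gives \<open>z \<union> w = \<delta>g\<close> on a finer cover \<open>\<W>\<close>, where \<open>z\<close> has a lift \<open>x\<close>; \<open>y\<close> is the
    lift of \<open>w\<^sup>k\<close> there.\<close>
  have "cohomologous (Suc k) ?B \<V> (sw_power w (Suc k)) (\<lambda>us x. 0)"
    unfolding cohomologous_iff primitives_Suc using e by auto
  then have "cech_vanishes (Suc k) ?B \<V> (cup_cochain k z w)"
    by (intro cup_w_vanishes[OF X dim w z] cech_vanishesI[OF V])
  then obtain \<W> r where W: "open_cover ?B \<W>" and r: "cover_map id \<W> \<V> r"
    and "cohomologous (Suc k) ?B \<W> (pullback_cochain id r (cup_cochain k z w)) (\<lambda>us x. 0)"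
    by (auto simp: cech_vanishes_def)
  then obtain g where g: "g \<in> cochains k ?B \<W>"
    "cochain_agree (Suc k) \<W> (cup_cochain k (pullback_cochain id r z) (pullback_cochain id r w)) (coboundary g)"
    unfolding pullback_cup by (elim cohomologous_zeroE)
  define \<epsilon>' where "\<epsilon>' = (\<lambda>W. \<epsilon> (r W))"
  define w' where "w' = pullback_cochain id r w"
  define z' where "z' = pullback_cochain id r z"
  define e' where "e' = pullback_cochain id r e"
  have w'_signs: "double_cover_signs X S \<W> \<epsilon>' w'"
    unfolding \<epsilon>'_def w'_def by (rule double_cover_signs_refine[OF w W r])
  note coc' = double_cover_signs_cocycle[OF X w'_signs]
  have z': "z' \<in> cocycles k ?B \<W>" unfolding z'_def by (rule cocycles_pullback[OF _ r z]) simp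
  have e'1: "e' \<in> cochains k ?B \<W>" unfolding e'_def by (rule cochains_pullback[OF _ r e(1)]) simp
  have e'2: "cochain_agree (Suc k) \<W> (cup_cochain k (sw_power w' k) w') (coboundary e')"
    using cochain_agree_pullback[OF r e(2)]
    unfolding pullback_sw_power w'_def e'_def coboundary_pullback by simp
  have coh': "cohomologous k ?B \<W> (sw_power w' k) (\<lambda>us x. 0)"
    using cohomologous_pullback[OF _ r coh] unfolding pullback_sw_power w'_def pullback_const by simp
  define L where "L = lifted_cover X S \<W>"
  have L: "open_cover X L" unfolding L_def by (rule open_cover_lifted[OF W])
  define x where "x = lift_cochain S \<epsilon>' k z' g"
  define y where "y = lift_cochain S \<epsilon>' k (sw_power w' k) e'"
  have x: "x \<in> cocycles k X L"
    unfolding x_def L_def by (rule lift_cochain_cocycle[OF w'_signs z' g(1)]) (use g(2) in \<open>simp add: z'_def w'_def\<close>)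
  have y: "y \<in> cocycles k X L"
    unfolding y_def L_def by (rule lift_cochain_cocycle[OF w'_signs sw_power_cocycle[OF coc'] e'1 e'2])
  have y_nonzero: "\<not> cech_vanishes k X L y"
    using nonzero lift_cochain_refine[OF V W r] unfolding y_def L_def \<epsilon>'_def w'_def e'_def pullback_sw_power[symmetric]
    by blast
  have "cech_vanishes k ?B \<W> z'"
  proof (cases "cech_vanishes k X L x")
    case True
    then show ?thesis using x unfolding x_def L_def by (rule transfer[OF X w'_signs, rotated])
  next
    case False
    then have "cech_class_of k X L x = cech_class_of k X L y"
      using y_nonzero x y L by (intro unique cech_class_of_carrier) (simp_all add: cech_class_zero_iff)
    \<comment> \<open>The sum of the two lifts is the lift of \<open>z + w\<^sup>k\<close>, and \<open>w\<^sup>k\<close> is a coboundary.\<close>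
    then have "cech_vanishes k X L (\<lambda>us p. x us p + y us p)"
      by (simp add: cech_class_eq_iff_vanishes L x y)
    moreover note cocycles_add[OF x y]
    moreover have "(\<lambda>us p. x us p + y us p) =
        lift_cochain S \<epsilon>' k (\<lambda>us b. z' us b + sw_power w' k us b) (\<lambda>us b. g us b + e' us b)"
      unfolding x_def y_def by (rule lift_cochain_add[symmetric])
    ultimately have "cech_vanishes k ?B \<W> (\<lambda>us b. z' us b + sw_power w' k us b)"
      unfolding L_def by (intro transfer[OF X w'_signs]) simp_all
    moreover have "cohomologous k ?B \<W> z' (\<lambda>us b. z' us b + sw_power w' k us b)"
      using cohomologous_add[OF cohomologous_refl cohomologous_sym[OF coh'], of z'] by simp
    ultimately show ?thesis by (rule cech_vanishes_cohomologous[rotated])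
  qed
  then have "cech_vanishes k ?B \<V> z"
    unfolding z'_def by (rule cech_vanishes_refine[OF r])
  then have "cech_vanishes k X (lifted_cover X S \<V>) (lift_pullback S z)"
    by (rule cech_vanishes_pullback[OF continuous_map_orb open_cover_lifted[OF V] cover_map_orb[OF V] z])
  with coh_z nonzero show False using cech_vanishes_cohomologous by blast
qed

text \<open>
  Contraposition of the preceding lemma, on a cover fine enough for \<open>w\<^sup>k\<close> to be a coboundary.
\<close>

lemma sw_power_nonvanishing:
  assumes X: "free_Z2_space X S" and dim: "covering_dim_le X (int k)"
    and unique: "\<And>A C. A \<in> carrier (cech_cohomology k X) \<Longrightarrow> C \<in> carrier (cech_cohomology k X) \<Longrightarrow>
      A \<noteq> cech_zero k X \<Longrightarrow> C \<noteq> cech_zero k X \<Longrightarrow> A = C"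
    and w: "double_cover_signs X S \<V> \<epsilon> w"
    and e: "e \<in> cochains k (orbit_space X S) \<V>"
      "cochain_agree (Suc k) \<V> (sw_power w (Suc k)) (coboundary e)"
    and nonzero: "\<not> cech_vanishes k X (lifted_cover X S \<V>) (lift_cochain S \<epsilon> k (sw_power w k) e)"
  shows "\<not> cech_vanishes k (orbit_space X S) \<V> (sw_power w k)"
proof
  let ?B = "orbit_space X S"
  assume "cech_vanishes k ?B \<V> (sw_power w k)"
  then obtain \<W> r where W: "open_cover ?B \<W>" and r: "cover_map id \<W> \<V> r"
    and coh: "cohomologous k ?B \<W> (pullback_cochain id r (sw_power w k)) (\<lambda>us x. 0)"
    by (auto simp: cech_vanishes_def)
  have V: "open_cover ?B \<V>" using w by (rule double_cover_signsD)
  have 1: "pullback_cochain id r e \<in> cochains k ?B \<W>" by (rule cochains_pullback[OF _ r e(1)]) simp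
  have 2: "cochain_agree (Suc k) \<W> (sw_power (pullback_cochain id r w) (Suc k))
      (coboundary (pullback_cochain id r e))"
    using cochain_agree_pullback[OF r e(2)] unfolding pullback_sw_power coboundary_pullback .
  have 3: "cohomologous k ?B \<W> (sw_power (pullback_cochain id r w) k) (\<lambda>us x. 0)"
    using coh unfolding pullback_sw_power .
  have "cech_vanishes k X (lifted_cover X S \<W>) (lift_cochain S (\<lambda>W. \<epsilon> (r W)) k
      (sw_power (pullback_cochain id r w) k) (pullback_cochain id r e))"
    using unique double_cover_signs_refine[OF w W r] 1 2 3
    by (rule lift_of_sw_power_vanishes[OF X dim])
  with nonzero lift_cochain_refine[OF V W r] show False
    unfolding pullback_sw_power[symmetric] by blast
qed

lemma iso_Z2_unique_nonzero:
  assumes "cech_cohomology k X \<cong> integer_mod_group 2"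
    and "A \<in> carrier (cech_cohomology k X)" "C \<in> carrier (cech_cohomology k X)"
    and "A \<noteq> cech_zero k X" "C \<noteq> cech_zero k X"
  shows "A = C"
proof -
  from assms(1) obtain h where "bij_betw h (carrier (cech_cohomology k X)) (carrier (integer_mod_group 2))"
    by (auto simp: is_iso_def iso_def)
  moreover have "carrier (integer_mod_group 2) = {0, 1}"
    by (auto simp: carrier_integer_mod_group)
  ultimately have "card (carrier (cech_cohomology k X)) = 2"
    by (simp add: bij_betw_same_card)
  moreover have "cech_zero k X \<in> carrier (cech_cohomology k X)"
    unfolding cech_zero_def by (rule cech_class_of_carrier[OF open_cover_topspace cocycles_zero])
  ultimately show ?thesis using assms(2-5) by (auto simp: card_2_iff)
qed

theorem theorem3p1:
  fixes X :: "'a topology" and Y :: "'b topology"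
    and S :: "'a \<Rightarrow> 'a" and T :: "'b \<Rightarrow> 'b"
    and f :: "'a \<Rightarrow> 'b" and k :: nat
  assumes "free_Z2_space X S"
    and "free_Z2_space Y T"
    and "continuous_map X Y f"
    and "\<forall>x\<in>topspace X. f (S x) = T (f x)"
    and "h_ind2 Y T = enat k"
    and "covering_dim X = ereal (real k)"
    and "cech_cohomology k X \<cong> integer_mod_group 2"
    and "cech_cohomology k Y \<cong> integer_mod_group 2"
    and "cech_induced k X Y f \<in> iso (cech_cohomology k Y) (cech_cohomology k X)"
  shows "h_ind2 X S = enat k"
proof -
  note X = assms(1) and Y = assms(2)
  let ?B = "orbit_space X S" and ?C = "orbit_space Y T"
  have f: "equivariant_map X S Y T f" using assms(3,4) by (simp add: equivariant_map_def)
  have ex: "\<exists>n. w_power_nonzero Y T n \<and> (\<forall>m. w_power_nonzero Y T m \<longrightarrow> m \<le> n)"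
    and k: "(GREATEST n. w_power_nonzero Y T n) = k"
    using assms(5) by (auto simp: h_ind2_def split: if_splits)
  from ex obtain n where n: "w_power_nonzero Y T n" "\<And>m. w_power_nonzero Y T m \<Longrightarrow> m \<le> n" by blast
  then have "(GREATEST n. w_power_nonzero Y T n) = n" by (rule Greatest_equality)
  with n k have Yk: "w_power_nonzero Y T k" "\<And>m. w_power_nonzero Y T m \<Longrightarrow> m \<le> k" by auto

  \<comment> \<open>On a fine cover of \<open>Y/T\<close> the cocycle \<open>w\<^sup>k\<^sup>+\<^sup>1\<close> is a coboundary, so that \<open>w\<^sup>k\<close> has a lift \<open>y\<close>;
    it is nonzero because its transfer is \<open>w\<^sup>k\<close>.\<close>
  obtain \<V>0 \<epsilon>0 w0 where w0: "double_cover_signs Y T \<V>0 \<epsilon>0 w0"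
    using double_cover_signs_exist[OF Y] .
  have "cech_vanishes (Suc k) ?C \<V>0 (sw_power w0 (Suc k))"
    using Yk(2)[of "Suc k"] w_power_nonzero_iff[OF Y w0] by auto
  then obtain \<V> r where V: "open_cover ?C \<V>" and r: "cover_map id \<V> \<V>0 r"
    and coh: "cohomologous (Suc k) ?C \<V> (pullback_cochain id r (sw_power w0 (Suc k))) (\<lambda>us x. 0)"
    by (auto simp: cech_vanishes_def)
  define \<epsilon> where "\<epsilon> = (\<lambda>V. \<epsilon>0 (r V))"
  define w where "w = pullback_cochain id r w0"
  have w: "double_cover_signs Y T \<V> \<epsilon> w"
    unfolding \<epsilon>_def w_def by (rule double_cover_signs_refine[OF w0 V r])
  note coc = double_cover_signs_cocycle[OF Y w]
  from coh obtain e where e: "e \<in> cochains k ?C \<V>"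
    "cochain_agree (Suc k) \<V> (sw_power w (Suc k)) (coboundary e)"
    unfolding pullback_sw_power w_def by (rule cohomologous_zeroE)
  define LY where "LY = lifted_cover Y T \<V>"
  define y where "y = lift_cochain T \<epsilon> k (sw_power w k) e"
  have LY: "open_cover Y LY" unfolding LY_def by (rule open_cover_lifted[OF V])
  have y: "y \<in> cocycles k Y LY"
    unfolding y_def LY_def
    by (rule lift_cochain_cocycle[OF w sw_power_cocycle[OF coc] e(1)]) (use e(2) in simp)
  have y_nonzero: "\<not> cech_vanishes k Y LY y"
  proof
    assume "cech_vanishes k Y LY y"
    then have "cech_vanishes k ?C \<V> (sw_power w k)"
      using y unfolding y_def LY_def by (intro transfer[OF Y w])
    then show False using Yk(1) w_power_nonzero_iff[OF Y w] by simp
  qed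

  \<comment> \<open>The pullback of \<open>y\<close> under \<open>f\<close> is the lift of \<open>w\<^sup>k\<close> for \<open>X\<close>; it is nonzero as \<open>f\<close> induces an
    injective map.\<close>
  define \<U> where "\<U> = preimage_cover ?B ((`) f) \<V>"
  have U: "open_cover ?B \<U>"
    unfolding \<U>_def by (rule open_cover_preimage[OF continuous_map_orbit_spaces[OF f] V])
  obtain \<phi> where \<phi>: "cover_map ((`) f) \<U> \<V> \<phi>"
    unfolding \<U>_def using cover_map_preimage by blast
  note wX = double_cover_signs_pullback[OF f w U \<phi>]
  let ?w = "pullback_cochain ((`) f) \<phi> w" and ?e = "pullback_cochain ((`) f) \<phi> e"
  let ?\<epsilon> = "\<lambda>U x. \<epsilon> (\<phi> U) (f x)"
  have eX: "?e \<in> cochains k ?B \<U>" "cochain_agree (Suc k) \<U> (sw_power ?w (Suc k)) (coboundary ?e)"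
    using cochains_pullback[OF continuous_map_orbit_spaces[OF f] \<phi> e(1)] cochain_agree_pullback[OF \<phi> e(2)]
    unfolding pullback_sw_power coboundary_pullback by auto
  define LX where "LX = lifted_cover X S \<U>"
  have LX: "open_cover X LX" unfolding LX_def by (rule open_cover_lifted[OF U])
  obtain \<psi> where \<psi>: "cover_map f LX LY \<psi>"
    and agree: "cochain_agree k LX (pullback_cochain f \<psi> y) (lift_cochain S ?\<epsilon> k (sw_power ?w k) ?e)"
    using lift_cochain_natural[OF f U V \<phi>] unfolding LX_def LY_def y_def pullback_sw_power[symmetric] by blast
  have "\<not> cech_vanishes k X LX (pullback_cochain f \<psi> y)"
  proof -
    have ind: "cech_induced k X Y f (cech_class_of k Y LY c) = cech_class_of k X LX (pullback_cochain f \<psi> c)"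
      if "c \<in> cocycles k Y LY" for c
      by (rule cech_induced_class[OF assms(3) LY that LX \<psi>])
    have "inj_on (cech_induced k X Y f) (carrier (cech_cohomology k Y))"
      using assms(9) by (auto simp: iso_def bij_betw_def)
    moreover have "cech_class_of k Y LY y \<noteq> cech_class_of k Y LY (\<lambda>us x. 0)"
      using y_nonzero cech_class_zero_iff[OF LY y] cech_zero_eq[OF LY] by metis
    ultimately have "cech_class_of k X LX (pullback_cochain f \<psi> y) \<noteq> cech_class_of k X LX (\<lambda>us x. 0)"
      using ind[OF y] ind[OF cocycles_zero] cech_class_of_carrier[OF LY y] cech_class_of_carrier[OF LY cocycles_zero]
      unfolding pullback_const inj_on_def by metis
    then show ?thesis
      using cech_class_zero_iff[OF LX cocycles_pullback[OF assms(3) \<psi> y]] cech_zero_eq[OF LX] by metis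
  qed
  then have lift_nonzero: "\<not> cech_vanishes k X LX (lift_cochain S ?\<epsilon> k (sw_power ?w k) ?e)"
    using cech_vanishes_agree[OF agree] by blast
  have "\<not> cech_vanishes k ?B \<U> (sw_power ?w k)"
    by (rule sw_power_nonvanishing[OF X covering_dim_eqD[OF assms(6)] iso_Z2_unique_nonzero[OF assms(7)] wX eX])
       (use lift_nonzero in \<open>simp_all add: LX_def\<close>)
  then have Xk: "w_power_nonzero X S k" by (simp add: w_power_nonzero_iff[OF X wX])
  \<comment> \<open>Higher powers are pulled back from \<open>Y/T\<close>, where they are zero.\<close>
  have Xm: "m \<le> k" if "w_power_nonzero X S m" for m
  proof (rule ccontr)
    assume "\<not> m \<le> k"
    then have "cech_vanishes m ?C \<V> (sw_power w m)"
      using Yk(2)[of m] w_power_nonzero_iff[OF Y w] by auto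
    then have "cech_vanishes m ?B \<U> (pullback_cochain ((`) f) \<phi> (sw_power w m))"
      by (rule cech_vanishes_pullback[OF continuous_map_orbit_spaces[OF f] U \<phi> sw_power_cocycle[OF coc]])
    with that show False
      by (simp add: w_power_nonzero_iff[OF X wX] pullback_sw_power)
  qed
  have "(GREATEST n. w_power_nonzero X S n) = k" using Xk Xm by (rule Greatest_equality)
  then show ?thesis using Xk Xm unfolding h_ind2_def by auto
qed

end
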